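(* Let $(X_i,Y_i)$, $i=1,\dots,n$, be an i.i.d. sample from $(X,Y)$ with $X\in\mathbb R^d$ having a continuous distribution $\mathbb Q$ with support $\mathcal X$, and $E(Y|X)=\Psi_0(\alpha_0^TX)$ almost surely, where $\alpha_0\in\mathcal S_{d-1}$ is identifiable and $\Psi_0$ is non-decreasing. Let $g_0(x)=\Psi_0(\alpha_0^Tx)$. Consider the conditions: (A1) $\mathcal X$ is a bounded convex subset of $\mathbb R^d$; (A2) there exists $K_0>0$ such that $|g_0(x)|\le K_0$ for all $x\in\mathcal X$; (A3) there exist $a_0>0$, $M>0$ such that $\int|y|^s\,d\mathbb P_x(y)\le a_0\,s!\,M^{s-2}$ for all integers $s\ge2$ and all $x\in\mathcal X$, where $\mathbb P_x$ is the conditional distribution of $Y$ given $X=x$; (A4) there exist $\overline q>0$ and $\underline q>0$ such that for all $\alpha\in\mathcal S_{d-1}$ the variable $\alpha^TX$ has a density with respect to Lebesgue measure that is bounded from above by $\overline q$ and bounded from below by $\underline q$ on its support $\mathcal C_\alpha$; (A5) there exists an interior point $z_0\in\mathcal C_{\alpha_0}$ such that $\Psi_0$ is continuously differentiable in a neighborhood of $z_0$, with $\Psi_0'(z_0)>0$; (A6) the density $q$ of $X$ (with respect to Lebesgue measure) is continuous on $\mathcal X$. Assume (A1)-(A4). Assume, moreover, that $\Psi_0$ is non-constant and Lipschitz continuous, and that the index estimator $\tilde\alpha_n\in\mathcal S_{d-1}$, computed from the first sub-sample, satisfies $\tilde\alpha_n=\alpha_0+O_p(n^{-1/3})$. Then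 the plug-in estimator $\tilde g_n(x)=\tilde\Psi_n(\tilde\alpha_n^Tx)$ satisfies $$\left(\int_{\mathcal X}(\tilde g_n(x)-g_0(x))^2\,dx\right)^{1/2}=O_p(n^{-1/3}).$$ Furthermore, if (A1)-(A6) hold and $\Psi_0$ has a first derivative that is bounded from above on $\mathcal C_{\alpha_0}$, then $$\left(\int_{\underline c+v_n}^{\overline c-v_n}(\tilde\Psi_n(t)-\Psi_0(t))^2\,dt\right)^{1/2}=O_p(n^{-1/3})$$ for all sequences $v_n$ such that $n^{1/3}v_n\to\infty$ and $\underline c+v_n\le\overline c-v_n$, where $\underline c=\inf\mathcal C_{\alpha_0}$ and $\overline c=\sup\mathcal C_{\alpha_0}$.
   Context: $\mathcal S_{d-1}$ is the Euclidean unit sphere of $\mathbb R^d$; $\mathcal M$ is the class of non-decreasing functions on $\mathbb R$; $\mathcal C_\alpha=\{\alpha^Tx:x\in\mathcal X\}$ (an interval). Plug-in estimator: fix $p\in(0,1)$ and randomly split the sample into two independent sub-samples of sizes $n_1$, the integer part of $pn$, and $n_2=n-n_1$; let $I_2$ be the set of indices in the second sub-sample. The estimator $\tilde\alpha_n$ is a function of the first sub-sample only. $\tilde\Psi_n$ is a minimizer over $\Psi\in\mathcal M$ of $\sum_{i\in I_2}\{Y_i-\Psi(\tilde\alpha_n^TX_i)\}^2$ (its values at the points $\tilde\alpha_n^TX_i$, $i\in I_2$, are uniquely determined), extended as a constant to the left of the smallest and to the right of the largest of these points. Identifiability of $\alpha_0$ means that $\alpha_0$ is the only index in $\mathcal S_{d-1}$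 for which the regression function has the stated monotone single index form. *)

theory Defs
  imports "HOL-Probability.Probability"
begin

text \<open>
  The joint law of \<open>(X, Y)\<close> is a probability measure \<open>P\<close> on the Borel sets of
  \<open>real ^ 'd \<times> real\<close>; on that space \<open>X = fst\<close> and \<open>Y = snd\<close>.
\<close>

subsection \<open>Stochastic boundedness\<close>

text \<open>
  \<open>Z n = O_p(r n)\<close>.  The event is asked to contain a measurable set of large probability,
  because an isotonic least squares fit is only determined at the design points, so that
  \<open>Z n\<close> need not be measurable.  For measurable \<open>Z n\<close> this is the usual notion, see
  \<open>O_p_iff_measurable\<close> below.
\<close>

definition O_p :: "'w measure \<Rightarrow> (nat \<Rightarrow> 'w \<Rightarrow> 'b::real_normed_vector) \<Rightarrow> (nat \<Rightarrow> real) \<Rightarrow> bool" where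
  "O_p M Z r \<longleftrightarrow> (\<forall>\<epsilon>>0. \<exists>C. \<forall>\<^sub>F n in sequentially.
     \<exists>E\<in>sets M. measure M E \<ge> 1 - \<epsilon> \<and> (\<forall>\<omega>\<in>E. norm (Z n \<omega>) \<le> C * r n))"

lemma O_p_iff_measurable:
  fixes Z :: "nat \<Rightarrow> 'w \<Rightarrow> 'b::real_normed_vector"
  assumes "prob_space M" and meas: "\<And>n. (\<lambda>\<omega>. norm (Z n \<omega>)) \<in> borel_measurable M"
  shows "O_p M Z r \<longleftrightarrow> (\<forall>\<epsilon>>0. \<exists>C. \<forall>\<^sub>F n in sequentially.
     measure M {\<omega> \<in> space M. norm (Z n \<omega>) > C * r n} \<le> \<epsilon>)"
proof -
  interpret prob_space M by fact
  note meas [measurable]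
  have "(\<exists>E\<in>sets M. measure M E \<ge> 1 - \<epsilon> \<and> (\<forall>\<omega>\<in>E. norm (Z n \<omega>) \<le> b)) \<longleftrightarrow>
      measure M {\<omega> \<in> space M. norm (Z n \<omega>) > b} \<le> \<epsilon>" (is "?L \<longleftrightarrow> ?R") for \<epsilon> n b
  proof -
    let ?G = "{\<omega> \<in> space M. norm (Z n \<omega>) \<le> b}"
    have G: "?G \<in> sets M" by measurable
    have c: "{\<omega> \<in> space M. norm (Z n \<omega>) > b} = space M - ?G" by auto
    have eq: "measure M {\<omega> \<in> space M. norm (Z n \<omega>) > b} = 1 - measure M ?G"
      unfolding c by (rule prob_compl[OF G])
    show ?thesis
    proof
      assume ?L
      then obtain E where E: "E \<in> sets M" "measure M E \<ge> 1 - \<epsilon>" "\<forall>\<omega>\<in>E. norm (Z n \<omega>) \<le> b"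
        by blast
      have "E \<subseteq> ?G" using E sets.sets_into_space by blast
      then have "measure M E \<le> measure M ?G" by (rule finite_measure_mono[OF _ G])
      then show ?R using E(2) eq by linarith
    next
      assume ?R
      then show ?L using eq G by (intro bexI[of _ ?G]) auto
    qed
  qed
  then show ?thesis unfolding O_p_def by simp
qed

subsection \<open>The monotone single index model\<close>

definition design_law :: "((real ^ 'd) \<times> real) measure \<Rightarrow> (real ^ 'd) measure" where
  "design_law P = distr P borel fst"

definition topological_support :: "'a::topological_space measure \<Rightarrow> 'a set" where
  "topological_support Q = {x. \<forall>U. open U \<and> x \<in> U \<longrightarrow> emeasure Q U > 0}"

text \<open>
  A support of \<open>Q\<close> is a set carrying all of \<open>Q\<close> whose closure is the topological support.
  The topological support itself is one, see \<open>is_support_topological_support\<close>.  Sets that are not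
  closed are admitted because, for a closed bounded convex set in dimension at least two, a density
  that is continuous on the set is bounded, and then the densities of the projections cannot be
  bounded away from zero.
\<close>

definition is_support :: "'a::topological_space measure \<Rightarrow> 'a set \<Rightarrow> bool" where
  "is_support Q S \<longleftrightarrow> closure S = topological_support Q \<and> (AE x in Q. x \<in> S)"

lemma is_support_topological_support:
  fixes Q :: "'a::second_countable_topology measure"
  assumes sets: "sets Q = sets borel"
  shows "is_support Q (topological_support Q)"
proof -
  let ?N = "{U. open U \<and> emeasure Q U = 0}"
  have compl: "- topological_support Q = \<Union>?N"
    by (auto simp: topological_support_def)
  obtain F where F: "F \<subseteq> ?N" "countable F" "\<Union>F = \<Union>?N"
    using Lindelof[of ?N] by auto
  have "\<Union>F \<in> null_sets Q"
    using F(1,2) sets by (intro null_sets_UN'[of F "\<lambda>U. U" Q, simplified]) (auto simp: null_sets_def)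
  then have "AE x in Q. x \<notin> - topological_support Q"
    unfolding compl F(3)[symmetric] by (rule AE_not_in)
  moreover have "closed (topological_support Q)"
    unfolding closed_def compl by (rule open_Union) auto
  ultimately show ?thesis by (simp add: is_support_def)
qed

definition index_range :: "(real ^ 'd) set \<Rightarrow> real ^ 'd \<Rightarrow> real set" where
  "index_range S \<alpha> = (\<lambda>x. \<alpha> \<bullet> x) ` S"

text \<open>\<open>E(Y | X) = \<Psi>(\<alpha>\<^sup>T X)\<close> almost surely, with \<open>\<Psi>\<close> non-decreasing.\<close>

definition monotone_single_index ::
    "((real ^ 'd) \<times> real) measure \<Rightarrow> (real \<Rightarrow> real) \<Rightarrow> real ^ 'd \<Rightarrow> bool" where
  "monotone_single_index P \<Psi> \<alpha> \<longleftrightarrow> integrable P snd \<and> mono \<Psi> \<and>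
     (AE z in P. real_cond_exp P (vimage_algebra (space P) fst borel) snd z = \<Psi> (\<alpha> \<bullet> fst z))"

definition identifiable_index :: "((real ^ 'd) \<times> real) measure \<Rightarrow> real ^ 'd \<Rightarrow> bool" where
  "identifiable_index P \<alpha>0 \<longleftrightarrow>
     (\<forall>\<alpha>\<in>sphere 0 1. (\<exists>\<Psi>. monotone_single_index P \<Psi> \<alpha>) \<longrightarrow> \<alpha> = \<alpha>0)"

text \<open>\<open>\<kappa> x\<close> is (a version of) the conditional distribution of \<open>Y\<close> given \<open>X = x\<close>.\<close>

definition is_conditional_law ::
    "((real ^ 'd) \<times> real) measure \<Rightarrow> (real ^ 'd \<Rightarrow> real measure) \<Rightarrow> bool" where
  "is_conditional_law P \<kappa> \<longleftrightarrow> \<kappa> \<in> measurable borel (prob_algebra borel) \<and>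
     (\<forall>A\<in>sets borel. \<forall>B\<in>sets borel.
        emeasure P (A \<times> B) = (\<integral>\<^sup>+x\<in>A. emeasure (\<kappa> x) B \<partial>design_law P))"

subsection \<open>The conditions\<close>

definition A1 :: "(real ^ 'd) set \<Rightarrow> bool" where
  "A1 S \<longleftrightarrow> bounded S \<and> convex S"

definition A2 :: "(real ^ 'd) set \<Rightarrow> (real ^ 'd \<Rightarrow> real) \<Rightarrow> bool" where
  "A2 S g0 \<longleftrightarrow> (\<exists>K0>0. \<forall>x\<in>S. \<bar>g0 x\<bar> \<le> K0)"

definition A3 :: "(real ^ 'd) set \<Rightarrow> (real ^ 'd \<Rightarrow> real measure) \<Rightarrow> bool" where
  "A3 S \<kappa> \<longleftrightarrow> (\<exists>a0>0. \<exists>B>0. \<forall>s\<ge>2. \<forall>x\<in>S.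
     (\<integral>\<^sup>+y. ennreal (\<bar>y\<bar> ^ s) \<partial>\<kappa> x) \<le> ennreal (a0 * fact s * B ^ (s - 2)))"

definition A4 :: "(real ^ 'd) set \<Rightarrow> ((real ^ 'd) \<times> real) measure \<Rightarrow> bool" where
  "A4 S P \<longleftrightarrow> (\<exists>q_up>0. \<exists>q_low>0. \<forall>\<alpha>\<in>sphere 0 1. \<exists>f :: real \<Rightarrow> real.
     distributed P lborel (\<lambda>z. \<alpha> \<bullet> fst z) (\<lambda>t. ennreal (f t)) \<and>
     (\<forall>t. 0 \<le> f t \<and> f t \<le> q_up) \<and> (\<forall>t\<in>index_range S \<alpha>. q_low \<le> f t))"

definition A5 :: "(real ^ 'd) set \<Rightarrow> (real \<Rightarrow> real) \<Rightarrow> real ^ 'd \<Rightarrow> bool" where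
  "A5 S \<Psi>0 \<alpha>0 \<longleftrightarrow> (\<exists>z0 \<in> interior (index_range S \<alpha>0). \<exists>U D. open U \<and> z0 \<in> U \<and>
     (\<forall>t\<in>U. (\<Psi>0 has_real_derivative D t) (at t)) \<and> continuous_on U D \<and> D z0 > 0)"

definition has_lebesgue_density :: "((real ^ 'd) \<times> real) measure \<Rightarrow> (real ^ 'd \<Rightarrow> real) \<Rightarrow> bool" where
  "has_lebesgue_density P q \<longleftrightarrow> (\<forall>x. 0 \<le> q x) \<and> distributed P lborel fst (\<lambda>x. ennreal (q x))"

definition A6 :: "(real ^ 'd) set \<Rightarrow> ((real ^ 'd) \<times> real) measure \<Rightarrow> bool" where
  "A6 S P \<longleftrightarrow> (\<exists>q. has_lebesgue_density P q \<and> continuous_on S q)"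

subsection \<open>Sampling, splitting and the plug-in estimator\<close>

text \<open>The sample of size \<open>n\<close> consists of the first \<open>n\<close> pairs \<open>(X i, Y i)\<close>, \<open>i = 1, \<dots>, n\<close>.\<close>

definition iid_sample :: "'w measure \<Rightarrow> ((real ^ 'd) \<times> real) measure \<Rightarrow>
    (nat \<Rightarrow> 'w \<Rightarrow> real ^ 'd) \<Rightarrow> (nat \<Rightarrow> 'w \<Rightarrow> real) \<Rightarrow> bool" where
  "iid_sample M P X Y \<longleftrightarrow>
     prob_space.indep_vars M (\<lambda>_. borel) (\<lambda>i \<omega>. (X i \<omega>, Y i \<omega>)) {1..} \<and>
     (\<forall>i\<ge>1. distr M borel (\<lambda>\<omega>. (X i \<omega>, Y i \<omega>)) = P)"

definition first_index_sets :: "real \<Rightarrow> nat \<Rightarrow> nat set set" where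
  "first_index_sets p n = {J. J \<subseteq> {1..n} \<and> card J = nat \<lfloor>p * real n\<rfloor>}"

text \<open>
  \<open>I1 n\<close> is the random index set of the first sub-sample: uniformly distributed among the subsets
  of \<open>{1..n}\<close> of the prescribed size, and independent of the sample.  The second sub-sample has the
  index set \<open>{1..n} - I1 n \<omega>\<close>.
\<close>

definition random_split :: "'w measure \<Rightarrow> real \<Rightarrow> (nat \<Rightarrow> 'w \<Rightarrow> real ^ 'd) \<Rightarrow> (nat \<Rightarrow> 'w \<Rightarrow> real) \<Rightarrow>
    (nat \<Rightarrow> 'w \<Rightarrow> nat set) \<Rightarrow> bool" where
  "random_split M p X Y I1 \<longleftrightarrow> (\<forall>n\<ge>1.
     I1 n \<in> measurable M (count_space (first_index_sets p n)) \<and>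
     distr M (count_space (first_index_sets p n)) (I1 n) = uniform_count_measure (first_index_sets p n) \<and>
     prob_space.indep_set M
       (sets (vimage_algebra (space M) (I1 n) (count_space (first_index_sets p n))))
       (sets (vimage_algebra (space M) (\<lambda>\<omega>. \<lambda>i\<in>{1..n}. (X i \<omega>, Y i \<omega>)) (Pi\<^sub>M {1..n} (\<lambda>_. borel)))))"

definition first_subsample_estimator :: "'w measure \<Rightarrow> real \<Rightarrow> (nat \<Rightarrow> 'w \<Rightarrow> real ^ 'd) \<Rightarrow>
    (nat \<Rightarrow> 'w \<Rightarrow> real) \<Rightarrow> (nat \<Rightarrow> 'w \<Rightarrow> nat set) \<Rightarrow> (nat \<Rightarrow> 'w \<Rightarrow> real ^ 'd) \<Rightarrow> bool" where
  "first_subsample_estimator M p X Y I1 \<alpha>' \<longleftrightarrow>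
     (\<exists>T :: nat \<Rightarrow> nat set \<Rightarrow> (nat \<Rightarrow> (real ^ 'd) \<times> real) \<Rightarrow> real ^ 'd.
        \<forall>n\<ge>1. (\<forall>J\<in>first_index_sets p n. T n J \<in> measurable (Pi\<^sub>M J (\<lambda>_. borel)) borel) \<and>
          (\<forall>\<omega>\<in>space M. \<alpha>' n \<omega> = T n (I1 n \<omega>) (\<lambda>i\<in>I1 n \<omega>. (X i \<omega>, Y i \<omega>))))"

text \<open>
  \<open>\<Psi>\<close> minimises the sum of squares over all non-decreasing functions and is constant to the left
  and to the right of the design points; between design points the choice of \<open>\<Psi>\<close> is left open.
\<close>

definition monotone_lse :: "nat set \<Rightarrow> (nat \<Rightarrow> real) \<Rightarrow> (nat \<Rightarrow> real) \<Rightarrow> (real \<Rightarrow> real) \<Rightarrow> bool" where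
  "monotone_lse J t y \<Psi> \<longleftrightarrow>
     is_arg_min (\<lambda>\<Phi>. \<Sum>i\<in>J. (y i - \<Phi> (t i))\<^sup>2) mono \<Psi> \<and>
     (\<forall>u \<le> Min (t ` J). \<Psi> u = \<Psi> (Min (t ` J))) \<and>
     (\<forall>u \<ge> Max (t ` J). \<Psi> u = \<Psi> (Max (t ` J)))"

end

theory Submission
  imports Defs
begin

text \<open>
  Why the rates hold.  Given the split and the first sub-sample, the estimated index is a fixed
  unit vector \<open>\<alpha>\<close>, and the projections \<open>t\<^sub>i = \<alpha>\<^sup>T X\<^sub>i\<close> of the second sub-sample are independent with a
  density between two positive constants on the interval \<open>C\<^sub>\<alpha>\<close>.  The link \<open>\<Psi>\<^sub>0\<close> agrees on the range of
  \<open>\<alpha>\<^sub>0\<^sup>T X\<close> with a non-decreasing \<open>L\<close>-Lipschitz function \<open>\<psi>\<close> on the line, and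
  \<open>\<bar>\<Psi>\<^sub>0(\<alpha>\<^sub>0\<^sup>T x) - \<psi>(\<alpha>\<^sup>T x)\<bar> \<le> L R \<bar>\<alpha> - \<alpha>\<^sub>0\<bar>\<close> for \<open>\<bar>x\<bar> \<le> R\<close>.  So \<open>\<Psi>'\<close> is an isotonic least squares fit to
  observations of \<open>\<psi>(t\<^sub>i)\<close> with centred noise and a bias \<open>\<delta>\<close> of order \<open>n\<^sup>-\<^sup>1\<^sup>/\<^sup>3\<close>.

  Such a fit is controlled by means of the noise.  If the window \<open>[a, b]\<close> contains \<open>N\<close> design points
  and \<open>s \<le> a\<close>, then \<open>\<Psi>'(s) - \<psi>(s) \<le> L (b - s) + \<delta> + D\<close>, where \<open>D\<close> is the largest absolute mean of the
  noise over windows with right end \<open>b\<close> and at least \<open>N\<close> points; this is one half of the min-max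
  formula (\<open>isotonic_lse_le_max_window_mean\<close>).  Taken in decreasing order of the design points the
  noise is a martingale difference sequence, so Kronecker summation (\<open>max_window_mean_le\<close>) and a
  pathwise form of Doob's inequality (\<open>pathwise_doob\<close>) give \<open>E D\<^sup>2 \<le> 32 v / N\<close>, with \<open>v\<close> a bound on the
  conditional second moments of the noise (\<open>max_window_mean_second_moment\<close>).  Since the loss is an
  integral, such second moments, one for each piece of the range of integration, are all it takes.

  Cut \<open>C\<^sub>\<alpha>\<close> into \<open>K \<approx> n\<^sup>1\<^sup>/\<^sup>3\<close> cells.  By Chebyshev all of them contain at least a multiple of \<open>n\<^sup>2\<^sup>/\<^sup>3\<close>
  points, up to an event of probability \<open>O(n\<^sup>-\<^sup>1\<^sup>/\<^sup>3)\<close>.  On each cell but the last one, the next cell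
  serves as window and the expected squared error is \<open>O(n\<^sup>-\<^sup>2\<^sup>/\<^sup>3)\<close>.  On the last cell the window is its
  end piece of length about \<open>n\<^sup>-\<^sup>2\<^sup>/\<^sup>3\<close>, with about \<open>n\<^sup>1\<^sup>/\<^sup>3\<close> points: a squared error \<open>O(n\<^sup>-\<^sup>1\<^sup>/\<^sup>3)\<close> on a
  length \<open>O(n\<^sup>-\<^sup>1\<^sup>/\<^sup>3)\<close>.  On the end piece itself a squared error \<open>O(1)\<close> is affordable.  So the integrated squared
  excess of \<open>\<Psi>'\<close> over \<open>\<psi>\<close> is \<open>O(n\<^sup>-\<^sup>2\<^sup>/\<^sup>3)\<close> in mean.  The reflection \<open>\<alpha> \<mapsto> -\<alpha>\<close> turns this into the
  opposite bound, and Markov's inequality yields \<open>plug_in_lse_rate\<close>.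

  For the first claim, \<open>\<integral>\<^sub>S h(\<alpha>\<^sup>T x) dx\<close> is at most a constant times \<open>\<integral> h(t) dt\<close>
  (\<open>nn_integral_projection_le\<close>).  For the second one, the end points of \<open>C\<^sub>\<alpha>\<close> are Lipschitz in \<open>\<alpha>\<close>, so
  the interval of integration eventually lies in \<open>C\<^sub>\<alpha>\<close>, for \<open>\<alpha>\<close> the estimated index, as well as in
  the interior of the range of \<open>\<alpha>\<^sub>0\<^sup>T X\<close>, where \<open>\<psi> = \<Psi>\<^sub>0\<close>.
\<close>

section \<open>Isotonic least squares and means over windows\<close>

definition window :: "'i set \<Rightarrow> ('i \<Rightarrow> real) \<Rightarrow> real \<Rightarrow> real \<Rightarrow> 'i set" where
  "window J t u b = {i \<in> J. u \<le> t i \<and> t i \<le> b}"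

lemma finite_window [simp]: "finite J \<Longrightarrow> finite (window J t u b)"
  by (simp add: window_def)

lemma exists_argmin:
  fixes t :: "'i \<Rightarrow> real"
  assumes "finite A" "A \<noteq> {}"
  obtains m where "m \<in> A" "\<And>i. i \<in> A \<Longrightarrow> t m \<le> t i"
proof -
  have "Min (t ` A) \<in> t ` A" using assms by (intro Min_in) auto
  then obtain m where "m \<in> A" "t m = Min (t ` A)" by auto
  then show ?thesis using assms that[of m] by simp
qed

text \<open>
  Lower the fit by a small \<open>\<eta>\<close> at the design points up to \<open>b\<close> where it is at least \<open>c\<close>.  For \<open>\<eta>\<close> below
  the gap to the fitted values under \<open>c\<close> the result is still non-decreasing, so the sum of squares
  cannot drop; the derivative of the sum of squares at \<open>\<eta> = 0\<close> is twice the sum below.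
\<close>

lemma isotonic_lse_level_sum:
  fixes t y :: "'i \<Rightarrow> real"
  assumes J: "finite J" and lse: "is_arg_min (\<lambda>\<Phi>. \<Sum>i\<in>J. (y i - \<Phi> (t i))\<^sup>2) mono \<Psi>"
  shows "0 \<le> (\<Sum>i\<in>{i \<in> J. t i \<le> b \<and> c \<le> \<Psi> (t i)}. y i - \<Psi> (t i))" (is "0 \<le> ?s")
proof (rule ccontr)
  assume neg: "\<not> 0 \<le> ?s"
  define U where "U = {i \<in> J. t i \<le> b \<and> c \<le> \<Psi> (t i)}"
  have mono: "mono \<Psi>" using lse by (simp add: is_arg_min_def)
  define \<eta>0 where "\<eta>0 = Min (insert 1 ((\<lambda>i. c - \<Psi> (t i)) ` {i \<in> J. \<Psi> (t i) < c}))"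
  have \<eta>0: "\<eta>0 > 0" "\<And>i. i \<in> J \<Longrightarrow> \<Psi> (t i) < c \<Longrightarrow> \<Psi> (t i) \<le> c - \<eta>0"
  proof -
    show "\<eta>0 > 0" unfolding \<eta>0_def using J by (subst Min_gr_iff) auto
    fix i assume "i \<in> J" "\<Psi> (t i) < c"
    then have "\<eta>0 \<le> c - \<Psi> (t i)" unfolding \<eta>0_def using J by (intro Min_le) auto
    then show "\<Psi> (t i) \<le> c - \<eta>0" by simp
  qed
  have key: "0 \<le> 2 * \<eta> * ?s + \<eta>\<^sup>2 * real (card U)" if \<eta>: "0 < \<eta>" "\<eta> \<le> \<eta>0" for \<eta>
  proof -
    \<comment> \<open>Values above \<open>c\<close> drop by \<open>\<eta>\<close>, those in between are sent to \<open>c - \<eta>\<close>, which keeps \<open>\<Phi>\<close> non-decreasing off the design points too.\<close>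
    define \<Phi> where "\<Phi> s = (if s \<le> b then \<Psi> s - min \<eta> (max 0 (\<Psi> s - c + \<eta>)) else \<Psi> s)" for s
    have "mono \<Phi>"
    proof (rule monoI)
      fix x z :: real assume "x \<le> z"
      then have "\<Psi> x \<le> \<Psi> z" using mono by (auto dest: monoD)
      then show "\<Phi> x \<le> \<Phi> z" using \<open>x \<le> z\<close> \<eta> by (auto simp: \<Phi>_def min_def max_def)
    qed
    then have le: "(\<Sum>i\<in>J. (y i - \<Psi> (t i))\<^sup>2) \<le> (\<Sum>i\<in>J. (y i - \<Phi> (t i))\<^sup>2)"
      using lse by (auto simp: is_arg_min_def not_less)
    have val: "\<Phi> (t i) = (if i \<in> U then \<Psi> (t i) - \<eta> else \<Psi> (t i))" if "i \<in> J" for i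
      using \<eta>0(2)[OF that] \<eta> that by (auto simp: \<Phi>_def U_def min_def max_def)
    have "(\<Sum>i\<in>J. (y i - \<Phi> (t i))\<^sup>2)
        = (\<Sum>i\<in>J. (y i - \<Psi> (t i))\<^sup>2 + (if i \<in> U then 2 * \<eta> * (y i - \<Psi> (t i)) + \<eta>\<^sup>2 else 0))"
      by (intro sum.cong) (auto simp: val power2_eq_square algebra_simps)
    also have "\<dots> = (\<Sum>i\<in>J. (y i - \<Psi> (t i))\<^sup>2) + (\<Sum>i\<in>U. 2 * \<eta> * (y i - \<Psi> (t i)) + \<eta>\<^sup>2)"
      using J by (simp add: sum.distrib sum.If_cases) (simp add: U_def Int_def conj_assoc)
    also have "(\<Sum>i\<in>U. 2 * \<eta> * (y i - \<Psi> (t i)) + \<eta>\<^sup>2) = 2 * \<eta> * ?s + \<eta>\<^sup>2 * real (card U)"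
      by (simp add: sum.distrib sum_distrib_left flip: U_def)
    finally show ?thesis using le by simp
  qed
  \<comment> \<open>A step so small that the linear term of \<open>key\<close> dominates the quadratic one.\<close>
  define \<eta> where "\<eta> = min \<eta>0 (- ?s / (real (card U) + 1))"
  have "- ?s / (real (card U) + 1) > 0" using neg by (intro divide_pos_pos) auto
  then have pos: "\<eta> > 0" using \<eta>0(1) by (simp add: \<eta>_def)
  have "\<eta> \<le> - ?s / (real (card U) + 1)" by (simp add: \<eta>_def)
  then have "\<eta> * (real (card U) + 1) \<le> - ?s"
    by (subst (asm) pos_le_divide_eq) auto
  then have "2 * ?s + \<eta> * real (card U) < 0" using pos neg by (simp add: algebra_simps)
  then have "\<eta> * (2 * ?s + \<eta> * real (card U)) < 0" using pos by (rule mult_pos_neg[rotated])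
  moreover have "0 \<le> 2 * \<eta> * ?s + \<eta>\<^sup>2 * real (card U)" by (rule key[OF pos]) (simp add: \<eta>_def)
  ultimately show False by (simp add: algebra_simps power2_eq_square)
qed

text \<open>
  Sums over short windows are divided by \<open>N\<close> instead of their length.  This leaves the means over
  windows with at least \<open>N\<close> points unchanged and makes the second moment \<open>O(1 / N)\<close> for every design.
\<close>

definition max_window_mean :: "nat \<Rightarrow> 'i set \<Rightarrow> ('i \<Rightarrow> real) \<Rightarrow> real \<Rightarrow> ('i \<Rightarrow> real) \<Rightarrow> real" where
  "max_window_mean N J t b e = Max (insert 0 ((\<lambda>k.
     \<bar>\<Sum>i\<in>window J t (t k) b. e i\<bar> / real (max N (card (window J t (t k) b)))) ` J))"

text \<open>
  Let \<open>c\<close> be the fitted value at \<open>i0\<close>.  By monotonicity the points up to \<open>b\<close> with fitted value at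
  least \<open>c\<close> form a window that contains all points between \<open>t i0\<close> and \<open>b\<close>.  On this window the fit,
  hence \<open>c\<close>, is on average at most the mean of the observations.
\<close>

lemma isotonic_lse_le_max_window_mean:
  fixes t y e :: "'i \<Rightarrow> real"
  assumes J: "finite J" and lse: "is_arg_min (\<lambda>\<Phi>. \<Sum>i\<in>J. (y i - \<Phi> (t i))\<^sup>2) mono \<Psi>"
    and i0: "i0 \<in> J" "t i0 \<le> b" and N: "N \<le> card (window J t (t i0) b)"
    and y: "\<And>i. i \<in> J \<Longrightarrow> t i \<le> b \<Longrightarrow> y i \<le> B + e i"
  shows "\<Psi> (t i0) \<le> B + max_window_mean N J t b e"
proof -
  define c where "c = \<Psi> (t i0)"
  define U where "U = {i \<in> J. t i \<le> b \<and> c \<le> \<Psi> (t i)}"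
  have mono: "mono \<Psi>" using lse by (simp add: is_arg_min_def)
  have finU: "finite U" and i0U: "i0 \<in> U" using J i0 by (auto simp: U_def c_def)
  obtain k where k: "k \<in> U" and kmin: "\<And>i. i \<in> U \<Longrightarrow> t k \<le> t i"
    using exists_argmin[of U t] finU i0U by blast
  have U_eq: "U = window J t (t k) b"
  proof
    show "U \<subseteq> window J t (t k) b" using kmin by (auto simp: window_def U_def)
    have "c \<le> \<Psi> (t i)" if "t k \<le> t i" for i
      using monoD[OF mono that] k by (simp add: U_def)
    then show "window J t (t k) b \<subseteq> U" by (auto simp: window_def U_def)
  qed
  have card: "N \<le> card U" "card U > 0"
  proof -
    have "window J t (t i0) b \<subseteq> U" using monoD[OF mono] by (auto simp: window_def U_def c_def)
    then show "N \<le> card U" using N card_mono[OF finU] by (meson le_trans)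
    show "card U > 0" using finU i0U by (auto simp: card_gt_0_iff)
  qed
  have "real (card U) * c \<le> (\<Sum>i\<in>U. \<Psi> (t i))"
    using sum_mono[of U "\<lambda>_. c" "\<lambda>i. \<Psi> (t i)"] by (simp add: U_def)
  also have "\<dots> \<le> (\<Sum>i\<in>U. y i)"
    using isotonic_lse_level_sum[OF J lse, of b c] by (simp add: U_def sum_subtractf)
  also have "\<dots> \<le> (\<Sum>i\<in>U. B + e i)" by (intro sum_mono y) (auto simp: U_def)
  also have "\<dots> = real (card U) * B + (\<Sum>i\<in>U. e i)" by (simp add: sum.distrib)
  finally have "c \<le> B + (\<Sum>i\<in>U. e i) / real (card U)" using card by (simp add: field_simps)
  also have "(\<Sum>i\<in>U. e i) / real (card U) \<le> \<bar>\<Sum>i\<in>U. e i\<bar> / real (max N (card U))"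
    using card by (simp add: max_def divide_right_mono)
  also have "\<dots> \<le> max_window_mean N J t b e"
    unfolding max_window_mean_def U_eq using J k by (intro Max_ge) (auto simp: U_def)
  finally show ?thesis by (simp add: c_def)
qed

definition upper_sum :: "'i set \<Rightarrow> ('i \<Rightarrow> real) \<Rightarrow> ('i \<Rightarrow> real) \<Rightarrow> real \<Rightarrow> real" where
  "upper_sum J t f u = (\<Sum>j\<in>J. if u \<le> t j then f j else 0)"

definition max_upper_sum :: "'i set \<Rightarrow> ('i \<Rightarrow> real) \<Rightarrow> ('i \<Rightarrow> real) \<Rightarrow> real" where
  "max_upper_sum J t f = Max (insert 0 ((\<lambda>k. upper_sum J t f (t k)) ` J))"

text \<open>
  If the points are visited from right to left, this is the running maximum just before the points
  at \<open>u\<close> are visited.  It is predictable: the terms at \<open>u\<close> do not enter.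
\<close>

definition max_upper_sum_above :: "'i set \<Rightarrow> ('i \<Rightarrow> real) \<Rightarrow> ('i \<Rightarrow> real) \<Rightarrow> real \<Rightarrow> real" where
  "max_upper_sum_above J t f u =
     Max (insert 0 ((\<lambda>k. if u < t k then upper_sum J t f (t k) else 0) ` J))"

definition up_closed :: "'i set \<Rightarrow> ('i \<Rightarrow> real) \<Rightarrow> 'i set \<Rightarrow> bool" where
  "up_closed J t U \<longleftrightarrow> U \<subseteq> J \<and> (\<forall>i\<in>U. \<forall>j\<in>J. t i \<le> t j \<longrightarrow> j \<in> U)"

lemma max_upper_sum_nonneg: "finite J \<Longrightarrow> 0 \<le> max_upper_sum J t f"
  by (simp add: max_upper_sum_def)

lemma sum_up_closed_le:
  assumes J: "finite J" and U: "up_closed J t U"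
  shows "sum f U \<le> max_upper_sum J t f"
proof (cases "U = {}")
  case True
  then show ?thesis by (simp add: max_upper_sum_nonneg J)
next
  case False
  have finU: "finite U" using J U finite_subset by (auto simp: up_closed_def)
  obtain k where k: "k \<in> U" and "\<And>i. i \<in> U \<Longrightarrow> t k \<le> t i"
    using exists_argmin[of U t] finU False by blast
  then have "U = {j \<in> J. t k \<le> t j}" using U k unfolding up_closed_def by blast
  then have "sum f U = upper_sum J t f (t k)"
    using J by (simp add: upper_sum_def sum.If_cases Int_def)
  also have "\<dots> \<le> max_upper_sum J t f"
    unfolding max_upper_sum_def using J k U by (intro Max_ge) (auto simp: up_closed_def)
  finally show ?thesis .
qed

text \<open>
  Kronecker's lemma in finite form: a bound on the partial sums of \<open>e j / a j\<close>, with \<open>a j\<close>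
  non-decreasing from right to left, bounds \<open>(\<Sum> e j) / a\<close> over each window.  Instead of Abel summation
  the natural number \<open>a j\<close> is written as the number of \<open>s\<close> with \<open>s < a j\<close>; each layer is then a
  difference of two up-closed sets.
\<close>

lemma max_window_mean_le:
  fixes t e :: "'i \<Rightarrow> real" and b :: real
  assumes J: "finite J" and N: "N \<ge> 1"
  defines "f \<equiv> \<lambda>j. if t j \<le> b then e j / real (max N (card (window J t (t j) b))) else 0"
  shows "max_window_mean N J t b e \<le> max_upper_sum J t f + max_upper_sum J t (\<lambda>j. - f j)"
    (is "_ \<le> ?V")
proof -
  define a where "a j = max N (card (window J t (t j) b))" for j
  have a_pos: "a j > 0" for j using N by (simp add: a_def)
  have anti: "a j \<le> a i" if "t i \<le> t j" for i j
    unfolding a_def using J that by (intro max.mono card_mono) (auto simp: window_def)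
  have V0: "0 \<le> ?V" using J by (simp add: max_upper_sum_nonneg)
  have up: "sum f U - sum f U' \<le> ?V"
    if "up_closed J t U" "up_closed J t U'" for U U'
  proof -
    have "sum f U \<le> max_upper_sum J t f" by (rule sum_up_closed_le[OF J that(1)])
    moreover have "(\<Sum>j\<in>U'. - f j) \<le> max_upper_sum J t (\<lambda>j. - f j)"
      by (rule sum_up_closed_le[OF J that(2)])
    ultimately show ?thesis by (simp add: sum_negf)
  qed
  have main: "\<bar>\<Sum>i\<in>window J t (t k) b. e i\<bar> \<le> ?V * real (a k)" if k: "k \<in> J" for k
  proof -
    define W where "W = window J t (t k) b"
    define U where "U = {j \<in> J. t k \<le> t j}"
    have finU: "finite U" using J by (simp add: U_def)
    have "(\<Sum>i\<in>W. e i) = (\<Sum>j\<in>U. real (a j) * f j)"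
    proof (rule sum.mono_neutral_cong_left[OF finU])
      show "W \<subseteq> U" by (auto simp: W_def U_def window_def)
      show "\<forall>i\<in>U - W. real (a i) * f i = 0" by (auto simp: W_def U_def window_def f_def)
      show "e i = real (a i) * f i" if "i \<in> W" for i
        using that a_pos[of i] unfolding f_def a_def[symmetric] by (auto simp: W_def window_def)
    qed
    also have "\<dots> = (\<Sum>j\<in>U. \<Sum>s<a k. if s < a j then f j else 0)"
    proof (rule sum.cong[OF refl])
      fix j assume "j \<in> U"
      then have "{..<a k} \<inter> {s. s < a j} = {..<a j}" using anti[of k j] by (auto simp: U_def)
      then show "real (a j) * f j = (\<Sum>s<a k. if s < a j then f j else 0)"
        by (simp add: sum.If_cases)
    qed
    also have "\<dots> = (\<Sum>s<a k. \<Sum>j\<in>U. if s < a j then f j else 0)" by (rule sum.swap)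
    also have "\<dots> = (\<Sum>s<a k. sum f U - sum f {j \<in> U. a j \<le> s})"
    proof (rule sum.cong[OF refl])
      fix s
      have "sum f U = (\<Sum>j\<in>U. (if s < a j then f j else 0) + (if a j \<le> s then f j else 0))"
        by (intro sum.cong) auto
      also have "\<dots> = (\<Sum>j\<in>U. if s < a j then f j else 0) + sum f {j \<in> U. a j \<le> s}"
        using finU by (simp add: sum.distrib sum.If_cases Int_def)
      finally show "(\<Sum>j\<in>U. if s < a j then f j else 0) = sum f U - sum f {j \<in> U. a j \<le> s}" by simp
    qed
    finally have eq: "(\<Sum>i\<in>W. e i) = (\<Sum>s<a k. sum f U - sum f {j \<in> U. a j \<le> s})" .
    have "\<bar>sum f U - sum f {j \<in> U. a j \<le> s}\<bar> \<le> ?V" for s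
    proof -
      have 1: "up_closed J t U" by (auto simp: U_def up_closed_def)
      have 2: "up_closed J t {j \<in> U. a j \<le> s}"
        using anti by (auto simp: U_def up_closed_def intro: order_trans)
      show ?thesis using up[OF 1 2] up[OF 2 1] by linarith
    qed
    then have "\<bar>\<Sum>s<a k. sum f U - sum f {j \<in> U. a j \<le> s}\<bar> \<le> (\<Sum>s<a k. ?V)"
      by (intro order_trans[OF sum_abs] sum_mono)
    then show ?thesis unfolding W_def[symmetric] eq by (simp add: mult.commute)
  qed
  have "\<bar>\<Sum>i\<in>window J t (t k) b. e i\<bar> / real (a k) \<le> ?V" if "k \<in> J" for k
    using main[OF that] a_pos[of k] by (simp add: divide_le_eq)
  then show ?thesis unfolding max_window_mean_def a_def[symmetric] using J V0 by (subst Max_le_iff) auto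
qed

text \<open>
  The subtracted term makes the induction go through: past \<open>N\<close> the squares are dominated by the
  increments of \<open>- 1 / k\<close>.
\<close>

lemma sum_inverse_squares_le:
  assumes N: "N \<ge> 1"
  shows "(\<Sum>k\<in>{1..n}. 1 / (real (max N k))\<^sup>2) \<le> 2 / real N - 1 / real (max N n)"
proof (induction n)
  case 0
  then show ?case using N by (simp add: field_simps)
next
  case (Suc n)
  show ?case
  proof (cases "Suc n \<le> N")
    case True
    have "(\<Sum>k\<in>{1..Suc n}. 1 / (real (max N k))\<^sup>2) = (\<Sum>k\<in>{1..Suc n}. 1 / (real N)\<^sup>2)"
      using True by (intro sum.cong) (auto simp: max_def)
    also have "\<dots> = real (Suc n) / (real N)\<^sup>2" by simp
    also have "\<dots> \<le> real N / (real N)\<^sup>2" using True by (intro divide_right_mono) auto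
    also have "\<dots> = 2 / real N - 1 / real N" using N by (simp add: power2_eq_square)
    finally show ?thesis using True by (simp only: max_absorb1)
  next
    case False
    then have n: "n \<ge> 1" "max N n = n" "max N (Suc n) = Suc n" using N by auto
    have "1 / (real (Suc n))\<^sup>2 \<le> 1 / (real n * real (Suc n))"
      unfolding power2_eq_square using n(1) by (intro divide_left_mono mult_right_mono) auto
    also have "\<dots> = 1 / real n - 1 / real (Suc n)" using n(1) by (simp add: diff_frac_eq)
    finally have step: "1 / (real (max N (Suc n)))\<^sup>2 \<le> 1 / real (max N n) - 1 / real (max N (Suc n))"
      unfolding n(2,3) .
    have "(\<Sum>k\<in>{1..Suc n}. 1 / (real (max N k))\<^sup>2)
        = (\<Sum>k\<in>{1..n}. 1 / (real (max N k))\<^sup>2) + 1 / (real (max N (Suc n)))\<^sup>2"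
      by (simp add: sum.nat_ivl_Suc' add.commute)
    then show ?thesis using Suc.IH step by linarith
  qed
qed

text \<open>
  The \<open>k\<close>-th point from the right has a window of at least \<open>k\<close> points, and ties only enlarge windows.
  The induction removes the leftmost point.
\<close>

lemma sum_window_weights_le:
  assumes J: "finite J" and N: "N \<ge> 1"
  shows "(\<Sum>j\<in>J. if t j \<le> b then 1 / (real (max N (card (window J t (t j) b))))\<^sup>2 else 0) \<le> 2 / real N"
proof -
  have "(\<Sum>j\<in>A. 1 / (real (max N (card (window A t (t j) b))))\<^sup>2) \<le> (\<Sum>k\<in>{1..n}. 1 / (real (max N k))\<^sup>2)"
    if "finite A" "card A = n" "\<And>j. j \<in> A \<Longrightarrow> t j \<le> b" for A :: "'a set" and n
    using that
  proof (induction n arbitrary: A)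
    case (Suc n)
    then have "A \<noteq> {}" by auto
    obtain m where m: "m \<in> A" and mle: "\<And>i. i \<in> A \<Longrightarrow> t m \<le> t i"
      using exists_argmin[of A t] Suc.prems(1) \<open>A \<noteq> {}\<close> by blast
    then have full: "window A t (t m) b = A" using Suc.prems(3) by (auto simp: window_def)
    define A' where "A' = A - {m}"
    have A': "finite A'" "card A' = n" "\<And>j. j \<in> A' \<Longrightarrow> t j \<le> b"
      using Suc.prems m by (auto simp: A'_def)
    have "(\<Sum>j\<in>A. 1 / (real (max N (card (window A t (t j) b))))\<^sup>2)
        = 1 / (real (max N (Suc n)))\<^sup>2 + (\<Sum>j\<in>A'. 1 / (real (max N (card (window A t (t j) b))))\<^sup>2)"
      unfolding A'_def using Suc.prems(1,2) m full by (subst sum.remove[of A m]) auto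
    also have "(\<Sum>j\<in>A'. 1 / (real (max N (card (window A t (t j) b))))\<^sup>2)
        \<le> (\<Sum>j\<in>A'. 1 / (real (max N (card (window A' t (t j) b))))\<^sup>2)"
    proof (rule sum_mono)
      fix j
      have "card (window A' t (t j) b) \<le> card (window A t (t j) b)"
        using Suc.prems(1) by (intro card_mono) (auto simp: window_def A'_def)
      then show "1 / (real (max N (card (window A t (t j) b))))\<^sup>2 \<le> 1 / (real (max N (card (window A' t (t j) b))))\<^sup>2"
        using N by (intro divide_left_mono power_mono mult_pos_pos zero_less_power) (auto simp: max_def)
    qed
    also have "\<dots> \<le> (\<Sum>k\<in>{1..n}. 1 / (real (max N k))\<^sup>2)" by (rule Suc.IH[OF A'])
    finally show ?case by simp
  qed simp
  note ineq = this
  define A where "A = {j \<in> J. t j \<le> b}"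
  have win: "window J t u b = window A t u b" for u by (auto simp: window_def A_def)
  have "(\<Sum>j\<in>J. if t j \<le> b then 1 / (real (max N (card (window J t (t j) b))))\<^sup>2 else 0)
      = (\<Sum>j\<in>A. 1 / (real (max N (card (window A t (t j) b))))\<^sup>2)"
    using J unfolding win A_def by (simp add: sum.If_cases Int_def)
  also have "\<dots> \<le> (\<Sum>k\<in>{1..card A}. 1 / (real (max N k))\<^sup>2)"
    using J by (intro ineq) (auto simp: A_def)
  also have "\<dots> \<le> 2 / real N - 1 / real (max N (card A))" by (rule sum_inverse_squares_le[OF N])
  also have "\<dots> \<le> 2 / real N" by simp
  finally show ?thesis .
qed

text \<open>
  Doob's \<open>L\<^sup>2\<close> inequality before expectations are taken: the last sum is a martingale transform of \<open>f\<close>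
  by the running maximum.  The induction removes all points at the lowest level of \<open>t\<close> at once, since
  these share the same running maximum; in this way ties are covered.
\<close>

lemma pathwise_doob:
  fixes t f :: "'i \<Rightarrow> real"
  assumes "finite J"
  shows "(max_upper_sum J t f)\<^sup>2 \<le>
    2 * max_upper_sum J t f * sum f J - 2 * (\<Sum>i\<in>J. max_upper_sum_above J t f (t i) * f i)"
  using assms
proof (induction "card J" arbitrary: J rule: less_induct)
  case less
  show ?case
  proof (cases "J = {}")
    case True
    then show ?thesis by (simp add: max_upper_sum_def)
  next
    case False
    obtain m where m: "m \<in> J" and mle: "\<And>i. i \<in> J \<Longrightarrow> t m \<le> t i"
      using exists_argmin[of J t] less.prems False by blast
    define A where "A = {i \<in> J. t i = t m}"
    define J' where "J' = J - A"
    have A: "m \<in> A" "A \<subseteq> J" "\<And>i. i \<in> A \<Longrightarrow> t i = t m" using m by (auto simp: A_def)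
    have J': "finite J'" "J' \<subseteq> J" "J = A \<union> J'" "A \<inter> J' = {}"
      using less.prems A(2) by (auto simp: J'_def)
    have fin: "finite A" using less.prems A(2) by (rule finite_subset[rotated])
    have gt: "t m < t i" if "i \<in> J'" for i using that mle[of i] by (force simp: J'_def A_def)
    have split: "sum g J = sum g A + sum g J'" for g :: "'i \<Rightarrow> real"
      unfolding J'(3) using fin J' by (intro sum.union_disjoint) auto
    have upper: "upper_sum J t f u = upper_sum J' t f u" if "t m < u" for u
    proof -
      have "\<not> u \<le> t j" if "j \<in> A" for j using A(3)[OF that] \<open>t m < u\<close> by simp
      then show ?thesis unfolding upper_sum_def split by (simp add: sum.neutral)
    qed
    have bottom: "upper_sum J t f (t m) = sum f J"
      unfolding upper_sum_def by (intro sum.cong) (auto simp: mle)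
    have img_split: "g ` J = g ` A \<union> g ` J'" for g :: "'i \<Rightarrow> real"
      unfolding image_Un[symmetric] J'(3)[symmetric] by (rule refl)
    define V where "V = max_upper_sum J t f"
    define V' where "V' = max_upper_sum J' t f"
    have img: "(\<lambda>k. upper_sum J t f (t k)) ` J
        = insert (sum f J) ((\<lambda>k. upper_sum J' t f (t k)) ` J')"
    proof -
      have "(\<lambda>k. upper_sum J t f (t k)) ` A = (\<lambda>k. sum f J) ` A"
        using bottom by (intro image_cong refl) (simp only: A(3))
      moreover have "(\<lambda>k. upper_sum J t f (t k)) ` J' = (\<lambda>k. upper_sum J' t f (t k)) ` J'"
        using gt upper by (intro image_cong) auto
      ultimately show ?thesis unfolding img_split using A(1) by auto
    qed
    have V: "V = max (sum f J) V'"
      unfolding V_def V'_def max_upper_sum_def img using J'(1)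
      by (subst insert_commute, subst Max_insert) auto
    have aboveJ: "max_upper_sum_above J t f u = max_upper_sum_above J' t f u" if "t m \<le> u" for u
    proof -
      let ?g = "\<lambda>k. if u < t k then upper_sum J t f (t k) else 0"
      have "?g k = 0" if "k \<in> A" for k using A(3)[OF that] \<open>t m \<le> u\<close> by simp
      then have "?g ` A \<subseteq> {0}" by blast
      moreover have "?g ` J' = (\<lambda>k. if u < t k then upper_sum J' t f (t k) else 0) ` J'"
        using gt upper by (intro image_cong) auto
      ultimately have "insert 0 (?g ` J) = insert 0 ((\<lambda>k. if u < t k then upper_sum J' t f (t k) else 0) ` J')"
        unfolding img_split by auto
      then show ?thesis by (simp add: max_upper_sum_above_def)
    qed
    have aboveA: "max_upper_sum_above J t f (t i) = V'" if "i \<in> A" for i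
    proof -
      have "(\<lambda>k. if t m < t k then upper_sum J' t f (t k) else 0) ` J' = (\<lambda>k. upper_sum J' t f (t k)) ` J'"
        using gt by (intro image_cong) auto
      then show ?thesis
        using aboveJ[of "t m"] A(3)[OF that] by (simp add: max_upper_sum_above_def V'_def max_upper_sum_def)
    qed
    have "(\<Sum>i\<in>J. max_upper_sum_above J t f (t i) * f i)
        = V' * sum f A + (\<Sum>i\<in>J'. max_upper_sum_above J' t f (t i) * f i)"
      unfolding split using aboveA aboveJ gt by (simp add: sum_distrib_left less_imp_le)
    moreover have "V'\<^sup>2 \<le> 2 * V' * sum f J' - 2 * (\<Sum>i\<in>J'. max_upper_sum_above J' t f (t i) * f i)"
      unfolding V'_def
    proof (rule less.hyps)
      show "card J' < card J" using less.prems A(1) m by (intro psubset_card_mono) (auto simp: J'_def)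
    qed (rule J')
    moreover have "sum f J = sum f A + sum f J'" by (rule split)
    moreover have "V\<^sup>2 \<le> V'\<^sup>2 + 2 * (V - V') * sum f J"
    proof (cases "sum f J \<le> V'")
      case True
      then show ?thesis using V by simp
    next
      case False
      then have "sum f J = V" using V by simp
      moreover have "0 \<le> (V - V')\<^sup>2" by simp
      ultimately show ?thesis by (simp add: power2_eq_square algebra_simps)
    qed
    ultimately show ?thesis unfolding V_def[symmetric] by (simp add: algebra_simps)
  qed
qed

section \<open>A maximal inequality for window means\<close>

lemma borel_measurable_Max_insert_0:
  fixes F :: "'i \<Rightarrow> 'a \<Rightarrow> real"
  assumes "finite J" "\<And>k. k \<in> J \<Longrightarrow> F k \<in> borel_measurable M"
  shows "(\<lambda>z. Max (insert 0 ((\<lambda>k. F k z) ` J))) \<in> borel_measurable M"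
  using assms
proof (induction J rule: finite_induct)
  case (insert a J)
  have "Max (insert 0 ((\<lambda>k. F k z) ` insert a J)) = max (F a z) (Max (insert 0 ((\<lambda>k. F k z) ` J)))" for z
    using insert.hyps(1) by (simp add: insert_commute[of 0])
  moreover have "(\<lambda>z. Max (insert 0 ((\<lambda>k. F k z) ` J))) \<in> borel_measurable M" "F a \<in> borel_measurable M"
    using insert by auto
  ultimately show ?case by simp
qed simp

lemma max_upper_sum_above_cong:
  assumes "\<And>j. j \<in> J \<Longrightarrow> u < t j \<Longrightarrow> f j = f' j"
  shows "max_upper_sum_above J t f u = max_upper_sum_above J t f' u"
proof -
  have "(if u < t k then upper_sum J t f (t k) else 0) = (if u < t k then upper_sum J t f' (t k) else 0)"
    if "k \<in> J" for k
    unfolding upper_sum_def by (auto intro!: sum.cong assms)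
  then show ?thesis by (simp add: max_upper_sum_above_def cong: image_cong)
qed

lemma abs_upper_sum_le: "\<bar>upper_sum J t f u\<bar> \<le> (\<Sum>j\<in>J. \<bar>f j\<bar>)"
  unfolding upper_sum_def by (rule order_trans[OF sum_abs]) (auto intro!: sum_mono)

lemma max_upper_sum_le_sum_abs: "finite J \<Longrightarrow> max_upper_sum J t f \<le> (\<Sum>j\<in>J. \<bar>f j\<bar>)"
  unfolding max_upper_sum_def
  by (subst Max_le_iff) (auto intro!: sum_nonneg order_trans[OF abs_ge_self abs_upper_sum_le])

lemma max_upper_sum_above_bounds:
  assumes "finite J"
  shows "0 \<le> max_upper_sum_above J t f u" "max_upper_sum_above J t f u \<le> (\<Sum>j\<in>J. \<bar>f j\<bar>)"
proof -
  show "0 \<le> max_upper_sum_above J t f u" using assms by (simp add: max_upper_sum_above_def)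
  show "max_upper_sum_above J t f u \<le> (\<Sum>j\<in>J. \<bar>f j\<bar>)"
    unfolding max_upper_sum_above_def using assms
    by (subst Max_le_iff) (auto intro!: sum_nonneg order_trans[OF abs_ge_self abs_upper_sum_le])
qed

text \<open>
  An observation \<open>y\<close> has a design part \<open>X y\<close> and a noise \<open>e y\<close> that is centred given the design part.
  The section \<open>s\<close> of \<open>X\<close> expresses that a function depends on \<open>y\<close> through its design part only: it does
  not change if \<open>y\<close> is replaced by \<open>s (X y)\<close>.  The condition \<open>mean_zero\<close> ranges over all measurable \<open>h\<close>,
  because the Bochner integral of a non-integrable function is \<open>0\<close>.
\<close>

locale centred_noise = prob_space P
  for P :: "'a measure" +
  fixes D :: "'x measure" and X :: "'a \<Rightarrow> 'x" and s :: "'x \<Rightarrow> 'a" and e :: "'a \<Rightarrow> real" and v :: real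
  assumes X [measurable]: "X \<in> measurable P D"
    and s [measurable]: "s \<in> measurable D P"
    and X_s: "\<And>u. u \<in> space D \<Longrightarrow> X (s u) = u"
    and e [measurable]: "e \<in> borel_measurable P"
    and v_nonneg: "0 \<le> v"
    and mean_zero: "\<And>h. h \<in> borel_measurable D \<Longrightarrow> (\<integral>y. h (X y) * e y \<partial>P) = 0"
    and second_moment: "\<And>h :: 'x \<Rightarrow> ennreal. h \<in> borel_measurable D \<Longrightarrow>
      (\<integral>\<^sup>+y. h (X y) * ennreal ((e y)\<^sup>2) \<partial>P) \<le> ennreal v * (\<integral>\<^sup>+y. h (X y) \<partial>P)"
begin

abbreviation "sample J \<equiv> Pi\<^sub>M J (\<lambda>_. P)"

definition ignores_noise_at :: "'i \<Rightarrow> 'i set \<Rightarrow> (('i \<Rightarrow> 'a) \<Rightarrow> 'b) \<Rightarrow> bool" where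
  "ignores_noise_at i J H \<longleftrightarrow>
     (\<forall>z\<in>space (sample (J - {i})). \<forall>y\<in>space P. H (z(i := y)) = H (z(i := s (X y))))"

sublocale product_sigma_finite "\<lambda>_ :: 'i. P"
  by unfold_locales

lemma prob_space_sample: "prob_space (sample J)"
  by (intro prob_space_PiM prob_space_axioms)

text \<open>
  Fubini with the \<open>i\<close>-th observation innermost: there \<open>H\<close> is a function of its design part.
\<close>

lemma integral_noise_zero:
  fixes H :: "('i \<Rightarrow> 'a) \<Rightarrow> real"
  assumes J: "finite J" "i \<in> J" and H [measurable]: "H \<in> borel_measurable (sample J)"
    and ig: "ignores_noise_at i J H" and int: "integrable (sample J) (\<lambda>z. H z * e (z i))"
  shows "(\<integral>z. H z * e (z i) \<partial>sample J) = 0"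
proof -
  define I where "I = J - {i}"
  have I: "finite I" "i \<notin> I" "J = insert i I" using J by (auto simp: I_def)
  have "(\<integral>z. H z * e (z i) \<partial>sample J)
      = (\<integral>z. (\<integral>y. H (z(i := y)) * e ((z(i := y)) i) \<partial>P) \<partial>sample I)"
    unfolding I(3) using I(1,2) int[unfolded I(3)] by (rule product_integral_insert)
  also have "\<dots> = (\<integral>z. 0 \<partial>sample I)"
  proof (rule Bochner_Integration.integral_cong[OF refl])
    fix z assume z: "z \<in> space (sample I)"
    have upd: "(\<lambda>y. z(i := y)) \<in> measurable P (sample J)"
      unfolding I(3) by (rule measurable_component_update[OF z I(2)])
    have h: "(\<lambda>u. H (z(i := s u))) \<in> borel_measurable D"
      by (rule measurable_compose[OF s measurable_compose[OF upd H]])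
    have "(\<integral>y. H (z(i := y)) * e ((z(i := y)) i) \<partial>P) = (\<integral>y. H (z(i := s (X y))) * e y \<partial>P)"
      using ig z by (intro Bochner_Integration.integral_cong) (auto simp: ignores_noise_at_def I_def)
    also have "\<dots> = 0" by (rule mean_zero[OF h])
    finally show "(\<integral>y. H (z(i := y)) * e ((z(i := y)) i) \<partial>P) = 0" .
  qed
  finally show ?thesis by simp
qed

lemma nn_integral_noise_square_le:
  fixes H :: "('i \<Rightarrow> 'a) \<Rightarrow> ennreal"
  assumes J: "finite J" "i \<in> J" and H [measurable]: "H \<in> borel_measurable (sample J)"
    and ig: "ignores_noise_at i J H"
  shows "(\<integral>\<^sup>+z. H z * ennreal ((e (z i))\<^sup>2) \<partial>sample J) \<le> ennreal v * (\<integral>\<^sup>+z. H z \<partial>sample J)"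
proof -
  define I where "I = J - {i}"
  have I: "finite I" "i \<notin> I" "J = insert i I" using J by (auto simp: I_def)
  have [measurable]: "(\<lambda>z. e (z i)) \<in> borel_measurable (sample J)"
    using J(2) by measurable
  have "(\<integral>\<^sup>+z. H z * ennreal ((e (z i))\<^sup>2) \<partial>sample J)
      = (\<integral>\<^sup>+z. (\<integral>\<^sup>+y. H (z(i := y)) * ennreal ((e ((z(i := y)) i))\<^sup>2) \<partial>P) \<partial>sample I)"
    unfolding I(3) using I(1,2)
    by (rule product_nn_integral_insert) (simp flip: I(3))
  also have "\<dots> \<le> (\<integral>\<^sup>+z. ennreal v * (\<integral>\<^sup>+y. H (z(i := y)) \<partial>P) \<partial>sample I)"
  proof (rule nn_integral_mono)
    fix z assume z: "z \<in> space (sample I)"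
    have upd: "(\<lambda>y. z(i := y)) \<in> measurable P (sample J)"
      unfolding I(3) by (rule measurable_component_update[OF z I(2)])
    have h: "(\<lambda>u. H (z(i := s u))) \<in> borel_measurable D"
      by (rule measurable_compose[OF s measurable_compose[OF upd H]])
    have eq: "H (z(i := y)) = H (z(i := s (X y)))" if "y \<in> space P" for y
      using ig z that by (auto simp: ignores_noise_at_def I_def)
    have "(\<integral>\<^sup>+y. H (z(i := y)) * ennreal ((e ((z(i := y)) i))\<^sup>2) \<partial>P)
        = (\<integral>\<^sup>+y. H (z(i := s (X y))) * ennreal ((e y)\<^sup>2) \<partial>P)"
      using eq by (intro nn_integral_cong) auto
    also have "\<dots> \<le> ennreal v * (\<integral>\<^sup>+y. H (z(i := s (X y))) \<partial>P)" by (rule second_moment[OF h])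
    also have "(\<integral>\<^sup>+y. H (z(i := s (X y))) \<partial>P) = (\<integral>\<^sup>+y. H (z(i := y)) \<partial>P)"
      using eq by (intro nn_integral_cong) auto
    finally show "(\<integral>\<^sup>+y. H (z(i := y)) * ennreal ((e ((z(i := y)) i))\<^sup>2) \<partial>P)
        \<le> ennreal v * (\<integral>\<^sup>+y. H (z(i := y)) \<partial>P)" .
  qed
  also have "\<dots> = ennreal v * (\<integral>\<^sup>+z. (\<integral>\<^sup>+y. H (z(i := y)) \<partial>P) \<partial>sample I)"
  proof (rule nn_integral_cmult)
    have "(\<lambda>(z, y). H (z(i := y))) \<in> borel_measurable (sample I \<Otimes>\<^sub>M P)"
      using measurable_compose[OF measurable_add_dim H[unfolded I(3)]] by (simp add: case_prod_beta')
    then show "(\<lambda>z. \<integral>\<^sup>+y. H (z(i := y)) \<partial>P) \<in> borel_measurable (sample I)"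
      by (rule borel_measurable_nn_integral)
  qed
  also have "(\<integral>\<^sup>+z. (\<integral>\<^sup>+y. H (z(i := y)) \<partial>P) \<partial>sample I) = (\<integral>\<^sup>+z. H z \<partial>sample J)"
    unfolding I(3) using I(1,2) H[unfolded I(3)] by (rule product_nn_integral_insert[symmetric])
  finally show ?thesis .
qed

definition design_only :: "'i set \<Rightarrow> (('i \<Rightarrow> 'a) \<Rightarrow> 'b) \<Rightarrow> bool" where
  "design_only J H \<longleftrightarrow> (\<forall>z z'. (\<forall>j\<in>J. X (z j) = X (z' j)) \<longrightarrow> H z = H z')"

lemma X_s_X: "y \<in> space P \<Longrightarrow> X (s (X y)) = X y"
  using measurable_space[OF X] by (intro X_s)

lemma design_only_upd:
  "design_only J H \<Longrightarrow> y \<in> space P \<Longrightarrow> H (z(i := s (X y))) = H (z(i := y))"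
  unfolding design_only_def using X_s_X by (metis fun_upd_apply)

lemma integrable_sum_abs_square:
  assumes J: "finite J"
  shows "integrable (sample J) (\<lambda>z. (\<Sum>j\<in>J. \<bar>e (z j)\<bar>)\<^sup>2)"
proof -
  have sq: "integrable (sample J) (\<lambda>z. (e (z j))\<^sup>2)" if j: "j \<in> J" for j
  proof -
    interpret S: prob_space "sample J" by (rule prob_space_sample)
    have [measurable]: "(\<lambda>z. e (z j)) \<in> borel_measurable (sample J)" using j by measurable
    have "(\<integral>\<^sup>+z. 1 * ennreal ((e (z j))\<^sup>2) \<partial>sample J) \<le> ennreal v * (\<integral>\<^sup>+z. 1 \<partial>sample J)"
      using J j by (intro nn_integral_noise_square_le) (auto simp: ignores_noise_at_def)
    then have "(\<integral>\<^sup>+z. ennreal ((e (z j))\<^sup>2) \<partial>sample J) < \<infinity>"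
      by (simp add: S.emeasure_space_1 le_less_trans)
    then show ?thesis by (intro integrableI_nonneg) auto
  qed
  have [measurable]: "(\<lambda>z. e (z j)) \<in> borel_measurable (sample J)" if "j \<in> J" for j
    using that by measurable
  show ?thesis
  proof (rule Bochner_Integration.integrable_bound)
    show "integrable (sample J) (\<lambda>z. real (card J) * (\<Sum>j\<in>J. (e (z j))\<^sup>2))"
      using sq by auto
    show "AE z in sample J. norm ((\<Sum>j\<in>J. \<bar>e (z j)\<bar>)\<^sup>2) \<le> norm (real (card J) * (\<Sum>j\<in>J. (e (z j))\<^sup>2))"
    proof (rule AE_I2)
      fix z
      have "(\<Sum>j\<in>J. \<bar>e (z j)\<bar>)\<^sup>2 \<le> real (card J) * (\<Sum>j\<in>J. \<bar>e (z j)\<bar>\<^sup>2)"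
        using sum_squared_le_sum_of_squares[of "\<lambda>j. \<bar>e (z j)\<bar>" J] J by (simp add: mult.commute)
      then show "norm ((\<Sum>j\<in>J. \<bar>e (z j)\<bar>)\<^sup>2) \<le> norm (real (card J) * (\<Sum>j\<in>J. (e (z j))\<^sup>2))"
        by (simp add: sum_nonneg abs_mult)
    qed
  qed measurable
qed

text \<open>
  The weights depend on the design only, so the mixed terms have mean zero.
\<close>

lemma weighted_noise_second_moment:
  fixes c :: "'i \<Rightarrow> ('i \<Rightarrow> 'a) \<Rightarrow> real"
  assumes J: "finite J"
    and c [measurable]: "\<And>j. j \<in> J \<Longrightarrow> c j \<in> borel_measurable (sample J)"
    and c_design: "\<And>j. j \<in> J \<Longrightarrow> design_only J (c j)"
    and c_bound: "\<And>j z. j \<in> J \<Longrightarrow> \<bar>c j z\<bar> \<le> 1" and w: "\<And>z. (\<Sum>j\<in>J. (c j z)\<^sup>2) \<le> w"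
  shows "integrable (sample J) (\<lambda>z. (\<Sum>j\<in>J. c j z * e (z j))\<^sup>2)"
    "(\<integral>z. (\<Sum>j\<in>J. c j z * e (z j))\<^sup>2 \<partial>sample J) \<le> v * w"
proof -
  interpret S: prob_space "sample J" by (rule prob_space_sample)
  have e_m [measurable]: "(\<lambda>z. e (z j)) \<in> borel_measurable (sample J)" if "j \<in> J" for j
    using that by measurable
  define G where "G z = (\<Sum>j\<in>J. \<bar>e (z j)\<bar>)" for z
  have intG: "integrable (sample J) (\<lambda>z. (G z)\<^sup>2)"
    unfolding G_def using J by (rule integrable_sum_abs_square)
  have f_le: "\<bar>c j z * e (z j)\<bar> \<le> G z" if j: "j \<in> J" for j z
  proof -
    have "\<bar>c j z * e (z j)\<bar> \<le> 1 * \<bar>e (z j)\<bar>"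
      unfolding abs_mult by (intro mult_right_mono c_bound j) auto
    also have "\<dots> \<le> G z" unfolding G_def using J j member_le_sum[of j J "\<lambda>j. \<bar>e (z j)\<bar>"] by simp
    finally show ?thesis .
  qed
  have int2: "integrable (sample J) (\<lambda>z. (c i z * e (z i)) * (c j z * e (z j)))" if "i \<in> J" "j \<in> J" for i j
  proof (rule Bochner_Integration.integrable_bound[OF intG])
    show "AE z in sample J. norm ((c i z * e (z i)) * (c j z * e (z j))) \<le> norm ((G z)\<^sup>2)"
    proof (rule AE_I2)
      fix z
      have "\<bar>c i z * e (z i)\<bar> * \<bar>c j z * e (z j)\<bar> \<le> G z * G z"
        using f_le that by (intro mult_mono) (auto simp: G_def sum_nonneg)
      then show "norm ((c i z * e (z i)) * (c j z * e (z j))) \<le> norm ((G z)\<^sup>2)"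
        by (simp add: abs_mult power2_eq_square)
    qed
  qed (use that in measurable)
  have sq: "(\<Sum>j\<in>J. c j z * e (z j))\<^sup>2 = (\<Sum>i\<in>J. \<Sum>j\<in>J. (c i z * e (z i)) * (c j z * e (z j)))" for z
    unfolding power2_eq_square sum_product ..
  show "integrable (sample J) (\<lambda>z. (\<Sum>j\<in>J. c j z * e (z j))\<^sup>2)"
    unfolding sq using int2 by auto
  have cross: "(\<integral>z. (c i z * e (z i)) * (c j z * e (z j)) \<partial>sample J) = 0" if ij: "i \<in> J" "j \<in> J" "i \<noteq> j" for i j
  proof -
    have "(\<integral>z. (c i z * c j z * e (z j)) * e (z i) \<partial>sample J) = 0"
    proof (rule integral_noise_zero[OF J ij(1)])
      show "(\<lambda>z. c i z * c j z * e (z j)) \<in> borel_measurable (sample J)" using ij by measurable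
      show "ignores_noise_at i J (\<lambda>z. c i z * c j z * e (z j))"
        using ij design_only_upd[OF c_design] by (auto simp: ignores_noise_at_def)
      show "integrable (sample J) (\<lambda>z. c i z * c j z * e (z j) * e (z i))"
        using int2[OF ij(1,2)] by (simp add: mult_ac)
    qed
    then show ?thesis by (simp add: mult_ac)
  qed
  have c2_int: "integrable (sample J) (\<lambda>z. (c j z)\<^sup>2)" if j: "j \<in> J" for j
    by (rule S.integrable_const_bound[of _ 1])
      (use c_bound[OF j] j in \<open>auto simp: abs_square_le_1\<close>)
  have diag: "(\<integral>z. (c j z * e (z j)) * (c j z * e (z j)) \<partial>sample J) \<le> v * (\<integral>z. (c j z)\<^sup>2 \<partial>sample J)"
    if j: "j \<in> J" for j
  proof -
    have "ennreal (\<integral>z. (c j z * e (z j)) * (c j z * e (z j)) \<partial>sample J)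
        = (\<integral>\<^sup>+z. ennreal ((c j z * e (z j)) * (c j z * e (z j))) \<partial>sample J)"
      by (rule nn_integral_eq_integral[symmetric, OF int2[OF j j]]) auto
    also have "\<dots> = (\<integral>\<^sup>+z. ennreal ((c j z)\<^sup>2) * ennreal ((e (z j))\<^sup>2) \<partial>sample J)"
      by (intro nn_integral_cong) (simp add: power2_eq_square mult_ac flip: ennreal_mult)
    also have "\<dots> \<le> ennreal v * (\<integral>\<^sup>+z. ennreal ((c j z)\<^sup>2) \<partial>sample J)"
    proof (rule nn_integral_noise_square_le[OF J j])
      show "ignores_noise_at j J (\<lambda>z. ennreal ((c j z)\<^sup>2))"
        using design_only_upd[OF c_design[OF j]] by (auto simp: ignores_noise_at_def)
    qed (use j in measurable)
    also have "(\<integral>\<^sup>+z. ennreal ((c j z)\<^sup>2) \<partial>sample J) = ennreal (\<integral>z. (c j z)\<^sup>2 \<partial>sample J)"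
      by (rule nn_integral_eq_integral[OF c2_int[OF j]]) auto
    finally show ?thesis using v_nonneg by (simp flip: ennreal_mult')
  qed
  have "(\<integral>z. (\<Sum>j\<in>J. c j z * e (z j))\<^sup>2 \<partial>sample J)
      = (\<Sum>i\<in>J. \<Sum>j\<in>J. (\<integral>z. (c i z * e (z i)) * (c j z * e (z j)) \<partial>sample J))"
    unfolding sq using int2 by (simp add: Bochner_Integration.integral_sum)
  also have "\<dots> = (\<Sum>i\<in>J. (\<integral>z. (c i z * e (z i)) * (c i z * e (z i)) \<partial>sample J))"
  proof (rule sum.cong[OF refl])
    fix i assume i: "i \<in> J"
    show "(\<Sum>j\<in>J. (\<integral>z. (c i z * e (z i)) * (c j z * e (z j)) \<partial>sample J))
        = (\<integral>z. (c i z * e (z i)) * (c i z * e (z i)) \<partial>sample J)"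
      using cross[OF i] by (subst sum.remove[OF J i]) (auto intro!: sum.neutral)
  qed
  also have "\<dots> \<le> (\<Sum>i\<in>J. v * (\<integral>z. (c i z)\<^sup>2 \<partial>sample J))" by (intro sum_mono diag)
  also have "\<dots> = v * (\<integral>z. (\<Sum>i\<in>J. (c i z)\<^sup>2) \<partial>sample J)"
    using c2_int by (simp add: sum_distrib_left Bochner_Integration.integral_sum)
  also have "\<dots> \<le> v * w"
  proof (rule mult_left_mono[OF _ v_nonneg])
    have "(\<integral>z. (\<Sum>i\<in>J. (c i z)\<^sup>2) \<partial>sample J) \<le> (\<integral>z. w \<partial>sample J)"
      using c2_int w by (intro integral_mono) auto
    then show "(\<integral>z. (\<Sum>i\<in>J. (c i z)\<^sup>2) \<partial>sample J) \<le> w" by (simp add: S.prob_space)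
  qed
  finally show "(\<integral>z. (\<Sum>j\<in>J. c j z * e (z j))\<^sup>2 \<partial>sample J) \<le> v * w" .
qed

text \<open>
  Integrate \<open>pathwise_doob\<close>.  The running maximum strictly to the right of the \<open>i\<close>-th point does not
  involve the noise at \<open>i\<close>, so the martingale transform has mean zero; this holds with the ordering of
  the points itself random, as it is a function of the design.
\<close>

lemma weighted_noise_maximal_inequality:
  fixes c :: "'i \<Rightarrow> ('i \<Rightarrow> 'a) \<Rightarrow> real" and \<tau> :: "'x \<Rightarrow> real"
  assumes J: "finite J" and \<tau> [measurable]: "\<tau> \<in> borel_measurable D"
    and c [measurable]: "\<And>j. j \<in> J \<Longrightarrow> c j \<in> borel_measurable (sample J)"
    and c_design: "\<And>j. j \<in> J \<Longrightarrow> design_only J (c j)"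
    and c_bound: "\<And>j z. j \<in> J \<Longrightarrow> \<bar>c j z\<bar> \<le> 1" and w: "\<And>z. (\<Sum>j\<in>J. (c j z)\<^sup>2) \<le> w"
  defines "V \<equiv> \<lambda>z. max_upper_sum J (\<lambda>j. \<tau> (X (z j))) (\<lambda>j. c j z * e (z j))"
  shows "V \<in> borel_measurable (sample J)"
    "(\<integral>\<^sup>+z. ennreal ((V z)\<^sup>2) \<partial>sample J) \<le> ennreal (4 * v * w)"
proof -
  interpret S: prob_space "sample J" by (rule prob_space_sample)
  have e_m [measurable]: "(\<lambda>z. e (z j)) \<in> borel_measurable (sample J)" if "j \<in> J" for j
    using that by measurable
  have t_m [measurable]: "(\<lambda>z. \<tau> (X (z j))) \<in> borel_measurable (sample J)" if "j \<in> J" for j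
    using that by measurable
  define f where "f z = (\<lambda>j. c j z * e (z j))" for z
  define t where "t z = (\<lambda>j. \<tau> (X (z j)))" for z :: "'i \<Rightarrow> 'a"
  have f_m [measurable]: "(\<lambda>z. f z j) \<in> borel_measurable (sample J)" if "j \<in> J" for j
    unfolding f_def using that by measurable
  have tt_m [measurable]: "(\<lambda>z. t z j) \<in> borel_measurable (sample J)" if "j \<in> J" for j
    unfolding t_def using that by measurable
  define A where "A i z = max_upper_sum_above J (t z) (f z) (t z i)" for i z
  have V: "V z = max_upper_sum J (t z) (f z)" for z by (simp add: V_def t_def f_def)
  have u_m: "(\<lambda>z. upper_sum J (t z) (f z) (t z k)) \<in> borel_measurable (sample J)" if "k \<in> J" for k
    unfolding upper_sum_def using that J by measurable
  show V_m [measurable]: "V \<in> borel_measurable (sample J)"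
    unfolding V max_upper_sum_def fun_eq_iff[symmetric]
    using borel_measurable_Max_insert_0[OF J u_m] by (simp add: V max_upper_sum_def cong: measurable_cong)
  have A_m [measurable]: "A i \<in> borel_measurable (sample J)" if i: "i \<in> J" for i
  proof -
    have "(\<lambda>z. if t z i < t z k then upper_sum J (t z) (f z) (t z k) else 0) \<in> borel_measurable (sample J)"
      if "k \<in> J" for k
      using that i u_m[OF that] by measurable
    from borel_measurable_Max_insert_0[OF J this] show ?thesis
      by (simp add: A_def max_upper_sum_above_def cong: measurable_cong)
  qed
  define G where "G z = (\<Sum>j\<in>J. \<bar>e (z j)\<bar>)" for z
  have intG: "integrable (sample J) (\<lambda>z. (G z)\<^sup>2)"
    unfolding G_def using J by (rule integrable_sum_abs_square)
  have f_le1: "\<bar>f z j\<bar> \<le> \<bar>e (z j)\<bar>" if j: "j \<in> J" for j z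
    using mult_right_mono[OF c_bound[OF j], of "\<bar>e (z j)\<bar>" z] by (simp add: f_def abs_mult)
  have sumf: "(\<Sum>j\<in>J. \<bar>f z j\<bar>) \<le> G z" for z unfolding G_def by (intro sum_mono f_le1)
  have G0: "0 \<le> G z" for z by (simp add: G_def sum_nonneg)
  have f_le: "\<bar>f z j\<bar> \<le> G z" if j: "j \<in> J" for j z
    using sumf[of z] member_le_sum[OF j, of "\<lambda>j. \<bar>f z j\<bar>"] J by simp
  have V_le: "\<bar>V z\<bar> \<le> G z" for z
    using max_upper_sum_le_sum_abs[OF J, of "t z" "f z"] max_upper_sum_nonneg[OF J, of "t z" "f z"] sumf[of z]
    by (simp add: V)
  have A_le: "\<bar>A i z\<bar> \<le> G z" for i z
    using max_upper_sum_above_bounds[OF J, of "t z" "f z" "t z i"] sumf[of z] by (simp add: A_def)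
  have S_le: "\<bar>sum (f z) J\<bar> \<le> G z" for z
    using sum_abs[of "f z" J] sumf[of z] by linarith
  have prod_int: "integrable (sample J) (\<lambda>z. a z * b z)"
    if "\<And>z. \<bar>a z\<bar> \<le> G z" "\<And>z. \<bar>b z\<bar> \<le> G z" "a \<in> borel_measurable (sample J)" "b \<in> borel_measurable (sample J)"
    for a b :: "('i \<Rightarrow> 'a) \<Rightarrow> real"
  proof (rule Bochner_Integration.integrable_bound[OF intG])
    show "AE z in sample J. norm (a z * b z) \<le> norm ((G z)\<^sup>2)"
    proof (rule AE_I2)
      fix z
      have "\<bar>a z\<bar> * \<bar>b z\<bar> \<le> G z * G z" using that(1,2) G0 by (intro mult_mono) auto
      then show "norm (a z * b z) \<le> norm ((G z)\<^sup>2)" by (simp add: abs_mult power2_eq_square)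
    qed
  qed (use that in measurable)
  have S_m [measurable]: "(\<lambda>z. sum (f z) J) \<in> borel_measurable (sample J)" by measurable
  have int_VV: "integrable (sample J) (\<lambda>z. (V z)\<^sup>2)"
    unfolding power2_eq_square using V_le by (intro prod_int) auto
  have int_VS: "integrable (sample J) (\<lambda>z. V z * sum (f z) J)"
    using V_le S_le by (intro prod_int) auto
  have int_SS: "integrable (sample J) (\<lambda>z. (sum (f z) J)\<^sup>2)"
    unfolding power2_eq_square using S_le by (intro prod_int) auto
  have int_Af: "integrable (sample J) (\<lambda>z. A i z * f z i)" if "i \<in> J" for i
    using A_le f_le[OF that] that by (intro prod_int) auto
  have Af_zero: "(\<integral>z. A i z * f z i \<partial>sample J) = 0" if i: "i \<in> J" for i
  proof -
    have "(\<integral>z. (A i z * c i z) * e (z i) \<partial>sample J) = 0"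
    proof (rule integral_noise_zero[OF J i])
      show "(\<lambda>z. A i z * c i z) \<in> borel_measurable (sample J)" using i by measurable
      show "ignores_noise_at i J (\<lambda>z. A i z * c i z)"
        unfolding ignores_noise_at_def
      proof (intro ballI)
        fix z y assume y: "y \<in> space P"
        let ?z = "z(i := y)" and ?z' = "z(i := s (X y))"
        have tz: "t ?z = t ?z'" using X_s_X[OF y] by (auto simp: t_def fun_eq_iff)
        have "f ?z j = f ?z' j" if "j \<in> J" "t ?z i < t ?z j" for j
          using design_only_upd[OF c_design[OF that(1)] y] that(2) by (auto simp: f_def)
        then have "A i ?z = A i ?z'"
          unfolding A_def tz[symmetric] by (rule max_upper_sum_above_cong)
        then show "A i ?z * c i ?z = A i ?z' * c i ?z'"
          using design_only_upd[OF c_design[OF i] y] by simp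
      qed
      show "integrable (sample J) (\<lambda>z. A i z * c i z * e (z i))"
        using int_Af[OF i] by (simp add: f_def mult_ac)
    qed
    then show ?thesis by (simp add: f_def mult_ac)
  qed
  \<comment> \<open>From here on, \<open>2 V S \<le> V\<^sup>2 / 2 + 2 S\<^sup>2\<close> absorbs half of the left-hand side.\<close>
  have "(\<integral>z. (V z)\<^sup>2 \<partial>sample J)
      \<le> (\<integral>z. 2 * (V z * sum (f z) J) - 2 * (\<Sum>i\<in>J. A i z * f z i) \<partial>sample J)"
  proof (rule integral_mono[OF int_VV])
    show "integrable (sample J) (\<lambda>z. 2 * (V z * sum (f z) J) - 2 * (\<Sum>i\<in>J. A i z * f z i))"
      using int_VS int_Af by auto
    show "(V z)\<^sup>2 \<le> 2 * (V z * sum (f z) J) - 2 * (\<Sum>i\<in>J. A i z * f z i)" for z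
      using pathwise_doob[OF J, of "t z" "f z"] unfolding V A_def by simp
  qed
  also have "\<dots> = 2 * (\<integral>z. V z * sum (f z) J \<partial>sample J)"
    using int_VS int_Af Af_zero by (simp add: Bochner_Integration.integral_sum)
  also have "\<dots> = (\<integral>z. 2 * (V z * sum (f z) J) \<partial>sample J)" by simp
  also have "\<dots> \<le> (\<integral>z. (V z)\<^sup>2 / 2 + 2 * (sum (f z) J)\<^sup>2 \<partial>sample J)"
  proof (rule integral_mono)
    show "2 * (V z * sum (f z) J) \<le> (V z)\<^sup>2 / 2 + 2 * (sum (f z) J)\<^sup>2" for z
      using zero_le_power2[of "V z - 2 * sum (f z) J"] by (simp add: power2_eq_square algebra_simps)
  qed (use int_VS int_VV int_SS in auto)
  also have "\<dots> = (\<integral>z. (V z)\<^sup>2 \<partial>sample J) / 2 + 2 * (\<integral>z. (sum (f z) J)\<^sup>2 \<partial>sample J)"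
    using int_VV int_SS by simp
  finally have "(\<integral>z. (V z)\<^sup>2 \<partial>sample J) \<le> 4 * (\<integral>z. (sum (f z) J)\<^sup>2 \<partial>sample J)" by simp
  also have "(\<integral>z. (sum (f z) J)\<^sup>2 \<partial>sample J) \<le> v * w"
    unfolding f_def by (rule weighted_noise_second_moment(2)[OF J c c_design c_bound w])
  finally have "(\<integral>z. (V z)\<^sup>2 \<partial>sample J) \<le> 4 * v * w" by simp
  then show "(\<integral>\<^sup>+z. ennreal ((V z)\<^sup>2) \<partial>sample J) \<le> ennreal (4 * v * w)"
    using int_VV by (subst nn_integral_eq_integral) (auto intro: ennreal_leI)
qed

text \<open>
  By Kronecker summation the mean is bounded by two one-sided maxima, for the weights and for their
  negatives; the squared weights sum to at most \<open>2 / N\<close>.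
\<close>

lemma max_window_mean_second_moment:
  fixes \<tau> :: "'x \<Rightarrow> real" and b :: real and J :: "'i set"
  assumes J: "finite J" and N: "N \<ge> 1" and \<tau> [measurable]: "\<tau> \<in> borel_measurable D"
  shows "(\<integral>\<^sup>+z. ennreal ((max_window_mean N J (\<lambda>j. \<tau> (X (z j))) b (\<lambda>j. e (z j)))\<^sup>2) \<partial>sample J)
    \<le> ennreal (32 * v / real N)"
proof -
  define t where "t z = (\<lambda>j. \<tau> (X (z j)))" for z :: "'i \<Rightarrow> 'a"
  define c where "c j z = (if t z j \<le> b then 1 / real (max N (card (window J (t z) (t z j) b))) else 0)" for j :: 'i and z
  have t_m [measurable]: "(\<lambda>z. t z j) \<in> borel_measurable (sample J)" if "j \<in> J" for j :: 'i
    unfolding t_def using that by measurable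
  have card_eq: "real (max N (card (window J (t z) u b)))
      = max (real N) (\<Sum>i\<in>J. if u \<le> t z i \<and> t z i \<le> b then 1 else 0)" for z u
    using J by (simp add: window_def sum.If_cases Int_def of_nat_max)
  have c_m: "c j \<in> borel_measurable (sample J)" if j: "j \<in> J" for j
  proof -
    have [measurable]: "Measurable.pred (sample J) (\<lambda>z. t z j \<le> t z i \<and> t z i \<le> b)" if "i \<in> J" for i
      using t_m[OF that] t_m[OF j]
      by (intro pred_intros_logic borel_measurable_pred_less borel_measurable_le pred_def[THEN iffD2]) auto
    show ?thesis unfolding c_def card_eq using j J by measurable
  qed
  have c_design: "design_only J (c j)" if "j \<in> J" for j
    unfolding design_only_def
  proof (intro allI impI)
    fix z z' :: "'i \<Rightarrow> 'a" assume *: "\<forall>j\<in>J. X (z j) = X (z' j)"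
    then have t_eq: "t z i = t z' i" if "i \<in> J" for i using that by (simp add: t_def)
    then have "window J (t z) u b = window J (t z') u b" for u by (auto simp: window_def)
    then show "c j z = c j z'" using t_eq[OF that] by (simp add: c_def)
  qed
  have c_bound: "\<bar>c j z\<bar> \<le> 1" for j z using N by (auto simp: c_def divide_le_eq)
  have w: "(\<Sum>j\<in>J. (c j z)\<^sup>2) \<le> 2 / real N" for z
  proof -
    have "(\<Sum>j\<in>J. (c j z)\<^sup>2) = (\<Sum>j\<in>J. if t z j \<le> b then 1 / (real (max N (card (window J (t z) (t z j) b))))\<^sup>2 else 0)"
      by (intro sum.cong) (auto simp: c_def power_divide)
    also have "\<dots> \<le> 2 / real N" by (rule sum_window_weights_le[OF J N])
    finally show ?thesis .
  qed
  define V1 where "V1 z = max_upper_sum J (t z) (\<lambda>j. c j z * e (z j))" for z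
  define V2 where "V2 z = max_upper_sum J (t z) (\<lambda>j. (- c j z) * e (z j))" for z
  have V1: "V1 \<in> borel_measurable (sample J)" "(\<integral>\<^sup>+z. ennreal ((V1 z)\<^sup>2) \<partial>sample J) \<le> ennreal (4 * v * (2 / real N))"
    unfolding V1_def t_def
    by (rule weighted_noise_maximal_inequality[OF J \<tau> c_m c_design c_bound w]; assumption)+
  have c2_m: "(\<lambda>z. - c j z) \<in> borel_measurable (sample J)" if "j \<in> J" for j using c_m[OF that] by simp
  have c2_design: "design_only J (\<lambda>z. - c j z)" if "j \<in> J" for j
    using c_design[OF that] unfolding design_only_def by metis
  have c2_bound: "\<bar>- c j z\<bar> \<le> 1" for j z using c_bound[of j z] by simp
  have c2_w: "(\<Sum>j\<in>J. (- c j z)\<^sup>2) \<le> 2 / real N" for z using w[of z] by simp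
  have V2: "V2 \<in> borel_measurable (sample J)" "(\<integral>\<^sup>+z. ennreal ((V2 z)\<^sup>2) \<partial>sample J) \<le> ennreal (4 * v * (2 / real N))"
    unfolding V2_def t_def
    by (rule weighted_noise_maximal_inequality[OF J \<tau> c2_m c2_design c2_bound c2_w]; assumption)+
  have le: "(max_window_mean N J (t z) b (\<lambda>j. e (z j)))\<^sup>2 \<le> 2 * (V1 z)\<^sup>2 + 2 * (V2 z)\<^sup>2" for z
  proof -
    have "max_window_mean N J (t z) b (\<lambda>j. e (z j)) \<le> V1 z + V2 z"
    proof -
      have eq: "(if t z j \<le> b then e (z j) / real (max N (card (window J (t z) (t z j) b))) else 0)
          = c j z * e (z j)" for j by (simp add: c_def)
      show ?thesis
        using max_window_mean_le[OF J N, of "t z" b "\<lambda>j. e (z j)"] unfolding eq V1_def V2_def by simp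
    qed
    moreover have "0 \<le> max_window_mean N J (t z) b (\<lambda>j. e (z j))"
      unfolding max_window_mean_def using J by simp
    ultimately have "(max_window_mean N J (t z) b (\<lambda>j. e (z j)))\<^sup>2 \<le> (V1 z + V2 z)\<^sup>2"
      by (intro power_mono)
    also have "\<dots> \<le> 2 * (V1 z)\<^sup>2 + 2 * (V2 z)\<^sup>2"
      using zero_le_power2[of "V1 z - V2 z"] by (simp add: power2_eq_square algebra_simps)
    finally show ?thesis .
  qed
  have "(\<integral>\<^sup>+z. ennreal ((max_window_mean N J (t z) b (\<lambda>j. e (z j)))\<^sup>2) \<partial>sample J)
      \<le> (\<integral>\<^sup>+z. 2 * ennreal ((V1 z)\<^sup>2) + 2 * ennreal ((V2 z)\<^sup>2) \<partial>sample J)"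
    by (intro nn_integral_mono)
      (use le in \<open>simp add: ennreal_leI flip: ennreal_plus ennreal_mult' ennreal_numeral\<close>)
  also have "\<dots> = 2 * (\<integral>\<^sup>+z. ennreal ((V1 z)\<^sup>2) \<partial>sample J) + 2 * (\<integral>\<^sup>+z. ennreal ((V2 z)\<^sup>2) \<partial>sample J)"
    using V1(1) V2(1) by (simp add: nn_integral_add nn_integral_cmult)
  also have "\<dots> \<le> 2 * ennreal (4 * v * (2 / real N)) + 2 * ennreal (4 * v * (2 / real N))"
    by (intro add_mono mult_left_mono V1 V2) auto
  also have "\<dots> = ennreal (32 * v / real N)"
    using v_nonneg by (simp flip: ennreal_plus ennreal_mult' ennreal_numeral)
  finally show ?thesis unfolding t_def .
qed

end

section \<open>Numbers of observations in a set\<close>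

text \<open>
  Chebyshev's inequality.  The variance of the count comes from \<open>weighted_noise_second_moment\<close> for a
  one-point design, with the centred indicator of \<open>A\<close> as noise.
\<close>

lemma count_lower_deviation:
  fixes P :: "'a measure" and J :: "'i set"
  assumes P: "prob_space P" and A [measurable]: "A \<in> sets P" and J: "finite J" "J \<noteq> {}"
    and p0: "0 < p0" "p0 \<le> measure P A"
  shows "emeasure (Pi\<^sub>M J (\<lambda>_. P)) {z \<in> space (Pi\<^sub>M J (\<lambda>_. P)). real (card {j \<in> J. z j \<in> A}) < real (card J) * p0 / 2}
    \<le> ennreal (4 / (real (card J) * p0))"
proof -
  interpret prob_space P by (rule P)
  define p where "p = measure P A"
  define e where "e y = indicator A y - p" for y
  obtain y0 where y0: "y0 \<in> space P" using not_empty by blast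
  have p: "0 < p" "p \<le> 1" "p0 \<le> p" using p0 by (auto simp: p_def)
  have int_e: "(\<integral>y. e y \<partial>P) = 0"
    by (simp add: e_def p_def prob_space emeasure_eq_measure)
  have int_e2: "integrable P (\<lambda>y. (e y)\<^sup>2)" "(\<integral>y. (e y)\<^sup>2 \<partial>P) \<le> p"
  proof -
    have sq: "(e y)\<^sup>2 = (1 - 2 * p) * indicator A y + p\<^sup>2" for y
      by (simp add: e_def indicator_def power2_eq_square algebra_simps)
    show "integrable P (\<lambda>y. (e y)\<^sup>2)" unfolding sq by (auto simp: emeasure_eq_measure)
    have "(\<integral>y. (e y)\<^sup>2 \<partial>P) = (1 - 2 * p) * p + p\<^sup>2"
      unfolding sq by (simp add: prob_space emeasure_eq_measure p_def)
    also have "\<dots> \<le> p" using p by (simp add: power2_eq_square algebra_simps)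
    finally show "(\<integral>y. (e y)\<^sup>2 \<partial>P) \<le> p" .
  qed
  interpret N: centred_noise P "count_space {()}" "\<lambda>_. ()" "\<lambda>_. y0" e p
  proof
    show "(\<lambda>_. ()) \<in> measurable P (count_space {()})" "(\<lambda>_. y0) \<in> measurable (count_space {()}) P"
      using y0 by auto
    show "e \<in> borel_measurable P" unfolding e_def by measurable
    show "(\<integral>y. h () * e y \<partial>P) = 0" for h :: "unit \<Rightarrow> real" using int_e by simp
    show "(\<integral>\<^sup>+y. h () * ennreal ((e y)\<^sup>2) \<partial>P) \<le> ennreal p * (\<integral>\<^sup>+y. h () \<partial>P)" for h :: "unit \<Rightarrow> ennreal"
    proof -
      have "(\<integral>\<^sup>+y. h () * ennreal ((e y)\<^sup>2) \<partial>P) = h () * ennreal (\<integral>y. (e y)\<^sup>2 \<partial>P)"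
        using int_e2 by (subst nn_integral_cmult) (auto simp: nn_integral_eq_integral e_def)
      also have "\<dots> \<le> h () * ennreal p" by (intro mult_left_mono ennreal_leI int_e2) auto
      finally show ?thesis by (simp add: emeasure_space_1 mult.commute)
    qed
  qed (use p in auto)
  let ?S = "Pi\<^sub>M J (\<lambda>_. P)"
  interpret S: prob_space ?S by (rule N.prob_space_sample)
  let ?m = "real (card J)"
  have m: "?m > 0" using J by (simp add: card_gt_0_iff)
  note W = N.weighted_noise_second_moment[OF J(1), of "\<lambda>_ _. 1" ?m, simplified N.design_only_def]
  have W: "integrable ?S (\<lambda>z. (\<Sum>j\<in>J. e (z j))\<^sup>2)" "(\<integral>z. (\<Sum>j\<in>J. e (z j))\<^sup>2 \<partial>?S) \<le> p * ?m"
    using W by auto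
  let ?B = "{z \<in> space ?S. real (card {j \<in> J. z j \<in> A}) < ?m * p0 / 2}"
  let ?C = "{z \<in> space ?S. (\<Sum>j\<in>J. e (z j))\<^sup>2 \<ge> (?m * p / 2)\<^sup>2}"
  have "?B \<subseteq> ?C"
  proof safe
    fix z assume z: "real (card {j \<in> J. z j \<in> A}) < ?m * p0 / 2"
    have "(\<Sum>j\<in>J. e (z j)) = real (card {j \<in> J. z j \<in> A}) - ?m * p"
      using J(1) by (simp add: e_def sum_subtractf indicator_def sum.If_cases Int_def)
    also have "\<dots> \<le> - (?m * p / 2)" using z p(3) mult_left_mono[OF p(3), of ?m] by simp
    finally have "?m * p / 2 \<le> - (\<Sum>j\<in>J. e (z j))" by simp
    then have "(?m * p / 2)\<^sup>2 \<le> (- (\<Sum>j\<in>J. e (z j)))\<^sup>2"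
      using m p by (intro power_mono) auto
    then show "(?m * p / 2)\<^sup>2 \<le> (\<Sum>j\<in>J. e (z j))\<^sup>2" by simp
  qed
  have C: "?C \<in> sets ?S" using W(1) by measurable
  have "emeasure ?S ?B \<le> emeasure ?S ?C" by (rule emeasure_mono[OF \<open>?B \<subseteq> ?C\<close> C])
  also have "\<dots> = ennreal (S.prob ?C)" by (rule S.emeasure_eq_measure)
  also have "\<dots> \<le> ennreal (4 / (?m * p0))"
  proof (rule ennreal_leI)
    have "S.prob ?C \<le> (\<integral>z. (\<Sum>j\<in>J. e (z j))\<^sup>2 \<partial>?S) / (?m * p / 2)\<^sup>2"
      using W(1) m p by (intro integral_Markov_inequality_measure[where A="{}"]) auto
    also have "\<dots> \<le> (p * ?m) / (?m * p / 2)\<^sup>2" using W(2) by (intro divide_right_mono) auto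
    also have "\<dots> = 4 / (?m * p)" using m p by (simp add: power2_eq_square field_simps)
    also have "\<dots> \<le> 4 / (?m * p0)" using m p p0 by (intro divide_left_mono mult_left_mono mult_pos_pos) auto
    finally show "S.prob ?C \<le> 4 / (?m * p0)" .
  qed
  finally show ?thesis .
qed

section \<open>The noise of the single index model\<close>

lemma measurable_fst_borel:
  fixes P :: "('a::topological_space \<times> 'b::topological_space) measure"
  assumes "sets P = sets borel"
  shows "fst \<in> measurable P borel"
  using measurable_cong_sets[OF assms refl] borel_measurable_continuous_onI[OF continuous_on_fst[OF continuous_on_id]]
  by blast

text \<open>
  The law of \<open>(X, Y)\<close> is the composition of the design law with the kernel \<open>\<kappa>\<close>, since both agree on
  measurable rectangles.
\<close>

lemma conditional_law_nn_integral:
  fixes P :: "((real ^ 'd) \<times> real) measure"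
  assumes P: "prob_space P" "sets P = sets borel" and \<kappa>: "is_conditional_law P \<kappa>"
    and F: "F \<in> borel_measurable borel"
  shows "(\<integral>\<^sup>+z. F z \<partial>P) = (\<integral>\<^sup>+x. (\<integral>\<^sup>+y. F (x, y) \<partial>\<kappa> x) \<partial>design_law P)"
proof -
  interpret prob_space P by (rule P)
  define Q where "Q = design_law P"
  have fst_m: "fst \<in> measurable P borel" by (rule measurable_fst_borel[OF P(2)])
  have Q: "prob_space Q" "sets Q = sets borel" "space Q = UNIV"
    unfolding Q_def design_law_def using prob_space_distr[OF fst_m] by auto
  interpret Q: prob_space Q by (rule Q)
  have \<kappa>_m: "\<kappa> \<in> measurable borel (prob_algebra borel)"
    and rect: "\<And>A B. A \<in> sets borel \<Longrightarrow> B \<in> sets borel \<Longrightarrow>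
        emeasure P (A \<times> B) = (\<integral>\<^sup>+x\<in>A. emeasure (\<kappa> x) B \<partial>Q)"
    using \<kappa> by (auto simp: is_conditional_law_def Q_def)
  have \<kappa>_sub: "\<kappa> \<in> measurable borel (subprob_algebra borel)"
    by (rule measurable_prob_algebraD[OF \<kappa>_m])
  have sets_\<kappa>: "sets (\<kappa> x) = sets borel" for x
    using measurable_space[OF \<kappa>_m, of x] by (simp add: space_prob_algebra)
  have space_\<kappa>: "space (\<kappa> x) = UNIV" for x using sets_eq_imp_space_eq[OF sets_\<kappa>, of x] by simp
  define K where "K x = distr (\<kappa> x) (borel :: ((real ^ 'd) \<times> real) measure) (\<lambda>y. (x, y))" for x
  have pair_m: "(\<lambda>y. (x, y)) \<in> measurable (\<kappa> x) borel" for x :: "real ^ 'd"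
    using measurable_Pair1'[of x borel borel] unfolding borel_prod
    by (simp add: measurable_cong_sets[OF sets_\<kappa> refl])
  have K_m: "K \<in> measurable Q (subprob_algebra borel)"
  proof -
    have "(\<lambda>x. distr (\<kappa> x) (borel :: ((real ^ 'd) \<times> real) measure) (\<lambda>y. (x, y)))
        \<in> measurable borel (subprob_algebra borel)"
    proof (rule measurable_distr2[OF _ \<kappa>_sub])
      show "(\<lambda>(x, y). (x, y)) \<in> borel \<Otimes>\<^sub>M borel \<rightarrow>\<^sub>M (borel :: ((real ^ 'd) \<times> real) measure)"
        unfolding borel_prod by simp
    qed
    then show ?thesis unfolding K_def[abs_def] by (simp add: measurable_cong_sets[OF Q(2) refl])
  qed
  define R where "R = Q \<bind> K"
  have setsR: "sets R = sets borel"
    unfolding R_def using Q(3) by (intro sets_bind[where N=borel]) (auto simp: K_def)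
  let ?E = "{A \<times> B | A B. A \<in> sets (borel :: (real ^ 'd) measure) \<and> B \<in> sets (borel :: real measure)}"
  have gen: "sets (borel :: ((real ^ 'd) \<times> real) measure) = sigma_sets UNIV ?E"
    using sets_pair_measure[of "borel :: (real ^ 'd) measure" "borel :: real measure"]
    unfolding borel_prod by simp
  have "P = R"
  proof (rule measure_eqI_generator_eq[where E="?E" and \<Omega>=UNIV and A="\<lambda>_. UNIV"])
    show "Int_stable ?E"
      using Int_stable_pair_measure_generator[of "borel :: (real ^ 'd) measure" "borel :: real measure"] by simp
    show "emeasure P Z = emeasure R Z" if ZE: "Z \<in> ?E" for Z
    proof -
      obtain A B where Z: "Z = A \<times> B" "A \<in> sets borel" "B \<in> sets borel" using ZE by auto
      have Zb: "Z \<in> sets borel" unfolding gen using ZE by auto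
      have KZ: "emeasure (K x) Z = emeasure (\<kappa> x) B * indicator A x" for x
      proof -
        have "emeasure (K x) Z = emeasure (\<kappa> x) ((\<lambda>y. (x, y)) -` Z \<inter> space (\<kappa> x))"
          unfolding K_def by (rule emeasure_distr[OF pair_m Zb])
        also have "(\<lambda>y. (x, y)) -` Z \<inter> space (\<kappa> x) = (if x \<in> A then B else {})"
          by (auto simp: Z space_\<kappa>)
        finally show ?thesis by simp
      qed
      have "emeasure R Z = (\<integral>\<^sup>+x. emeasure (K x) Z \<partial>Q)"
        unfolding R_def using Q(3) by (intro emeasure_bind[OF _ K_m Zb]) auto
      then show ?thesis using rect[OF Z(2,3)] by (simp add: KZ Z(1)[symmetric])
    qed
    show "range (\<lambda>_. UNIV) \<subseteq> ?E" by (auto intro!: exI[of _ UNIV])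
    show "emeasure P UNIV \<noteq> \<infinity>" by simp
  qed (auto simp: P(2) setsR gen)
  then have "(\<integral>\<^sup>+z. F z \<partial>P) = (\<integral>\<^sup>+x. (\<integral>\<^sup>+z. F z \<partial>K x) \<partial>Q)"
    unfolding R_def using nn_integral_bind[OF F K_m] by simp
  also have "\<dots> = (\<integral>\<^sup>+x. (\<integral>\<^sup>+y. F (x, y) \<partial>\<kappa> x) \<partial>Q)"
    unfolding K_def using F by (intro nn_integral_cong nn_integral_distr[OF pair_m]) auto
  finally show ?thesis unfolding Q_def .
qed

text \<open>
  That the noise is centred is the model equation for the conditional expectation; its conditional
  second moment is bounded through the second moment of \<open>\<kappa> x\<close> and the bound on the regression function.
\<close>

lemma regression_noise_centred:
  fixes P :: "((real ^ 'd) \<times> real) measure"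
  assumes P: "prob_space P" "sets P = sets borel"
    and S: "AE x in design_law P. x \<in> S" and \<kappa>: "is_conditional_law P \<kappa>"
    and model: "monotone_single_index P \<Psi>0 \<alpha>0"
    and A2: "A2 S (\<lambda>x. \<Psi>0 (\<alpha>0 \<bullet> x))" and A3: "A3 S \<kappa>"
  shows "\<exists>v. centred_noise P borel fst (\<lambda>x. (x, 0)) (\<lambda>z. snd z - \<Psi>0 (\<alpha>0 \<bullet> fst z)) v"
proof -
  interpret prob_space P by (rule P)
  define g where "g x = \<Psi>0 (\<alpha>0 \<bullet> x)" for x
  have [measurable_cong]: "sets P = sets (borel \<Otimes>\<^sub>M borel)" using P(2) unfolding borel_prod .
  have sets_Q [measurable_cong]: "sets (design_law P) = sets borel" by (simp add: design_law_def)
  obtain K0 where K0: "K0 > 0" "\<And>x. x \<in> S \<Longrightarrow> \<bar>g x\<bar> \<le> K0" using A2 by (auto simp: A2_def g_def)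
  obtain a0 B where a0: "a0 > 0" "B > 0" and mom: "\<And>s x. s \<ge> 2 \<Longrightarrow> x \<in> S \<Longrightarrow>
     (\<integral>\<^sup>+y. ennreal (\<bar>y\<bar> ^ s) \<partial>\<kappa> x) \<le> ennreal (a0 * fact s * B ^ (s - 2))"
    using A3 unfolding A3_def by blast
  have mono: "mono \<Psi>0" and int_Y: "integrable P snd"
    and ce: "AE z in P. real_cond_exp P (vimage_algebra (space P) fst borel) snd z = g (fst z)"
    using model by (auto simp: monotone_single_index_def g_def)
  have [measurable]: "\<Psi>0 \<in> borel_measurable borel" using mono by (rule borel_measurable_mono)
  have g_m [measurable]: "g \<in> borel_measurable borel" unfolding g_def by measurable
  have fst_m [measurable]: "fst \<in> measurable P borel" by measurable
  have S_P: "AE z in P. fst z \<in> S" using S unfolding design_law_def by (rule AE_distrD[OF fst_m])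
  have int_g: "integrable P (\<lambda>z. g (fst z))"
  proof (rule integrable_const_bound)
    show "AE z in P. norm (g (fst z)) \<le> K0" using S_P by eventually_elim (simp add: K0)
  qed measurable
  \<comment> \<open>\<open>(y - g x)\<^sup>2 \<le> 2 y\<^sup>2 + 2 (g x)\<^sup>2\<close>, where \<open>y\<^sup>2\<close> has mean at most \<open>2 a0\<close>, the case \<open>s = 2\<close> of the moment condition.\<close>
  define v where "v = 4 * a0 + 2 * K0\<^sup>2"
  have v: "v \<ge> 0" using a0 by (simp add: v_def)
  have "centred_noise P borel fst (\<lambda>x. (x, 0)) (\<lambda>z. snd z - g (fst z)) v"
  proof
    show "(\<integral>z. h (fst z) * (snd z - g (fst z)) \<partial>P) = 0" if [measurable]: "h \<in> borel_measurable borel" for h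
    proof (cases "integrable P (\<lambda>z. h (fst z) * (snd z - g (fst z)))")
      case False
      then show ?thesis by (rule not_integrable_integral_eq)
    next
      case True
      define F where "F = vimage_algebra (space P) fst (borel :: (real ^ 'd) measure)"
      have "subalgebra P F"
        unfolding F_def subalgebra_def using measurable_sets[OF fst_m]
        by (auto simp: sets_vimage_algebra2)
      then have "finite_measure_subalgebra P F"
        by (intro finite_measure_subalgebra.intro finite_measure_subalgebra_axioms.intro finite_measure_axioms)
      then interpret sigma_finite_subalgebra P F
        by (rule finite_measure_subalgebra_is_sigma_finite)
      have fst_F: "fst \<in> measurable F borel"
        unfolding F_def by (rule measurable_vimage_algebra1) auto
      have "AE z in P. real_cond_exp P F (\<lambda>z. snd z - g (fst z)) z
          = real_cond_exp P F snd z - real_cond_exp P F (\<lambda>z. g (fst z)) z"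
        by (rule real_cond_exp_diff[OF int_Y int_g])
      moreover have "AE z in P. real_cond_exp P F (\<lambda>z. g (fst z)) z = g (fst z)"
        by (rule real_cond_exp_F_meas[OF int_g measurable_compose[OF fst_F g_m]])
      ultimately have zero: "AE z in P. real_cond_exp P F (\<lambda>z. snd z - g (fst z)) z = 0"
        using ce unfolding F_def[symmetric] by eventually_elim simp
      have "(\<integral>z. h (fst z) * (snd z - g (fst z)) \<partial>P)
          = (\<integral>z. h (fst z) * real_cond_exp P F (\<lambda>z. snd z - g (fst z)) z \<partial>P)"
        using True by (intro real_cond_exp_intg(2)[symmetric] measurable_compose[OF fst_F]) auto
      also have "\<dots> = 0"
        using zero by (intro integral_eq_zero_AE) (auto elim: eventually_mono)
      finally show ?thesis .
    qed
    show "(\<integral>\<^sup>+z. h (fst z) * ennreal ((snd z - g (fst z))\<^sup>2) \<partial>P) \<le> ennreal v * (\<integral>\<^sup>+z. h (fst z) \<partial>P)"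
      if [measurable]: "h \<in> borel_measurable borel" for h :: "real ^ 'd \<Rightarrow> ennreal"
    proof -
      have inner: "(\<integral>\<^sup>+y. h x * ennreal ((y - g x)\<^sup>2) \<partial>\<kappa> x) \<le> h x * ennreal v" if x: "x \<in> S" for x
      proof -
        have \<kappa>x: "prob_space (\<kappa> x)" "sets (\<kappa> x) = sets borel"
          using \<kappa> measurable_space[of \<kappa> borel "prob_algebra borel" x]
          by (auto simp: is_conditional_law_def space_prob_algebra)
        interpret k: prob_space "\<kappa> x" by (rule \<kappa>x)
        note \<kappa>x(2) [measurable_cong]
        have "(\<integral>\<^sup>+y. ennreal ((y - g x)\<^sup>2) \<partial>\<kappa> x) \<le> (\<integral>\<^sup>+y. ennreal (2 * K0\<^sup>2) + 2 * ennreal (\<bar>y\<bar> ^ 2) \<partial>\<kappa> x)"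
        proof (rule nn_integral_mono)
          fix y
          have "(g x)\<^sup>2 \<le> K0\<^sup>2" using K0(2)[OF x] K0(1) by (intro power2_le_iff_abs_le[THEN iffD2]) auto
          moreover have "(y - g x)\<^sup>2 \<le> 2 * y\<^sup>2 + 2 * (g x)\<^sup>2"
            using zero_le_power2[of "y + g x"] by (simp add: power2_eq_square algebra_simps)
          ultimately have "(y - g x)\<^sup>2 \<le> 2 * K0\<^sup>2 + 2 * \<bar>y\<bar>\<^sup>2" by simp
          then have "ennreal ((y - g x)\<^sup>2) \<le> ennreal (2 * K0\<^sup>2 + 2 * \<bar>y\<bar>\<^sup>2)" by (rule ennreal_leI)
          also have "\<dots> = ennreal (2 * K0\<^sup>2) + 2 * ennreal (\<bar>y\<bar> ^ 2)"
            by (simp add: ennreal_plus ennreal_mult')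
          finally show "ennreal ((y - g x)\<^sup>2) \<le> ennreal (2 * K0\<^sup>2) + 2 * ennreal (\<bar>y\<bar> ^ 2)" .
        qed
        also have "\<dots> = ennreal (2 * K0\<^sup>2) + 2 * (\<integral>\<^sup>+y. ennreal (\<bar>y\<bar> ^ 2) \<partial>\<kappa> x)"
          by (simp add: nn_integral_add nn_integral_cmult k.emeasure_space_1)
        also have "\<dots> \<le> ennreal (2 * K0\<^sup>2) + 2 * ennreal (2 * a0)"
          using mom[of 2 x] x by (intro add_left_mono mult_left_mono) (auto simp: mult.commute)
        also have "\<dots> = ennreal v"
          using a0 by (simp add: v_def flip: ennreal_plus ennreal_mult' ennreal_numeral)
        finally have "h x * (\<integral>\<^sup>+y. ennreal ((y - g x)\<^sup>2) \<partial>\<kappa> x) \<le> h x * ennreal v"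
          by (intro mult_left_mono) auto
        then show ?thesis by (simp add: nn_integral_cmult)
      qed
      have "(\<integral>\<^sup>+z. h (fst z) * ennreal ((snd z - g (fst z))\<^sup>2) \<partial>P)
          = (\<integral>\<^sup>+x. (\<integral>\<^sup>+y. h x * ennreal ((y - g x)\<^sup>2) \<partial>\<kappa> x) \<partial>design_law P)"
        by (subst conditional_law_nn_integral[OF P \<kappa>]) (simp_all flip: borel_prod)
      also have "\<dots> \<le> (\<integral>\<^sup>+x. h x * ennreal v \<partial>design_law P)"
        using S by (intro nn_integral_mono_AE) (auto elim!: eventually_mono intro: inner)
      also have "\<dots> = ennreal v * (\<integral>\<^sup>+x. h x \<partial>design_law P)"
        by (subst nn_integral_multc) (auto simp: mult.commute)
      also have "(\<integral>\<^sup>+x. h x \<partial>design_law P) = (\<integral>\<^sup>+z. h (fst z) \<partial>P)"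
        unfolding design_law_def by (rule nn_integral_distr) auto
      finally show ?thesis .
    qed
  qed (use v in \<open>auto simp flip: borel_prod\<close>)
  then show ?thesis unfolding g_def by blast
qed

section \<open>Projections of the design\<close>

text \<open>
  Some coordinate of the unit vector \<open>\<alpha>\<close> is at least \<open>1 / d\<close> in absolute value.  Integrating over this
  coordinate first is an affine substitution in one variable; the others range over a cube.
\<close>

lemma nn_integral_projection_le:
  fixes \<alpha> :: "'a :: euclidean_space" and \<phi> :: "real \<Rightarrow> ennreal" and R :: real
  assumes \<alpha>: "norm \<alpha> = 1" and R: "R \<ge> 0" and \<phi> [measurable]: "\<phi> \<in> borel_measurable borel"
  shows "(\<integral>\<^sup>+x. (if \<forall>b\<in>Basis. \<bar>x \<bullet> b\<bar> \<le> R then \<phi> (\<alpha> \<bullet> x) else 0) \<partial>lborel)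
    \<le> ennreal (DIM('a) * (2 * R) ^ (DIM('a) - 1)) * (\<integral>\<^sup>+t. \<phi> t \<partial>lborel)"
proof -
  let ?L = "\<lambda>_ :: 'a. lborel :: real measure"
  interpret product_sigma_finite ?L by unfold_locales
  have "\<exists>b0 :: 'a \<in> Basis. 1 / real DIM('a) \<le> \<bar>\<alpha> \<bullet> b0\<bar>"
  proof (rule ccontr)
    assume "\<not> ?thesis"
    then have "(\<Sum>b\<in>Basis. \<bar>\<alpha> \<bullet> b\<bar>) < (\<Sum>b\<in>(Basis :: 'a set). 1 / real DIM('a))"
      by (intro sum_strict_mono) (auto simp: not_le)
    also have "\<dots> = 1" by simp
    finally show False using norm_le_l1[of \<alpha>] \<alpha> by simp
  qed
  then obtain b0 :: 'a where b0: "b0 \<in> Basis" "1 / real DIM('a) \<le> \<bar>\<alpha> \<bullet> b0\<bar>" by blast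
  define a where "a = \<alpha> \<bullet> b0"
  have "0 < 1 / real DIM('a)" by simp
  then have a: "a \<noteq> 0" "1 / \<bar>a\<bar> \<le> real DIM('a)"
    using b0(2) by (auto simp: a_def divide_le_eq mult.commute)
  define I where "I = (Basis :: 'a set) - {b0}"
  have I: "finite I" "b0 \<notin> I" "Basis = insert b0 I" using b0(1) by (auto simp: I_def)
  define F where "F f = (if \<forall>b\<in>Basis. \<bar>f b\<bar> \<le> R then \<phi> (\<Sum>b\<in>Basis. f b * (\<alpha> \<bullet> b)) else 0)" for f :: "'a \<Rightarrow> real"
  have F_m: "F \<in> borel_measurable (Pi\<^sub>M Basis ?L)" unfolding F_def by measurable
  have box_m: "(\<lambda>x :: 'a. if \<forall>b\<in>Basis. \<bar>x \<bullet> b\<bar> \<le> R then \<phi> (\<alpha> \<bullet> x) else 0) \<in> borel_measurable borel"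
    by measurable
  have "(\<integral>\<^sup>+x. (if \<forall>b\<in>Basis. \<bar>x \<bullet> b\<bar> \<le> R then \<phi> (\<alpha> \<bullet> x) else 0) \<partial>lborel)
      = (\<integral>\<^sup>+f. F f \<partial>Pi\<^sub>M Basis ?L)"
  proof -
    have F_eq: "F f = (if \<forall>b\<in>Basis. \<bar>f b\<bar> \<le> R then \<phi> (\<alpha> \<bullet> (\<Sum>b\<in>Basis. f b *\<^sub>R b)) else 0)" for f
      unfolding F_def inner_sum_right by simp
    show ?thesis
      unfolding F_eq[abs_def] by (subst lborel_eq) (use box_m in \<open>simp add: nn_integral_distr\<close>)
  qed
  also have "\<dots> = (\<integral>\<^sup>+f. (\<integral>\<^sup>+y. F (f(b0 := y)) \<partial>lborel) \<partial>Pi\<^sub>M I ?L)"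
    using product_nn_integral_insert[OF I(1,2), of F] F_m unfolding I(3) by simp
  also have "\<dots> \<le> (\<integral>\<^sup>+f. (\<Prod>b\<in>I. indicator {-R..R} (f b)) * (ennreal (real DIM('a)) * (\<integral>\<^sup>+t. \<phi> t \<partial>lborel)) \<partial>Pi\<^sub>M I ?L)"
  proof (rule nn_integral_mono)
    fix f :: "'a \<Rightarrow> real"
    define c where "c = (\<Sum>b\<in>I. f b * (\<alpha> \<bullet> b))"
    have upd: "(\<Sum>b\<in>Basis. (f(b0 := y)) b * (\<alpha> \<bullet> b)) = c + a * y" for y
      unfolding I(3) using I(1,2) by (subst sum.insert) (auto simp: c_def a_def intro!: sum.cong)
    have "F (f(b0 := y)) \<le> (\<Prod>b\<in>I. indicator {-R..R} (f b)) * \<phi> (c + a * y)" for y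
    proof (cases "\<forall>b\<in>Basis. \<bar>(f(b0 := y)) b\<bar> \<le> R")
      case True
      then have "\<bar>f b\<bar> \<le> R" if "b \<in> I" for b
        using bspec[OF True, of b] that by (cases "b = b0") (auto simp: I_def)
      then have "(\<Prod>b\<in>I. indicator {-R..R} (f b)) = (1 :: ennreal)"
        by (intro prod.neutral) (auto simp: abs_le_iff minus_le_iff indicator_def)
      then show ?thesis using True unfolding F_def upd by simp
    next
      case False
      then have "F (f(b0 := y)) = 0" unfolding F_def by (rule if_not_P)
      then show ?thesis by simp
    qed
    then have "(\<integral>\<^sup>+y. F (f(b0 := y)) \<partial>lborel) \<le> (\<integral>\<^sup>+y. (\<Prod>b\<in>I. indicator {-R..R} (f b)) * \<phi> (c + a * y) \<partial>lborel)"
      by (intro nn_integral_mono)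
    also have "\<dots> = (\<Prod>b\<in>I. indicator {-R..R} (f b)) * (\<integral>\<^sup>+y. \<phi> (c + a * y) \<partial>lborel)"
      by (rule nn_integral_cmult) measurable
    also have "\<dots> \<le> (\<Prod>b\<in>I. indicator {-R..R} (f b)) * (ennreal (real DIM('a)) * (\<integral>\<^sup>+t. \<phi> t \<partial>lborel))"
    proof (rule mult_left_mono)
      have "(\<integral>\<^sup>+y. \<phi> (c + a * y) \<partial>lborel) = ennreal (1 / \<bar>a\<bar>) * (\<integral>\<^sup>+t. \<phi> t \<partial>lborel)"
        unfolding nn_integral_real_affine[OF \<phi> a(1), of c] using a(1)
        by (simp add: mult.assoc[symmetric] ennreal_mult'[symmetric])
      also have "\<dots> \<le> ennreal (real DIM('a)) * (\<integral>\<^sup>+t. \<phi> t \<partial>lborel)"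
        using a(2) by (intro mult_right_mono ennreal_leI) auto
      finally show "(\<integral>\<^sup>+y. \<phi> (c + a * y) \<partial>lborel) \<le> ennreal (real DIM('a)) * (\<integral>\<^sup>+t. \<phi> t \<partial>lborel)" .
    qed simp
    finally show "(\<integral>\<^sup>+y. F (f(b0 := y)) \<partial>lborel)
        \<le> (\<Prod>b\<in>I. indicator {-R..R} (f b)) * (ennreal (real DIM('a)) * (\<integral>\<^sup>+t. \<phi> t \<partial>lborel))" .
  qed
  also have "\<dots> = (\<integral>\<^sup>+f. (\<Prod>b\<in>I. indicator {-R..R} (f b)) \<partial>Pi\<^sub>M I ?L) * (ennreal (real DIM('a)) * (\<integral>\<^sup>+t. \<phi> t \<partial>lborel))"
    using I(1) by (intro nn_integral_multc) measurable
  also have "(\<integral>\<^sup>+f. (\<Prod>b\<in>I. indicator {-R..R} (f b)) \<partial>Pi\<^sub>M I ?L) = (\<Prod>b\<in>I. \<integral>\<^sup>+y. indicator {-R..R} y \<partial>lborel)"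
    by (rule product_nn_integral_prod[OF I(1)]) auto
  also have "\<dots> = ennreal ((2 * R) ^ card I)" using R by (simp add: ennreal_power)
  also have "card I = DIM('a) - 1" using b0(1) by (simp add: I_def)
  also have "ennreal ((2 * R) ^ (DIM('a) - 1)) * (ennreal (real DIM('a)) * (\<integral>\<^sup>+t. \<phi> t \<partial>lborel))
      = ennreal (DIM('a) * (2 * R) ^ (DIM('a) - 1)) * (\<integral>\<^sup>+t. \<phi> t \<partial>lborel)"
    using R by (simp add: ennreal_mult mult_ac)
  finally show ?thesis .
qed

text \<open>
  The supremum over \<open>s\<close> of \<open>\<Psi> s\<close> minus a penalty for \<open>s\<close> to the right of \<open>t\<close>.  The one-sided penalty is
  what keeps the extension non-decreasing, also at an end point where \<open>\<Psi>\<close> itself may jump.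
\<close>

lemma monotone_lipschitz_extension:
  fixes \<Psi> :: "real \<Rightarrow> real"
  assumes mono: "mono \<Psi>" and L: "L-lipschitz_on I \<Psi>" and I: "I \<noteq> {}" and bd: "\<And>t. t \<in> I \<Longrightarrow> \<bar>\<Psi> t\<bar> \<le> K0"
  obtains \<psi> where "mono \<psi>" "L-lipschitz_on UNIV \<psi>" "\<And>t. t \<in> I \<Longrightarrow> \<psi> t = \<Psi> t"
proof -
  have L0: "L \<ge> 0" using L by (rule lipschitz_on_nonneg)
  define \<psi> where "\<psi> t = (SUP s\<in>I. \<Psi> s - L * max 0 (s - t))" for t
  have bdd: "bdd_above ((\<lambda>s. \<Psi> s - L * max 0 (s - t)) ` I)" for t
  proof (rule bdd_aboveI2)
    fix s assume "s \<in> I"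
    then show "\<Psi> s - L * max 0 (s - t) \<le> K0"
      using bd[of s] mult_nonneg_nonneg[OF L0, of "max 0 (s - t)"] by simp
  qed
  have up: "\<psi> t \<le> \<psi> u + L * max 0 (t - u)" for t u
    unfolding \<psi>_def
  proof (rule cSUP_least[OF I])
    fix s assume s: "s \<in> I"
    have "max 0 (s - u) \<le> max 0 (s - t) + max 0 (t - u)" by simp
    from mult_left_mono[OF this L0]
    have "\<Psi> s - L * max 0 (s - t) \<le> \<Psi> s - L * max 0 (s - u) + L * max 0 (t - u)"
      by (simp add: distrib_left)
    also have "\<Psi> s - L * max 0 (s - u) \<le> (SUP s\<in>I. \<Psi> s - L * max 0 (s - u))"
      by (rule cSUP_upper[OF s bdd])
    finally show "\<Psi> s - L * max 0 (s - t) \<le> (SUP s\<in>I. \<Psi> s - L * max 0 (s - u)) + L * max 0 (t - u)"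
      by simp
  qed
  have "mono \<psi>"
  proof (rule monoI)
    fix t u :: real assume "t \<le> u"
    then have "max 0 (t - u) = 0" by simp
    then show "\<psi> t \<le> \<psi> u" using up[of t u] by simp
  qed
  moreover have "L-lipschitz_on UNIV \<psi>"
  proof (rule lipschitz_onI[OF _ L0])
    fix t u :: real
    have "L * max 0 (t - u) \<le> L * \<bar>t - u\<bar>" "L * max 0 (u - t) \<le> L * \<bar>t - u\<bar>"
      using L0 by (auto intro!: mult_left_mono)
    then show "dist (\<psi> t) (\<psi> u) \<le> L * dist t u"
      using up[of t u] up[of u t] unfolding dist_real_def by linarith
  qed
  moreover have "\<psi> t = \<Psi> t" if t: "t \<in> I" for t
  proof (rule antisym)
    show "\<psi> t \<le> \<Psi> t" unfolding \<psi>_def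
    proof (rule cSUP_least[OF I])
      fix s assume s: "s \<in> I"
      show "\<Psi> s - L * max 0 (s - t) \<le> \<Psi> t"
      proof (cases "s \<le> t")
        case True
        then show ?thesis using monoD[OF mono True] by simp
      next
        case False
        then show ?thesis using lipschitz_onD[OF L s t] by (simp add: dist_real_def)
      qed
    qed
    show "\<Psi> t \<le> \<psi> t" unfolding \<psi>_def using cSUP_upper[OF t bdd, of t] by simp
  qed
  ultimately show ?thesis using that by blast
qed

definition support_function :: "(real ^ 'd) set \<Rightarrow> real ^ 'd \<Rightarrow> real" where
  "support_function S \<alpha> = Sup (index_range S \<alpha>)"

lemma bdd_index_range:
  assumes "\<And>x. x \<in> S \<Longrightarrow> norm x \<le> R"
  shows "bdd_above (index_range S \<alpha>)" "bdd_below (index_range S \<alpha>)"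
proof -
  have "\<bar>\<alpha> \<bullet> x\<bar> \<le> norm \<alpha> * R" if "x \<in> S" for x
    using Cauchy_Schwarz_ineq2[of \<alpha> x] mult_left_mono[OF assms[OF that], of "norm \<alpha>"] by simp
  then have "\<alpha> \<bullet> x \<le> norm \<alpha> * R" "- (norm \<alpha> * R) \<le> \<alpha> \<bullet> x" if "x \<in> S" for x
    using that by (fastforce simp: abs_le_iff)+
  then show "bdd_above (index_range S \<alpha>)" "bdd_below (index_range S \<alpha>)"
    unfolding index_range_def by (auto intro!: bdd_aboveI2[of S _ "norm \<alpha> * R"] bdd_belowI2[of S "- (norm \<alpha> * R)"])
qed

lemma Inf_index_range:
  "Inf (index_range S \<alpha>) = - support_function S (- \<alpha>)"
  unfolding support_function_def index_range_def Inf_real_def image_image by simp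

lemma support_function_upper:
  assumes "\<And>x. x \<in> S \<Longrightarrow> norm x \<le> R" "x \<in> S"
  shows "\<alpha> \<bullet> x \<le> support_function S \<alpha>" "- support_function S (- \<alpha>) \<le> \<alpha> \<bullet> x"
proof -
  have *: "\<beta> \<bullet> x \<le> support_function S \<beta>" for \<beta>
    unfolding support_function_def
    by (rule cSup_upper) (use assms(2) bdd_index_range[OF assms(1)] in \<open>auto simp: index_range_def\<close>)
  show "\<alpha> \<bullet> x \<le> support_function S \<alpha>" "- support_function S (- \<alpha>) \<le> \<alpha> \<bullet> x"
    using *[of \<alpha>] *[of "- \<alpha>"] by auto
qed

lemma support_function_le:
  assumes bd: "\<And>x. x \<in> S \<Longrightarrow> norm x \<le> R" and ne: "S \<noteq> {}"
  shows "support_function S \<alpha> \<le> support_function S \<beta> + R * norm (\<alpha> - \<beta>)"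
  unfolding support_function_def[of S \<alpha>]
proof (rule cSup_least)
  show "index_range S \<alpha> \<noteq> {}" using ne by (simp add: index_range_def)
  fix t assume "t \<in> index_range S \<alpha>"
  then obtain x where x: "x \<in> S" "t = \<alpha> \<bullet> x" by (auto simp: index_range_def)
  have "\<alpha> \<bullet> x = \<beta> \<bullet> x + (\<alpha> - \<beta>) \<bullet> x" by (simp add: inner_diff_left)
  also have "(\<alpha> - \<beta>) \<bullet> x \<le> norm (\<alpha> - \<beta>) * norm x" by (rule norm_cauchy_schwarz)
  also have "\<dots> \<le> norm (\<alpha> - \<beta>) * R" by (intro mult_left_mono bd x) auto
  also have "\<beta> \<bullet> x \<le> support_function S \<beta>" by (rule support_function_upper[OF bd x(1)])
  finally show "t \<le> support_function S \<beta> + R * norm (\<alpha> - \<beta>)" by (simp add: x(2) mult.commute)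
qed

lemma borel_measurable_support_function:
  assumes bd: "\<And>x. x \<in> S \<Longrightarrow> norm x \<le> R" and ne: "S \<noteq> {}"
  shows "support_function S \<in> borel_measurable borel"
proof (rule borel_measurable_continuous_onI, rule lipschitz_on_continuous_on)
  obtain x where "x \<in> S" using ne by blast
  then have R: "R \<ge> 0" using bd[of x] norm_ge_zero[of x] by linarith
  show "R-lipschitz_on UNIV (support_function S)"
  proof (rule lipschitz_onI[OF _ R])
    fix \<alpha> \<beta> :: "real ^ 'a"
    show "dist (support_function S \<alpha>) (support_function S \<beta>) \<le> R * dist \<alpha> \<beta>"
      using support_function_le[OF bd ne, of \<alpha> \<beta>] support_function_le[OF bd ne, of \<beta> \<alpha>]
      by (auto simp: dist_norm abs_le_iff norm_minus_commute)
  qed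
qed

lemma Ioo_subset_index_range:
  assumes cv: "convex S" and ne: "S \<noteq> {}" and bd: "\<And>x. x \<in> S \<Longrightarrow> norm x \<le> R"
  shows "{- support_function S (- \<alpha>) <..< support_function S \<alpha>} \<subseteq> index_range S \<alpha>"
proof
  fix t assume t: "t \<in> {- support_function S (- \<alpha>) <..< support_function S \<alpha>}"
  have ne': "index_range S \<alpha> \<noteq> {}" using ne by (simp add: index_range_def)
  obtain u where u: "u \<in> index_range S \<alpha>" "t < u"
    using t less_cSup_iff[OF ne' bdd_index_range(1)[OF bd], of t] by (auto simp: support_function_def)
  obtain l where l: "l \<in> index_range S \<alpha>" "l < t"
    using t cInf_less_iff[OF ne' bdd_index_range(2)[OF bd], of t] by (auto simp: Inf_index_range)
  have "convex (index_range S \<alpha>)"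
    unfolding index_range_def by (rule convex_linear_image[OF _ cv]) (intro bounded_linear.linear bounded_linear_inner_right)
  then have "is_interval (index_range S \<alpha>)" by (simp add: is_interval_convex_1)
  then show "t \<in> index_range S \<alpha>" using l u unfolding is_interval_1 by (meson less_imp_le)
qed

text \<open>
  The density has total mass one on an interval, so its bounds confine the length of the interval.
\<close>

lemma projected_density_facts:
  fixes P :: "((real ^ 'd) \<times> real) measure"
  assumes P: "prob_space P" and S_P: "AE z in P. fst z \<in> S"
    and cv: "convex S" and ne: "S \<noteq> {}" and bd: "\<And>x. x \<in> S \<Longrightarrow> norm x \<le> R"
    and d: "distributed P lborel (\<lambda>z. \<alpha> \<bullet> fst z) (\<lambda>t. ennreal (f t))"
    and f: "\<And>t. 0 \<le> f t" "\<And>t. f t \<le> q_up" "\<And>t. t \<in> index_range S \<alpha> \<Longrightarrow> q_low \<le> f t"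
    and q: "0 < q_up" "0 < q_low"
  defines "lo \<equiv> - support_function S (- \<alpha>)" and "hi \<equiv> support_function S \<alpha>"
  shows "1 / q_up \<le> hi - lo" "hi - lo \<le> 1 / q_low"
    "\<And>a b. lo \<le> a \<Longrightarrow> a \<le> b \<Longrightarrow> b \<le> hi \<Longrightarrow>
       q_low * (b - a) \<le> measure P {z \<in> space P. \<alpha> \<bullet> fst z \<in> {a..b}}"
proof -
  interpret prob_space P by (rule P)
  have X_m [measurable]: "(\<lambda>z. \<alpha> \<bullet> fst z) \<in> borel_measurable P"
    using distributed_measurable[OF d] by simp
  have em: "ennreal (prob {z \<in> space P. \<alpha> \<bullet> fst z \<in> {a..b}}) = (\<integral>\<^sup>+t. ennreal (f t) * indicator {a..b} t \<partial>lborel)" for a b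
  proof -
    have eq: "{z \<in> space P. \<alpha> \<bullet> fst z \<in> {a..b}} = (\<lambda>z. \<alpha> \<bullet> fst z) -` {a..b} \<inter> space P" by auto
    show ?thesis unfolding eq emeasure_eq_measure[symmetric]
      by (rule distributed_emeasure[OF d]) simp
  qed
  have low: "q_low * (b - a) \<le> prob {z \<in> space P. \<alpha> \<bullet> fst z \<in> {a..b}}" if "lo \<le> a" "a \<le> b" "b \<le> hi" for a b
  proof -
    have "ennreal (q_low * (b - a)) = (\<integral>\<^sup>+t. ennreal q_low * indicator {a<..<b} t \<partial>lborel)"
      using that q by (subst nn_integral_cmult_indicator) (auto simp: ennreal_mult')
    also have "\<dots> \<le> (\<integral>\<^sup>+t. ennreal (f t) * indicator {a..b} t \<partial>lborel)"
    proof (rule nn_integral_mono)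
      fix t
      have "t \<in> {a<..<b} \<Longrightarrow> q_low \<le> f t"
        using Ioo_subset_index_range[OF cv ne bd, of \<alpha>] that by (intro f) (auto simp: lo_def hi_def)
      then show "ennreal q_low * indicator {a<..<b} t \<le> ennreal (f t) * indicator {a..b} t"
        by (auto simp: indicator_def intro: ennreal_leI)
    qed
    also have "\<dots> = ennreal (prob {z \<in> space P. \<alpha> \<bullet> fst z \<in> {a..b}})" by (rule em[symmetric])
    finally show ?thesis by (simp add: ennreal_le_iff)
  qed
  then show "\<And>a b. lo \<le> a \<Longrightarrow> a \<le> b \<Longrightarrow> b \<le> hi \<Longrightarrow>
       q_low * (b - a) \<le> measure P {z \<in> space P. \<alpha> \<bullet> fst z \<in> {a..b}}" .
  obtain x0 where "x0 \<in> S" using ne by blast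
  then have lohi: "lo \<le> hi" using support_function_upper[of S R x0 \<alpha>] bd by (auto simp: lo_def hi_def)
  have "q_low * (hi - lo) \<le> 1" using low[of lo hi] lohi prob_le_1 by (meson order_refl order_trans)
  then show "hi - lo \<le> 1 / q_low" using q by (simp add: field_simps)
  have "AE z in P. z \<in> {z \<in> space P. \<alpha> \<bullet> fst z \<in> {lo..hi}}"
    using S_P AE_space
  proof eventually_elim
    case (elim z)
    then show ?case using support_function_upper[of S R "fst z" \<alpha>] bd by (simp add: lo_def hi_def)
  qed
  then have "prob {z \<in> space P. \<alpha> \<bullet> fst z \<in> {lo..hi}} = 1"
    by (subst prob_eq_1) auto
  then have "1 = (\<integral>\<^sup>+t. ennreal (f t) * indicator {lo..hi} t \<partial>lborel)"
    using em[of lo hi] by simp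
  also have "\<dots> \<le> (\<integral>\<^sup>+t. ennreal q_up * indicator {lo..hi} t \<partial>lborel)"
    using f(2) by (intro nn_integral_mono mult_right_mono ennreal_leI) auto
  also have "\<dots> = ennreal (q_up * (hi - lo))"
    using lohi q by (subst nn_integral_cmult_indicator) (auto simp: ennreal_mult')
  finally have "1 \<le> q_up * (hi - lo)" using q lohi by (simp flip: ennreal_1 add: ennreal_le_iff)
  then show "1 / q_up \<le> hi - lo" using q by (simp add: field_simps)
qed

section \<open>The isotonic fit on a grid of cells\<close>

definition knot :: "real \<Rightarrow> real \<Rightarrow> nat \<Rightarrow> nat \<Rightarrow> real" where
  "knot lo hi K j = lo + real j * ((hi - lo) / real K)"

text \<open>
  The last cell has no right neighbour that could serve as window; its final piece, of length
  \<open>(hi - lo) / K\<^sup>2\<close>, takes this role.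
\<close>

definition end_knot :: "real \<Rightarrow> real \<Rightarrow> nat \<Rightarrow> real" where
  "end_knot lo hi K = hi - (hi - lo) / (real K)\<^sup>2"

text \<open>
  The noise part of a bound for the integrated squared excess of the fit: each squared maximal mean is
  multiplied by the length of the piece on which it is used.  The window of a cell is its right
  neighbour, that of the last cell is its end piece, and on the end piece all windows are admitted.
\<close>

definition noise_bound :: "real \<Rightarrow> real \<Rightarrow> nat \<Rightarrow> nat \<Rightarrow> nat \<Rightarrow> 'i set \<Rightarrow> ('i \<Rightarrow> real) \<Rightarrow> ('i \<Rightarrow> real) \<Rightarrow> real" where
  "noise_bound lo hi K N N' J t e =
     (\<Sum>j\<in>{1..<K}. (hi - lo) / real K * (max_window_mean N J t (knot lo hi K (Suc j)) e)\<^sup>2)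
     + (hi - lo) / real K * (max_window_mean N' J t hi e)\<^sup>2
     + (hi - lo) / (real K)\<^sup>2 * (max_window_mean 1 J t hi e)\<^sup>2"

definition well_filled :: "real \<Rightarrow> real \<Rightarrow> nat \<Rightarrow> nat \<Rightarrow> nat \<Rightarrow> 'i set \<Rightarrow> ('i \<Rightarrow> real) \<Rightarrow> bool" where
  "well_filled lo hi K N N' J t \<longleftrightarrow>
     (\<forall>j\<in>{1..<K}. N \<le> card (window J t (knot lo hi K j) (knot lo hi K (Suc j)))) \<and>
     N' \<le> card (window J t (end_knot lo hi K) hi)"

lemma max_window_mean_minus: "max_window_mean N J t b (\<lambda>i. - e i) = max_window_mean N J t b e"
  by (simp add: max_window_mean_def sum_negf)

lemma noise_bound_minus: "noise_bound lo hi K N N' J t (\<lambda>i. - e i) = noise_bound lo hi K N N' J t e"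
  by (simp add: noise_bound_def max_window_mean_minus)

lemma isotonic_lse_excess_le:
  fixes t y e :: "'i \<Rightarrow> real"
  assumes J: "finite J" and lse: "is_arg_min (\<lambda>\<Phi>. \<Sum>i\<in>J. (y i - \<Phi> (t i))\<^sup>2) mono \<Psi>"
    and i0: "i0 \<in> J" "t i0 \<le> b" and N: "N \<le> card (window J t (t i0) b)"
    and \<psi>: "mono \<psi>" "L-lipschitz_on UNIV \<psi>"
    and y: "\<And>i. i \<in> J \<Longrightarrow> y i \<le> \<psi> (t i) + \<delta> + e i"
    and s: "\<Psi> s \<le> \<Psi> (t i0)" "s \<le> b"
  shows "\<Psi> s - \<psi> s \<le> L * (b - s) + \<delta> + max_window_mean N J t b e"
proof -
  have "\<Psi> (t i0) \<le> (\<psi> b + \<delta>) + max_window_mean N J t b e"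
  proof (rule isotonic_lse_le_max_window_mean[OF J lse i0 N])
    show "y i \<le> \<psi> b + \<delta> + e i" if "i \<in> J" "t i \<le> b" for i
      using y[OF that(1)] monoD[OF \<psi>(1) that(2)] by linarith
  qed
  moreover have "\<psi> b - \<psi> s \<le> L * (b - s)"
    using lipschitz_onD[OF \<psi>(2), of b s] s(2) by (simp add: dist_real_def)
  ultimately show ?thesis using s(1) by linarith
qed

lemma square_pos_part_le:
  fixes x :: real
  assumes "x \<le> a + b + c" "0 \<le> a" "0 \<le> b" "0 \<le> c"
  shows "(max 0 x)\<^sup>2 \<le> 3 * a\<^sup>2 + 3 * b\<^sup>2 + 3 * c\<^sup>2"
proof -
  have "(max 0 x)\<^sup>2 \<le> (a + b + c)\<^sup>2" using assms by (intro power_mono) auto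
  also have "\<dots> \<le> 3 * a\<^sup>2 + 3 * b\<^sup>2 + 3 * c\<^sup>2"
    using zero_le_power2[of "a - b"] zero_le_power2[of "a - c"] zero_le_power2[of "b - c"]
    by (simp add: power2_eq_square algebra_simps)
  finally show ?thesis .
qed

text \<open>
  The piece that contains \<open>s\<close> decides which window is used.  On the end piece the fit at \<open>s\<close> is
  compared with the fit at the rightmost design point, beyond which it is constant.
\<close>

lemma isotonic_lse_pointwise_bound:
  fixes t y e :: "'i \<Rightarrow> real"
  assumes J: "finite J" "J \<noteq> {}" and lse: "is_arg_min (\<lambda>\<Phi>. \<Sum>i\<in>J. (y i - \<Phi> (t i))\<^sup>2) mono \<Psi>"
    and right: "\<And>u. u \<ge> Max (t ` J) \<Longrightarrow> \<Psi> u = \<Psi> (Max (t ` J))"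
    and \<psi>: "mono \<psi>" "L-lipschitz_on UNIV \<psi>"
    and \<delta>: "0 \<le> \<delta>" and y: "\<And>i. i \<in> J \<Longrightarrow> y i \<le> \<psi> (t i) + \<delta> + e i"
    and hi: "\<And>i. i \<in> J \<Longrightarrow> t i \<le> hi" and lohi: "lo < hi" and K: "K \<ge> 1" and N: "N \<ge> 1" "N' \<ge> 1"
    and filled: "well_filled lo hi K N N' J t" and s: "lo \<le> s" "s \<le> hi"
  shows "(max 0 (\<Psi> s - \<psi> s))\<^sup>2 \<le> 3 * (2 * L * (hi - lo) / real K)\<^sup>2 + 3 * \<delta>\<^sup>2
    + 3 * ((\<Sum>j\<in>{1..<K}. indicator {knot lo hi K (j - 1)..knot lo hi K j} s
              * (max_window_mean N J t (knot lo hi K (Suc j)) e)\<^sup>2)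
         + indicator {knot lo hi K (K - 1)..hi} s * (max_window_mean N' J t hi e)\<^sup>2
         + indicator {end_knot lo hi K..hi} s * (max_window_mean 1 J t hi e)\<^sup>2)"
    (is "?lhs \<le> ?A + ?B + 3 * (sum ?g _ + ?E + ?F)")
proof -
  define h where "h = (hi - lo) / real K"
  have h: "h > 0" using lohi K by (simp add: h_def)
  have L: "L \<ge> 0" using \<psi>(2) by (rule lipschitz_on_nonneg)
  have mono: "mono \<Psi>" using lse by (simp add: is_arg_min_def)
  have knot: "knot lo hi K j = lo + real j * h" for j by (simp add: knot_def h_def)
  have knotK: "knot lo hi K K = hi" using K by (simp add: knot_def)
  have mw0: "0 \<le> max_window_mean n J t b e" for n b
    unfolding max_window_mean_def using J(1) by simp
  have A: "?A = 3 * (2 * L * h)\<^sup>2" by (simp add: h_def)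
  have g0: "0 \<le> sum ?g {1..<K}" by (intro sum_nonneg) auto
  have E0: "0 \<le> ?E" "0 \<le> ?F" by auto
  have combine: "x \<le> a + b + 3 * (u + v + w)"
    if "x \<le> a + b + 3 * d" "d \<le> u \<or> d \<le> v \<or> d \<le> w" "0 \<le> u" "0 \<le> v" "0 \<le> w"
    for x a b d u v w :: real
    using that by auto
  have final: "?lhs \<le> ?A + ?B + 3 * D\<^sup>2"
    if "\<Psi> s - \<psi> s \<le> L * (b - s) + \<delta> + D" "b - s \<le> 2 * h" "0 \<le> D" for b D
  proof -
    have "L * (b - s) \<le> L * (2 * h)" using that(2) L by (intro mult_left_mono)
    then have "\<Psi> s - \<psi> s \<le> 2 * L * h + \<delta> + D" using that(1) by (simp add: mult_ac)
    from square_pos_part_le[OF this _ \<delta> that(3)] show ?thesis unfolding A using L h by simp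
  qed
  have window_case: "\<Psi> s - \<psi> s \<le> L * (b - s) + \<delta> + max_window_mean n J t b e"
    if "s \<le> a" "a \<le> b" "n \<ge> 1" "n \<le> card (window J t a b)" for a b n
  proof -
    have "window J t a b \<noteq> {}" using that(3,4) by auto
    then obtain i0 where i0: "i0 \<in> window J t a b" "\<And>i. i \<in> window J t a b \<Longrightarrow> t i0 \<le> t i"
      using exists_argmin[of "window J t a b" t] J(1) by auto
    have eq: "window J t (t i0) b = window J t a b" using i0 by (auto simp: window_def)
    show ?thesis
      using i0(1) that monoD[OF mono, of s "t i0"]
      by (intro isotonic_lse_excess_le[OF J(1) lse, of i0] \<psi> y) (auto simp: eq, auto simp: window_def)
  qed
  define j where "j = nat \<lfloor>(s - lo) / h\<rfloor>"
  have "0 \<le> (s - lo) / h" using s(1) h by simp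
  then have "real j \<le> (s - lo) / h" "(s - lo) / h < real j + 1"
    unfolding j_def by linarith+
  then have j: "lo + real j * h \<le> s" "s < lo + (real j + 1) * h"
    using h by (auto simp: field_simps)
  have hK: "lo + real K * h = hi" using knotK knot[of K] by simp
  show ?thesis
  proof (cases "Suc j < K")
    case True
    have "?lhs \<le> ?A + ?B + 3 * (max_window_mean N J t (knot lo hi K (Suc (Suc j))) e)\<^sup>2"
    proof (rule final[OF window_case])
      show "s \<le> knot lo hi K (Suc j)" "knot lo hi K (Suc j) \<le> knot lo hi K (Suc (Suc j))"
        "knot lo hi K (Suc (Suc j)) - s \<le> 2 * h"
        using j h by (auto simp: knot algebra_simps)
      show "N \<le> card (window J t (knot lo hi K (Suc j)) (knot lo hi K (Suc (Suc j))))"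
        using filled True by (simp add: well_filled_def)
    qed (use N mw0 in auto)
    moreover have "(max_window_mean N J t (knot lo hi K (Suc (Suc j))) e)\<^sup>2 = ?g (Suc j)"
      using j by (simp add: knot algebra_simps)
    moreover have "?g (Suc j) \<le> sum ?g {1..<K}"
      using True by (intro member_le_sum[of "Suc j" "{1..<K}" ?g]) auto
    ultimately show ?thesis by (intro combine[OF _ _ g0 E0]) auto
  next
    case False
    have sK: "knot lo hi K (K - 1) \<le> s"
    proof -
      have "real (K - 1) \<le> real j" using False by simp
      then have "real (K - 1) * h \<le> real j * h" using h by (intro mult_right_mono) auto
      then show ?thesis using j(1) by (simp add: knot)
    qed
    have near: "hi - s \<le> 2 * h"
    proof -
      have "hi - h = lo + real (K - 1) * h" using hK K by (simp add: of_nat_diff algebra_simps)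
      then show ?thesis using sK h by (simp add: knot)
    qed
    show ?thesis
    proof (cases "s \<le> end_knot lo hi K")
      case True
      have "?lhs \<le> ?A + ?B + 3 * (max_window_mean N' J t hi e)\<^sup>2"
      proof (rule final[OF window_case near])
        show "s \<le> end_knot lo hi K" by (rule True)
        show "end_knot lo hi K \<le> hi" using lohi by (simp add: end_knot_def)
        show "N' \<le> card (window J t (end_knot lo hi K) hi)" using filled by (simp add: well_filled_def)
      qed (use N mw0 in auto)
      moreover have "(max_window_mean N' J t hi e)\<^sup>2 \<le> ?E" using sK s by simp
      ultimately show ?thesis by (intro combine[OF _ _ g0 E0]) auto
    next
      case False
      have "Max (t ` J) \<in> t ` J" using J by (intro Max_in) auto
      then obtain i0 where i0: "i0 \<in> J" "t i0 = Max (t ` J)" by auto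
      have "\<Psi> s \<le> \<Psi> (t i0)"
      proof (cases "s \<le> t i0")
        case True
        then show ?thesis by (rule monoD[OF mono])
      next
        case False
        then show ?thesis using right[of s] i0(2) by simp
      qed
      moreover have "i0 \<in> window J t (t i0) hi" using i0(1) hi by (simp add: window_def)
      then have "1 \<le> card (window J t (t i0) hi)"
        using J(1) by (metis One_nat_def Suc_leI card_gt_0_iff empty_iff finite_window)
      ultimately have "\<Psi> s - \<psi> s \<le> L * (hi - s) + \<delta> + max_window_mean 1 J t hi e"
        using i0(1) hi s by (intro isotonic_lse_excess_le[OF J(1) lse, of i0] \<psi> y) auto
      from final[OF this near mw0] have "?lhs \<le> ?A + ?B + 3 * (max_window_mean 1 J t hi e)\<^sup>2" .
      moreover have "(max_window_mean 1 J t hi e)\<^sup>2 \<le> ?F" using False s by simp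
      ultimately show ?thesis by (intro combine[OF _ _ g0 E0]) auto
    qed
  qed
qed

lemma isotonic_lse_upper_integral_bound:
  fixes t y e :: "'i \<Rightarrow> real"
  assumes J: "finite J" "J \<noteq> {}" and lse: "is_arg_min (\<lambda>\<Phi>. \<Sum>i\<in>J. (y i - \<Phi> (t i))\<^sup>2) mono \<Psi>"
    and right: "\<And>u. u \<ge> Max (t ` J) \<Longrightarrow> \<Psi> u = \<Psi> (Max (t ` J))"
    and \<psi>: "mono \<psi>" "L-lipschitz_on UNIV \<psi>"
    and \<delta>: "0 \<le> \<delta>" and y: "\<And>i. i \<in> J \<Longrightarrow> y i \<le> \<psi> (t i) + \<delta> + e i"
    and hi: "\<And>i. i \<in> J \<Longrightarrow> t i \<le> hi" and lohi: "lo < hi" and K: "K \<ge> 1" and N: "N \<ge> 1" "N' \<ge> 1"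
    and filled: "well_filled lo hi K N N' J t"
  shows "(\<integral>\<^sup>+s. ennreal ((max 0 (\<Psi> s - \<psi> s))\<^sup>2) * indicator {lo..hi} s \<partial>lborel)
    \<le> ennreal (3 * (hi - lo) * ((2 * L * (hi - lo) / real K)\<^sup>2 + \<delta>\<^sup>2) + 3 * noise_bound lo hi K N N' J t e)"
proof -
  define c where "c = 3 * (2 * L * (hi - lo) / real K)\<^sup>2 + 3 * \<delta>\<^sup>2"
  define D where "D j = (max_window_mean N J t (knot lo hi K (Suc j)) e)\<^sup>2" for j
  define E where "E = (max_window_mean N' J t hi e)\<^sup>2"
  define F where "F = (max_window_mean 1 J t hi e)\<^sup>2"
  have nn: "0 \<le> c" "\<And>j. 0 \<le> D j" "0 \<le> E" "0 \<le> F" by (auto simp: c_def D_def E_def F_def)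
  have h: "(hi - lo) / real K > 0" using lohi K by simp
  have knot_diff: "knot lo hi K j - knot lo hi K (j - 1) = (hi - lo) / real K" if "j \<ge> 1" for j
    using that by (simp add: knot_def of_nat_diff left_diff_distrib diff_divide_distrib)
  have knot_le: "knot lo hi K (j - 1) \<le> knot lo hi K j" if "j \<ge> 1" for j
    using knot_diff[OF that] h by simp
  have last: "hi - knot lo hi K (K - 1) = (hi - lo) / real K" "knot lo hi K (K - 1) \<le> hi"
    using knot_diff[OF K] knot_le[OF K] K by (auto simp: knot_def)
  have endk: "hi - end_knot lo hi K = (hi - lo) / (real K)\<^sup>2" "end_knot lo hi K \<le> hi"
    using lohi by (auto simp: end_knot_def)
  let ?g = "\<lambda>s. ennreal c * indicator {lo..hi} s
      + (\<Sum>j\<in>{1..<K}. ennreal (3 * D j) * indicator {knot lo hi K (j - 1)..knot lo hi K j} s)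
      + ennreal (3 * E) * indicator {knot lo hi K (K - 1)..hi} s
      + ennreal (3 * F) * indicator {end_knot lo hi K..hi} s"
  have "(\<integral>\<^sup>+s. ennreal ((max 0 (\<Psi> s - \<psi> s))\<^sup>2) * indicator {lo..hi} s \<partial>lborel) \<le> (\<integral>\<^sup>+s. ?g s \<partial>lborel)"
  proof (rule nn_integral_mono)
    fix s
    show "ennreal ((max 0 (\<Psi> s - \<psi> s))\<^sup>2) * indicator {lo..hi} s \<le> ?g s"
    proof (cases "s \<in> {lo..hi}")
      case True
      have "(max 0 (\<Psi> s - \<psi> s))\<^sup>2 \<le> c + (\<Sum>j\<in>{1..<K}. 3 * D j * indicator {knot lo hi K (j - 1)..knot lo hi K j} s)
          + 3 * E * indicator {knot lo hi K (K - 1)..hi} s + 3 * F * indicator {end_knot lo hi K..hi} s"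
      proof -
        let ?S = "\<Sum>j\<in>{1..<K}. indicator {knot lo hi K (j - 1)..knot lo hi K j} s * D j"
        have "lo \<le> s" "s \<le> hi" using True by auto
        from isotonic_lse_pointwise_bound[OF J lse right \<psi> \<delta> y hi lohi K N filled this]
        have "(max 0 (\<Psi> s - \<psi> s))\<^sup>2 \<le> c + 3 * (?S + indicator {knot lo hi K (K - 1)..hi} s * E
            + indicator {end_knot lo hi K..hi} s * F)"
          unfolding c_def D_def E_def F_def .
        moreover have "(\<Sum>j\<in>{1..<K}. 3 * D j * indicator {knot lo hi K (j - 1)..knot lo hi K j} s) = 3 * ?S"
          unfolding sum_distrib_left by (intro sum.cong) auto
        ultimately show ?thesis by (simp only: distrib_left mult_ac add_ac)
      qed
      then have "ennreal ((max 0 (\<Psi> s - \<psi> s))\<^sup>2) \<le> ennreal \<dots>" by (rule ennreal_leI)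
      also have "\<dots> = ?g s"
        using True nn
        by (simp add: ennreal_plus sum_nonneg ennreal_mult ennreal_indicator flip: sum_ennreal)
      finally show ?thesis using True by simp
    qed simp
  qed
  also have "\<dots> = ennreal c * ennreal (hi - lo)
      + (\<Sum>j\<in>{1..<K}. ennreal (3 * D j) * ennreal ((hi - lo) / real K))
      + ennreal (3 * E) * ennreal ((hi - lo) / real K) + ennreal (3 * F) * ennreal ((hi - lo) / (real K)\<^sup>2)"
  proof -
    have Icc: "(\<integral>\<^sup>+s. ennreal x * indicator {a..b} s \<partial>lborel) = ennreal x * ennreal d"
      if "b - a = d" "a \<le> b" for x a b d :: real
      using that by (subst nn_integral_cmult_indicator) auto
    have "(\<integral>\<^sup>+s. (\<Sum>j\<in>{1..<K}. ennreal (3 * D j) * indicator {knot lo hi K (j - 1)..knot lo hi K j} s) \<partial>lborel)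
        = (\<Sum>j\<in>{1..<K}. ennreal (3 * D j) * ennreal ((hi - lo) / real K))"
    proof -
      have "(\<integral>\<^sup>+s. (\<Sum>j\<in>{1..<K}. ennreal (3 * D j) * indicator {knot lo hi K (j - 1)..knot lo hi K j} s) \<partial>lborel)
          = (\<Sum>j\<in>{1..<K}. \<integral>\<^sup>+s. ennreal (3 * D j) * indicator {knot lo hi K (j - 1)..knot lo hi K j} s \<partial>lborel)"
        by (rule nn_integral_sum) measurable
      also have "\<dots> = (\<Sum>j\<in>{1..<K}. ennreal (3 * D j) * ennreal ((hi - lo) / real K))"
        by (intro sum.cong refl Icc knot_diff knot_le) auto
      finally show ?thesis .
    qed
    note I2 = this
    have add4: "(\<integral>\<^sup>+s. f1 s + f2 s + f3 s + f4 s \<partial>lborel)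
        = (\<integral>\<^sup>+s. f1 s \<partial>lborel) + (\<integral>\<^sup>+s. f2 s \<partial>lborel) + (\<integral>\<^sup>+s. f3 s \<partial>lborel) + (\<integral>\<^sup>+s. f4 s \<partial>lborel)"
      if "f1 \<in> borel_measurable borel" "f2 \<in> borel_measurable borel" "f3 \<in> borel_measurable borel"
        "f4 \<in> borel_measurable borel" for f1 f2 f3 f4 :: "real \<Rightarrow> ennreal"
      using that by (simp add: nn_integral_add)
    show ?thesis
      unfolding Icc[OF refl less_imp_le[OF lohi], of c, symmetric] Icc[OF last, of "3 * E", symmetric]
        Icc[OF endk, of "3 * F", symmetric] I2[symmetric]
      by (rule add4) measurable
  qed
  also have "\<dots> = ennreal (c * (hi - lo) + (\<Sum>j\<in>{1..<K}. 3 * D j * ((hi - lo) / real K))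
      + 3 * E * ((hi - lo) / real K) + 3 * F * ((hi - lo) / (real K)\<^sup>2))"
  proof -
    have sum: "(\<Sum>j\<in>{1..<K}. ennreal (3 * D j) * ennreal ((hi - lo) / real K))
        = ennreal (\<Sum>j\<in>{1..<K}. 3 * D j * ((hi - lo) / real K))"
    proof -
      have "(\<Sum>j\<in>{1..<K}. ennreal (3 * D j) * ennreal ((hi - lo) / real K))
          = (\<Sum>j\<in>{1..<K}. ennreal (3 * D j * ((hi - lo) / real K)))"
        using nn less_imp_le[OF h] by (intro sum.cong refl ennreal_mult[symmetric]) auto
      also have "\<dots> = ennreal (\<Sum>j\<in>{1..<K}. 3 * D j * ((hi - lo) / real K))"
        using nn(2) less_imp_le[OF h] by (intro sum_ennreal mult_nonneg_nonneg) auto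
      finally show ?thesis .
    qed
    have sum0: "0 \<le> (\<Sum>j\<in>{1..<K}. 3 * D j * ((hi - lo) / real K))"
      using nn h by (intro sum_nonneg mult_nonneg_nonneg) auto
    have "ennreal a * ennreal a' + ennreal b + ennreal d * ennreal d' + ennreal f * ennreal f'
        = ennreal (a * a' + b + d * d' + f * f')"
      if "0 \<le> a" "0 \<le> a'" "0 \<le> b" "0 \<le> d" "0 \<le> d'" "0 \<le> f" "0 \<le> f'" for a a' b d d' f f' :: real
      using that by (simp add: ennreal_plus ennreal_mult)
    from this[OF nn(1) _ sum0 _ less_imp_le[OF h]] show ?thesis
      unfolding sum using nn lohi by simp
  qed
  also have "c * (hi - lo) + (\<Sum>j\<in>{1..<K}. 3 * D j * ((hi - lo) / real K))
      + 3 * E * ((hi - lo) / real K) + 3 * F * ((hi - lo) / (real K)\<^sup>2)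
      = 3 * (hi - lo) * ((2 * L * (hi - lo) / real K)\<^sup>2 + \<delta>\<^sup>2) + 3 * noise_bound lo hi K N N' J t e"
  proof -
    define r where "r = (hi - lo) / real K"
    have "(\<Sum>j\<in>{1..<K}. 3 * D j * r) = 3 * (\<Sum>j\<in>{1..<K}. r * D j)"
      unfolding sum_distrib_left by (intro sum.cong) auto
    moreover have "noise_bound lo hi K N N' J t e = (\<Sum>j\<in>{1..<K}. r * D j) + r * E + (hi - lo) / (real K)\<^sup>2 * F"
      unfolding noise_bound_def D_def E_def F_def r_def ..
    moreover have "c * (hi - lo) = 3 * (hi - lo) * ((2 * L * (hi - lo) / real K)\<^sup>2 + \<delta>\<^sup>2)"
      unfolding c_def by (simp only: distrib_left distrib_right mult_ac)
    ultimately show ?thesis unfolding r_def[symmetric] by (simp only: distrib_left mult_ac add_ac)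
  qed
  finally show ?thesis .
qed

text \<open>
  Reflecting design, observations and fit preserves the least squares problem, so every upper bound for
  the fit has a lower counterpart.
\<close>

lemma is_arg_min_mono_reflect:
  assumes lse: "is_arg_min (\<lambda>\<Phi>. \<Sum>i\<in>J. (y i - \<Phi> (t i :: real))\<^sup>2) mono (\<Psi> :: real \<Rightarrow> real)"
  shows "is_arg_min (\<lambda>\<Phi>. \<Sum>i\<in>J. (- y i - \<Phi> (- t i))\<^sup>2) mono (\<lambda>s. - \<Psi> (- s))"
proof -
  have refl: "mono (\<lambda>s. - \<Phi> (- s))" if "mono \<Phi>" for \<Phi> :: "real \<Rightarrow> real"
    using that by (auto simp: mono_def)
  have opt: "mono \<Psi>" "\<And>\<Phi>. mono \<Phi> \<Longrightarrow> (\<Sum>i\<in>J. (y i - \<Psi> (t i))\<^sup>2) \<le> (\<Sum>i\<in>J. (y i - \<Phi> (t i))\<^sup>2)"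
    using lse by (auto simp: is_arg_min_def not_less)
  have le: "(\<Sum>i\<in>J. (- y i - (- \<Psi> (- (- t i))))\<^sup>2) \<le> (\<Sum>i\<in>J. (- y i - \<Phi> (- t i))\<^sup>2)"
    if "mono \<Phi>" for \<Phi>
  proof -
    have "(\<Sum>i\<in>J. (- y i - (- \<Psi> (- (- t i))))\<^sup>2) = (\<Sum>i\<in>J. (y i - \<Psi> (t i))\<^sup>2)"
      by (intro sum.cong) (auto simp: power2_eq_square algebra_simps)
    also have "\<dots> \<le> (\<Sum>i\<in>J. (y i - (\<lambda>s. - \<Phi> (- s)) (t i))\<^sup>2)"
      by (rule opt(2)[OF refl[OF that]])
    also have "\<dots> = (\<Sum>i\<in>J. (- y i - \<Phi> (- t i))\<^sup>2)"
      by (intro sum.cong) (auto simp: power2_eq_square algebra_simps)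
    finally show ?thesis .
  qed
  show ?thesis
    unfolding is_arg_min_def using le refl[OF opt(1)] by (auto simp: not_less)
qed

lemma isotonic_lse_integral_bound:
  fixes t y e :: "nat \<Rightarrow> real"
  assumes J: "finite J" "J \<noteq> {}" and lse: "monotone_lse J t y \<Psi>"
    and \<psi>: "mono \<psi>" "L-lipschitz_on UNIV \<psi>"
    and \<delta>: "0 \<le> \<delta>" and y: "\<And>i. i \<in> J \<Longrightarrow> \<bar>y i - \<psi> (t i) - e i\<bar> \<le> \<delta>"
    and t: "\<And>i. i \<in> J \<Longrightarrow> lo \<le> t i \<and> t i \<le> hi" and lohi: "lo < hi" and K: "K \<ge> 1" and N: "N \<ge> 1" "N' \<ge> 1"
    and filled: "well_filled lo hi K N N' J t" "well_filled (- hi) (- lo) K N N' J (\<lambda>i. - t i)"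
  shows "(\<integral>\<^sup>+s. ennreal ((\<Psi> s - \<psi> s)\<^sup>2) * indicator {lo..hi} s \<partial>lborel)
    \<le> ennreal (6 * (hi - lo) * ((2 * L * (hi - lo) / real K)\<^sup>2 + \<delta>\<^sup>2)
        + 3 * noise_bound lo hi K N N' J t e + 3 * noise_bound (- hi) (- lo) K N N' J (\<lambda>i. - t i) e)"
proof -
  have arg: "is_arg_min (\<lambda>\<Phi>. \<Sum>i\<in>J. (y i - \<Phi> (t i))\<^sup>2) mono \<Psi>"
    and left: "\<And>u. u \<le> Min (t ` J) \<Longrightarrow> \<Psi> u = \<Psi> (Min (t ` J))"
    and right: "\<And>u. u \<ge> Max (t ` J) \<Longrightarrow> \<Psi> u = \<Psi> (Max (t ` J))"
    using lse unfolding monotone_lse_def by blast+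
  have mono: "mono \<Psi>" using arg by (simp add: is_arg_min_def)
  note [measurable] = borel_measurable_mono[OF mono] borel_measurable_mono[OF \<psi>(1)]
  define A where "A = 3 * (hi - lo) * ((2 * L * (hi - lo) / real K)\<^sup>2 + \<delta>\<^sup>2)"
  have A0: "0 \<le> A" using lohi by (simp add: A_def)
  have nb0: "0 \<le> noise_bound lo' hi' K N N' J t' e" if "lo' \<le> hi'" for lo' hi' t'
    using that unfolding noise_bound_def by (auto intro!: add_nonneg_nonneg sum_nonneg mult_nonneg_nonneg)
  have up: "(\<integral>\<^sup>+s. ennreal ((max 0 (\<Psi> s - \<psi> s))\<^sup>2) * indicator {lo..hi} s \<partial>lborel)
      \<le> ennreal (A + 3 * noise_bound lo hi K N N' J t e)"
    unfolding A_def
  proof (rule isotonic_lse_upper_integral_bound[OF J arg right \<psi> \<delta> _ _ lohi K N filled(1)])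
    show "y i \<le> \<psi> (t i) + \<delta> + e i" "t i \<le> hi" if "i \<in> J" for i
      using y[OF that] t[OF that] by (auto simp: abs_le_iff)
  qed
  have Max_minus: "Max ((\<lambda>i. - t i) ` J) = - Min (t ` J)"
    using J minus_Min_eq_Max[of "t ` J"] by (simp add: image_image)
  have "(\<integral>\<^sup>+s. ennreal ((max 0 ((- \<Psi> (- s)) - (- \<psi> (- s))))\<^sup>2) * indicator {- hi..- lo} s \<partial>lborel)
      \<le> ennreal (3 * (- lo - - hi) * ((2 * L * (- lo - - hi) / real K)\<^sup>2 + \<delta>\<^sup>2)
          + 3 * noise_bound (- hi) (- lo) K N N' J (\<lambda>i. - t i) (\<lambda>i. - e i))"
  proof (rule isotonic_lse_upper_integral_bound[where y="\<lambda>i. - y i", OF J is_arg_min_mono_reflect[OF arg]])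
    show "- \<Psi> (- u) = - \<Psi> (- Max ((\<lambda>i. - t i) ` J))" if "Max ((\<lambda>i. - t i) ` J) \<le> u" for u
      using left[of "- u"] that unfolding Max_minus by simp
    show "mono (\<lambda>s. - \<psi> (- s))" using \<psi>(1) by (auto simp: mono_def)
    show "L-lipschitz_on UNIV (\<lambda>s. - \<psi> (- s))"
    proof (rule lipschitz_onI)
      show "dist (- \<psi> (- u)) (- \<psi> (- w)) \<le> L * dist u w" for u w
        using lipschitz_onD[OF \<psi>(2), of "- u" "- w"] by (simp add: dist_real_def abs_minus_commute)
    qed (rule lipschitz_on_nonneg[OF \<psi>(2)])
    show "- y i \<le> - \<psi> (- (- t i)) + \<delta> + - e i" "- t i \<le> - lo" if "i \<in> J" for i
      using y[OF that] t[OF that] by (auto simp: abs_le_iff)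
  qed (use lohi K N filled \<delta> in auto)
  moreover have "(\<integral>\<^sup>+s. ennreal ((max 0 ((- \<Psi> (- s)) - (- \<psi> (- s))))\<^sup>2) * indicator {- hi..- lo} s \<partial>lborel)
      = (\<integral>\<^sup>+s. ennreal ((max 0 (\<psi> s - \<Psi> s))\<^sup>2) * indicator {lo..hi} s \<partial>lborel)"
    by (subst nn_integral_real_affine[where c="-1" and t=0, of "\<lambda>s. ennreal ((max 0 (\<psi> s - \<Psi> s))\<^sup>2) * indicator {lo..hi} s"])
      (auto intro!: nn_integral_cong simp: indicator_def)
  ultimately have down: "(\<integral>\<^sup>+s. ennreal ((max 0 (\<psi> s - \<Psi> s))\<^sup>2) * indicator {lo..hi} s \<partial>lborel)
      \<le> ennreal (A + 3 * noise_bound (- hi) (- lo) K N N' J (\<lambda>i. - t i) e)"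
    by (simp add: A_def noise_bound_minus)
  have "(\<integral>\<^sup>+s. ennreal ((\<Psi> s - \<psi> s)\<^sup>2) * indicator {lo..hi} s \<partial>lborel)
      = (\<integral>\<^sup>+s. ennreal ((max 0 (\<Psi> s - \<psi> s))\<^sup>2) * indicator {lo..hi} s
          + ennreal ((max 0 (\<psi> s - \<Psi> s))\<^sup>2) * indicator {lo..hi} s \<partial>lborel)"
  proof (rule nn_integral_cong)
    fix s
    have "(\<Psi> s - \<psi> s)\<^sup>2 = (max 0 (\<Psi> s - \<psi> s))\<^sup>2 + (max 0 (\<psi> s - \<Psi> s))\<^sup>2"
      by (cases "\<psi> s \<le> \<Psi> s") (auto simp: power2_commute)
    then show "ennreal ((\<Psi> s - \<psi> s)\<^sup>2) * indicator {lo..hi} s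
        = ennreal ((max 0 (\<Psi> s - \<psi> s))\<^sup>2) * indicator {lo..hi} s
          + ennreal ((max 0 (\<psi> s - \<Psi> s))\<^sup>2) * indicator {lo..hi} s"
      by (simp add: ennreal_plus distrib_right)
  qed
  also have "\<dots> = (\<integral>\<^sup>+s. ennreal ((max 0 (\<Psi> s - \<psi> s))\<^sup>2) * indicator {lo..hi} s \<partial>lborel)
      + (\<integral>\<^sup>+s. ennreal ((max 0 (\<psi> s - \<Psi> s))\<^sup>2) * indicator {lo..hi} s \<partial>lborel)"
    by (rule nn_integral_add) measurable
  also have "\<dots> \<le> ennreal (A + 3 * noise_bound lo hi K N N' J t e)
      + ennreal (A + 3 * noise_bound (- hi) (- lo) K N N' J (\<lambda>i. - t i) e)"
    by (rule add_mono[OF up down])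
  also have "\<dots> = ennreal (6 * (hi - lo) * ((2 * L * (hi - lo) / real K)\<^sup>2 + \<delta>\<^sup>2)
        + 3 * noise_bound lo hi K N N' J t e + 3 * noise_bound (- hi) (- lo) K N N' J (\<lambda>i. - t i) e)"
  proof (subst ennreal_plus[symmetric])
    show "0 \<le> A + 3 * noise_bound lo hi K N N' J t e"
      "0 \<le> A + 3 * noise_bound (- hi) (- lo) K N N' J (\<lambda>i. - t i) e"
      using A0 nb0[of lo hi t] nb0[of "- hi" "- lo" "\<lambda>i. - t i"] lohi by auto
  qed (rule arg_cong[where f=ennreal], simp add: A_def algebra_simps)
  finally show ?thesis .
qed

section \<open>Expected noise and expected number of badly filled cells\<close>

text \<open>
  A count rather than a predicate, so that its expectation is a sum of probabilities;
  \<open>well_filled\<close> says that it vanishes.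
\<close>

definition underfilled :: "real \<Rightarrow> real \<Rightarrow> nat \<Rightarrow> nat \<Rightarrow> nat \<Rightarrow> 'i set \<Rightarrow> ('i \<Rightarrow> real) \<Rightarrow> real" where
  "underfilled lo hi K N N' J t =
     (\<Sum>j\<in>{1..<K}. if card (window J t (knot lo hi K j) (knot lo hi K (Suc j))) < N then 1 else 0)
     + (if card (window J t (end_knot lo hi K) hi) < N' then 1 else 0)"

lemma well_filledI:
  assumes "underfilled lo hi K N N' J t < 1"
  shows "well_filled lo hi K N N' J t"
proof -
  let ?g = "\<lambda>j. (if card (window J t (knot lo hi K j) (knot lo hi K (Suc j))) < N then 1 else 0) :: real"
  have "0 \<le> sum ?g {1..<K}" by (intro sum_nonneg) auto
  then have "N' \<le> card (window J t (end_knot lo hi K) hi)" and sum: "sum ?g {1..<K} < 1"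
    using assms unfolding underfilled_def by (auto split: if_splits)
  moreover have "N \<le> card (window J t (knot lo hi K j) (knot lo hi K (Suc j)))" if "j \<in> {1..<K}" for j
  proof -
    have "?g j \<le> sum ?g {1..<K}" using that by (intro member_le_sum[of j "{1..<K}" ?g]) auto
    then show ?thesis using sum by (auto split: if_splits)
  qed
  ultimately show ?thesis by (simp add: well_filled_def)
qed

lemma borel_measurable_card_window:
  fixes t :: "'w \<Rightarrow> 'i \<Rightarrow> real"
  assumes J: "finite J" and t: "\<And>j. j \<in> J \<Longrightarrow> (\<lambda>w. t w j) \<in> borel_measurable M"
    and ab: "a \<in> borel_measurable M" "b \<in> borel_measurable M"
  shows "(\<lambda>w. real (card (window J (t w) (a w) (b w)))) \<in> borel_measurable M"
proof -
  have eq: "real (card (window J (t w) (a w) (b w))) = (\<Sum>i\<in>J. if a w \<le> t w i \<and> t w i \<le> b w then 1 else 0)" for w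
    using J by (simp add: window_def sum.If_cases Int_def)
  have [measurable]: "Measurable.pred M (\<lambda>w. a w \<le> t w i \<and> t w i \<le> b w)" if "i \<in> J" for i
    using t[OF that] ab by measurable
  show ?thesis unfolding eq by measurable
qed

lemma borel_measurable_max_window_mean:
  fixes t e :: "'w \<Rightarrow> 'i \<Rightarrow> real"
  assumes J: "finite J" and t: "\<And>j. j \<in> J \<Longrightarrow> (\<lambda>w. t w j) \<in> borel_measurable M"
    and e: "\<And>j. j \<in> J \<Longrightarrow> (\<lambda>w. e w j) \<in> borel_measurable M" and b: "b \<in> borel_measurable M"
  shows "(\<lambda>w. max_window_mean N J (t w) (b w) (e w)) \<in> borel_measurable M"
  unfolding max_window_mean_def
proof (rule borel_measurable_Max_insert_0[OF J])
  fix k assume k: "k \<in> J"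
  have "(\<Sum>i\<in>window J (t w) (t w k) (b w). e w i) = (\<Sum>i\<in>J. if t w k \<le> t w i \<and> t w i \<le> b w then e w i else 0)" for w
    using J by (simp add: window_def sum.If_cases Int_def)
  moreover have "(\<lambda>w. \<Sum>i\<in>J. if t w k \<le> t w i \<and> t w i \<le> b w then e w i else 0) \<in> borel_measurable M"
  proof (rule borel_measurable_sum)
    fix i assume i: "i \<in> J"
    have [measurable]: "Measurable.pred M (\<lambda>w. t w k \<le> t w i \<and> t w i \<le> b w)"
      using t[OF k] t[OF i] b by measurable
    note e[OF i, measurable]
    show "(\<lambda>w. if t w k \<le> t w i \<and> t w i \<le> b w then e w i else 0) \<in> borel_measurable M" by measurable
  qed
  ultimately have [measurable]: "(\<lambda>w. \<Sum>i\<in>window J (t w) (t w k) (b w). e w i) \<in> borel_measurable M" by simp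
  have [measurable]: "(\<lambda>w. real (card (window J (t w) (t w k) (b w)))) \<in> borel_measurable M"
    by (rule borel_measurable_card_window[OF J t t[OF k] b])
  show "(\<lambda>w. \<bar>\<Sum>i\<in>window J (t w) (t w k) (b w). e w i\<bar>
      / real (max N (card (window J (t w) (t w k) (b w))))) \<in> borel_measurable M"
    unfolding of_nat_max by measurable
qed

lemma borel_measurable_noise_bound:
  fixes t e :: "'w \<Rightarrow> 'i \<Rightarrow> real"
  assumes J: "finite J" and t: "\<And>j. j \<in> J \<Longrightarrow> (\<lambda>w. t w j) \<in> borel_measurable M"
    and e: "\<And>j. j \<in> J \<Longrightarrow> (\<lambda>w. e w j) \<in> borel_measurable M"
    and [measurable]: "lo \<in> borel_measurable M" "hi \<in> borel_measurable M"
  shows "(\<lambda>w. noise_bound (lo w) (hi w) K N N' J (t w) (e w)) \<in> borel_measurable M"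
proof -
  have [measurable]: "(\<lambda>w. max_window_mean n J (t w) (b w) (e w)) \<in> borel_measurable M"
    if [measurable]: "b \<in> borel_measurable M" for b n
    by (rule borel_measurable_max_window_mean[OF J t e that])
  have [measurable]: "(\<lambda>w. max_window_mean n J (t w) (knot (lo w) (hi w) K j) (e w)) \<in> borel_measurable M" for n j
    by (rule borel_measurable_max_window_mean[OF J t e]) (auto simp: knot_def)
  show ?thesis unfolding noise_bound_def by measurable
qed

lemma borel_measurable_underfilled:
  fixes t :: "'w \<Rightarrow> 'i \<Rightarrow> real"
  assumes J: "finite J" and t: "\<And>j. j \<in> J \<Longrightarrow> (\<lambda>w. t w j) \<in> borel_measurable M"
    and [measurable]: "lo \<in> borel_measurable M" "hi \<in> borel_measurable M"
  shows "(\<lambda>w. underfilled (lo w) (hi w) K N N' J (t w)) \<in> borel_measurable M"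
proof -
  have 1: "(\<lambda>w. real (card (window J (t w) (knot (lo w) (hi w) K j) (knot (lo w) (hi w) K (Suc j))))) \<in> borel_measurable M" for j
    by (rule borel_measurable_card_window[OF J t]) (auto simp: knot_def)
  have 2: "(\<lambda>w. real (card (window J (t w) (end_knot (lo w) (hi w) K) (hi w)))) \<in> borel_measurable M"
    by (rule borel_measurable_card_window[OF J t]) (auto simp: end_knot_def)
  have lt: "c < n \<longleftrightarrow> real c < real n" for c n by simp
  note 1 [measurable] 2 [measurable]
  show ?thesis unfolding underfilled_def lt by measurable
qed

text \<open>
  The \<open>K - 1\<close> regular cells have total length at most \<open>hi - lo\<close> and contribute the term \<open>1 / N\<close>.
\<close>

lemma (in centred_noise) expected_noise_bound:
  fixes \<tau> :: "'x \<Rightarrow> real" and J :: "'i set"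
  assumes J: "finite J" and \<tau> [measurable]: "\<tau> \<in> borel_measurable D"
    and lohi: "lo \<le> hi" and K: "K \<ge> 1" and N: "N \<ge> 1" "N' \<ge> 1"
  shows "(\<integral>\<^sup>+z. ennreal (noise_bound lo hi K N N' J (\<lambda>j. \<tau> (X (z j))) (\<lambda>j. e (z j))) \<partial>sample J)
    \<le> ennreal (32 * v * (hi - lo) * (1 / real N + 1 / (real K * real N') + 1 / (real K)\<^sup>2))"
proof -
  define W where "W n b z = (max_window_mean n J (\<lambda>j. \<tau> (X (z j))) b (\<lambda>j. e (z j)))\<^sup>2" for n b and z :: "'i \<Rightarrow> 'a"
  have [measurable]: "(\<lambda>z. \<tau> (X (z j))) \<in> borel_measurable (sample J)" "(\<lambda>z. e (z j)) \<in> borel_measurable (sample J)"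
    if "j \<in> J" for j using that by measurable
  have W_m [measurable]: "W n b \<in> borel_measurable (sample J)" for n b
    unfolding W_def by (intro borel_measurable_power borel_measurable_max_window_mean[OF J]) auto
  have W0: "0 \<le> W n b z" for n b z by (simp add: W_def)
  have EW: "(\<integral>\<^sup>+z. ennreal (W n b z) \<partial>sample J) \<le> ennreal (32 * v / real n)" if "n \<ge> 1" for n b
    unfolding W_def by (rule max_window_mean_second_moment[OF J that \<tau>])
  define h where "h = (hi - lo) / real K"
  have h: "0 \<le> h" using lohi by (simp add: h_def)
  define h2 where "h2 = (hi - lo) / (real K)\<^sup>2"
  have h2: "0 \<le> h2" using lohi by (simp add: h2_def)
  have cW: "(\<integral>\<^sup>+z. ennreal (c * W n b z) \<partial>sample J) \<le> ennreal (c * (32 * v / real n))" if "n \<ge> 1" "0 \<le> c" for n b c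
  proof -
    have "(\<integral>\<^sup>+z. ennreal (c * W n b z) \<partial>sample J) = ennreal c * (\<integral>\<^sup>+z. ennreal (W n b z) \<partial>sample J)"
      unfolding ennreal_mult'[OF that(2)] by (rule nn_integral_cmult) measurable
    also have "\<dots> \<le> ennreal c * ennreal (32 * v / real n)" by (intro mult_left_mono EW that) auto
    also have "\<dots> = ennreal (c * (32 * v / real n))" by (rule ennreal_mult'[OF that(2), symmetric])
    finally show ?thesis .
  qed
  have "(\<integral>\<^sup>+z. ennreal (noise_bound lo hi K N N' J (\<lambda>j. \<tau> (X (z j))) (\<lambda>j. e (z j))) \<partial>sample J)
      = (\<integral>\<^sup>+z. (\<Sum>j\<in>{1..<K}. ennreal (h * W N (knot lo hi K (Suc j)) z)) + ennreal (h * W N' hi z) + ennreal (h2 * W 1 hi z) \<partial>sample J)"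
  proof (rule nn_integral_cong)
    fix z :: "'i \<Rightarrow> 'a"
    have nn: "0 \<le> (\<Sum>j\<in>{1..<K}. h * W N (knot lo hi K (Suc j)) z)" "0 \<le> h * W N' hi z" "0 \<le> h2 * W 1 hi z"
      using h h2 W0 by (auto intro!: sum_nonneg mult_nonneg_nonneg)
    have "noise_bound lo hi K N N' J (\<lambda>j. \<tau> (X (z j))) (\<lambda>j. e (z j))
        = (\<Sum>j\<in>{1..<K}. h * W N (knot lo hi K (Suc j)) z) + h * W N' hi z + h2 * W 1 hi z"
      unfolding noise_bound_def W_def h_def h2_def ..
    moreover have "(\<Sum>j\<in>{1..<K}. ennreal (h * W N (knot lo hi K (Suc j)) z)) = ennreal (\<Sum>j\<in>{1..<K}. h * W N (knot lo hi K (Suc j)) z)"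
      using h W0 by (intro sum_ennreal mult_nonneg_nonneg)
    ultimately show "ennreal (noise_bound lo hi K N N' J (\<lambda>j. \<tau> (X (z j))) (\<lambda>j. e (z j)))
        = (\<Sum>j\<in>{1..<K}. ennreal (h * W N (knot lo hi K (Suc j)) z)) + ennreal (h * W N' hi z) + ennreal (h2 * W 1 hi z)"
      using nn by (simp only: ennreal_plus add_nonneg_nonneg)
  qed
  also have "\<dots> = (\<Sum>j\<in>{1..<K}. \<integral>\<^sup>+z. ennreal (h * W N (knot lo hi K (Suc j)) z) \<partial>sample J)
      + (\<integral>\<^sup>+z. ennreal (h * W N' hi z) \<partial>sample J) + (\<integral>\<^sup>+z. ennreal (h2 * W 1 hi z) \<partial>sample J)"
    by (simp add: nn_integral_add nn_integral_sum del: One_nat_def)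
  also have "\<dots> \<le> (\<Sum>j\<in>{1..<K}. ennreal (h * (32 * v / real N))) + ennreal (h * (32 * v / real N')) + ennreal (h2 * (32 * v / real 1))"
    by (intro add_mono sum_mono cW h h2 N) auto
  also have "(\<Sum>j\<in>{1..<K}. ennreal (h * (32 * v / real N))) = ennreal (real (K - 1) * (h * (32 * v / real N)))"
    using ennreal_mult'[of "real (K - 1)" "h * (32 * v / real N)"]
    by (simp add: ennreal_of_nat_eq_real_of_nat)
  also have "\<dots> \<le> ennreal ((hi - lo) * (32 * v / real N))"
  proof (rule ennreal_leI)
    have "real (K - 1) * h \<le> real K * h" using h by (intro mult_right_mono) auto
    also have "\<dots> = hi - lo" using K by (simp add: h_def)
    finally have "(real (K - 1) * h) * (32 * v / real N) \<le> (hi - lo) * (32 * v / real N)"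
      using v_nonneg by (intro mult_right_mono) auto
    then show "real (K - 1) * (h * (32 * v / real N)) \<le> (hi - lo) * (32 * v / real N)" by (simp only: mult.assoc)
  qed
  finally have "(\<integral>\<^sup>+z. ennreal (noise_bound lo hi K N N' J (\<lambda>j. \<tau> (X (z j))) (\<lambda>j. e (z j))) \<partial>sample J)
     \<le> ennreal ((hi - lo) * (32 * v / real N)) + ennreal (h * (32 * v / real N')) + ennreal (h2 * (32 * v / real 1))"
    by (auto intro: add_mono)
  also have "\<dots> = ennreal ((hi - lo) * (32 * v / real N) + h * (32 * v / real N') + h2 * (32 * v / real 1))"
    using lohi h h2 v_nonneg by (simp add: ennreal_plus)
  also have "(hi - lo) * (32 * v / real N) + h * (32 * v / real N') + h2 * (32 * v / real 1)
      = 32 * v * (hi - lo) * (1 / real N + 1 / (real K * real N') + 1 / (real K)\<^sup>2)"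
  proof -
    have "d * (32 * v / a) + d / k * (32 * v / b) + d / k\<^sup>2 * (32 * v / real 1)
        = 32 * v * d * (1 / a + 1 / (k * b) + 1 / k\<^sup>2)" for a b d k :: real
      by (simp add: algebra_simps)
    then show ?thesis unfolding h_def h2_def .
  qed
  finally show ?thesis .
qed

text \<open>
  A cell has probability at least \<open>\<rho> / K\<close> and the end piece at least \<open>\<rho> / K\<^sup>2\<close>; the thresholds \<open>N\<close> and
  \<open>N'\<close> are half of the resulting lower bounds for the expected numbers of points, rounded up.
\<close>

lemma expected_underfilled:
  fixes P :: "((real ^ 'd) \<times> real) measure" and J :: "'i set"
  assumes P: "prob_space P" "sets P = sets borel" and J: "finite J" "J \<noteq> {}"
    and low: "\<And>a b. lo \<le> a \<Longrightarrow> a \<le> b \<Longrightarrow> b \<le> hi \<Longrightarrow>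
       q_low * (b - a) \<le> measure P {z \<in> space P. \<alpha> \<bullet> fst z \<in> {a..b}}"
    and len: "1 / q_up \<le> hi - lo" and q: "0 < q_up" "0 < q_low" and K: "K \<ge> 1"
  defines "\<rho> \<equiv> q_low / q_up" and "m \<equiv> real (card J)"
  assumes N: "N = nat \<lceil>m * \<rho> / (2 * real K)\<rceil>" "N' = nat \<lceil>m * \<rho> / (2 * (real K)\<^sup>2)\<rceil>"
  shows "(\<integral>\<^sup>+z. ennreal (underfilled lo hi K N N' J (\<lambda>j. \<alpha> \<bullet> fst (z j))) \<partial>Pi\<^sub>M J (\<lambda>_. P))
    \<le> ennreal (8 * (real K)\<^sup>2 / (m * \<rho>))"
proof -
  interpret prob_space P by (rule P)
  note P(2) [measurable_cong]
  let ?S = "Pi\<^sub>M J (\<lambda>_. P)"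
  have m: "m > 0" using J by (simp add: m_def card_gt_0_iff)
  have \<rho>: "\<rho> > 0" using q by (simp add: \<rho>_def)
  have lohi: "lo < hi" using len q by (smt (verit) divide_pos_pos)
  have fst_m: "fst \<in> measurable P borel" by (rule measurable_fst_borel[OF P(2)])
  have proj_m [measurable]: "(\<lambda>z. \<alpha> \<bullet> fst z) \<in> borel_measurable P"
    by (rule measurable_compose[OF fst_m]) simp
  have t_m [measurable]: "(\<lambda>z. \<alpha> \<bullet> fst (z j)) \<in> borel_measurable ?S" if "j \<in> J" for j
    by (rule measurable_compose[OF measurable_component_singleton[OF that] proj_m])
  have cell: "emeasure ?S {z \<in> space ?S. card (window J (\<lambda>j. \<alpha> \<bullet> fst (z j)) a b) < n} \<le> ennreal (4 / (m * p0))"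
    if ab: "lo \<le> a" "a \<le> b" "b \<le> hi" and p0: "0 < p0" "p0 \<le> q_low * (b - a)" and n: "n = nat \<lceil>m * p0 / 2\<rceil>" for a b p0 n
  proof -
    let ?A = "{z \<in> space P. \<alpha> \<bullet> fst z \<in> {a..b}}"
    have "emeasure ?S {z \<in> space ?S. real (card {j \<in> J. z j \<in> ?A}) < real (card J) * p0 / 2}
        \<le> ennreal (4 / (real (card J) * p0))"
      using low[OF ab] p0 by (intro count_lower_deviation P J) auto
    moreover have "{z \<in> space ?S. real (card {j \<in> J. z j \<in> ?A}) < real (card J) * p0 / 2}
        = {z \<in> space ?S. card (window J (\<lambda>j. \<alpha> \<bullet> fst (z j)) a b) < n}"
    proof (rule Collect_cong, rule conj_cong[OF refl])
      fix z assume "z \<in> space ?S"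
      then have "{j \<in> J. z j \<in> ?A} = window J (\<lambda>j. \<alpha> \<bullet> fst (z j)) a b"
        by (auto simp: window_def space_PiM PiE_def Pi_def)
      moreover have "c < n \<longleftrightarrow> real c < m * p0 / 2" for c :: nat
        unfolding n by linarith
      ultimately show "real (card {j \<in> J. z j \<in> ?A}) < real (card J) * p0 / 2
          \<longleftrightarrow> card (window J (\<lambda>j. \<alpha> \<bullet> fst (z j)) a b) < n" by (simp add: m_def)
    qed
    ultimately show ?thesis by (simp add: m_def)
  qed
  have card_m [measurable]: "(\<lambda>z. real (card (window J (\<lambda>j. \<alpha> \<bullet> fst (z j)) a b))) \<in> borel_measurable ?S" for a b
    by (rule borel_measurable_card_window[OF J(1) t_m]) auto
  have pred_m [measurable]: "{z \<in> space ?S. card (window J (\<lambda>j. \<alpha> \<bullet> fst (z j)) a b) < n} \<in> sets ?S" for a b n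
  proof -
    have "{z \<in> space ?S. real (card (window J (\<lambda>j. \<alpha> \<bullet> fst (z j)) a b)) < real n} \<in> sets ?S" by measurable
    then show ?thesis by simp
  qed
  let ?B = "\<lambda>a b n. {z \<in> space ?S. card (window J (\<lambda>j. \<alpha> \<bullet> fst (z j)) a b) < n}"
  let ?k = "knot lo hi K"
  have rho_le: "\<rho> \<le> q_low * (hi - lo)" using mult_left_mono[OF len, of q_low] q by (simp add: \<rho>_def)
  have "(\<integral>\<^sup>+z. ennreal (underfilled lo hi K N N' J (\<lambda>j. \<alpha> \<bullet> fst (z j))) \<partial>?S)
      = (\<integral>\<^sup>+z. (\<Sum>j\<in>{1..<K}. indicator (?B (?k j) (?k (Suc j)) N) z) + indicator (?B (end_knot lo hi K) hi N') z \<partial>?S)"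
  proof (rule nn_integral_cong)
    fix z assume z: "z \<in> space ?S"
    let ?g = "\<lambda>j. (if card (window J (\<lambda>j. \<alpha> \<bullet> fst (z j)) (?k j) (?k (Suc j))) < N then 1 else 0) :: real"
    have "ennreal (underfilled lo hi K N N' J (\<lambda>j. \<alpha> \<bullet> fst (z j)))
        = ennreal (sum ?g {1..<K}) + ennreal (if card (window J (\<lambda>j. \<alpha> \<bullet> fst (z j)) (end_knot lo hi K) hi) < N' then 1 else 0)"
      unfolding underfilled_def by (rule ennreal_plus) (auto intro!: sum_nonneg)
    also have "ennreal (sum ?g {1..<K}) = (\<Sum>j\<in>{1..<K}. ennreal (?g j))"
      by (rule sum_ennreal[symmetric]) auto
    also have "\<dots> = (\<Sum>j\<in>{1..<K}. indicator (?B (?k j) (?k (Suc j)) N) z)"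
      using z by (intro sum.cong) auto
    also have "ennreal (if card (window J (\<lambda>j. \<alpha> \<bullet> fst (z j)) (end_knot lo hi K) hi) < N' then 1 else 0)
        = indicator (?B (end_knot lo hi K) hi N') z" using z by auto
    finally show "ennreal (underfilled lo hi K N N' J (\<lambda>j. \<alpha> \<bullet> fst (z j)))
        = (\<Sum>j\<in>{1..<K}. indicator (?B (?k j) (?k (Suc j)) N) z) + indicator (?B (end_knot lo hi K) hi N') z" .
  qed
  also have "\<dots> = (\<Sum>j\<in>{1..<K}. emeasure ?S (?B (?k j) (?k (Suc j)) N)) + emeasure ?S (?B (end_knot lo hi K) hi N')"
  proof -
    have "(\<integral>\<^sup>+z. (\<Sum>j\<in>{1..<K}. indicator (?B (?k j) (?k (Suc j)) N) z) + indicator (?B (end_knot lo hi K) hi N') z \<partial>?S)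
        = (\<integral>\<^sup>+z. (\<Sum>j\<in>{1..<K}. indicator (?B (?k j) (?k (Suc j)) N) z) \<partial>?S) + (\<integral>\<^sup>+z. indicator (?B (end_knot lo hi K) hi N') z \<partial>?S)"
      by (rule nn_integral_add) measurable
    also have "(\<integral>\<^sup>+z. (\<Sum>j\<in>{1..<K}. indicator (?B (?k j) (?k (Suc j)) N) z) \<partial>?S)
        = (\<Sum>j\<in>{1..<K}. \<integral>\<^sup>+z. indicator (?B (?k j) (?k (Suc j)) N) z \<partial>?S)"
      by (rule nn_integral_sum) measurable
    finally show ?thesis using pred_m by (simp only: nn_integral_indicator)
  qed
  also have "\<dots> \<le> (\<Sum>j\<in>{1..<K}. ennreal (4 / (m * (\<rho> / real K)))) + ennreal (4 / (m * (\<rho> / (real K)\<^sup>2)))"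
  proof (intro add_mono sum_mono cell)
    fix j assume j: "j \<in> {1..<K}"
    have h: "0 \<le> (hi - lo) / real K" using lohi by simp
    show "lo \<le> ?k j" unfolding knot_def using h by (simp del: times_divide_eq_right)
    show "?k j \<le> ?k (Suc j)" unfolding knot_def using mult_right_mono[OF _ h, of "real j" "real (Suc j)"] by simp
    have "real (Suc j) * ((hi - lo) / real K) \<le> real K * ((hi - lo) / real K)"
      using j h by (intro mult_right_mono) auto
    then show "?k (Suc j) \<le> hi" using K unfolding knot_def by simp
    have "?k (Suc j) - ?k j = (hi - lo) / real K" by (simp add: knot_def distrib_right del: times_divide_eq_right)
    then show "\<rho> / real K \<le> q_low * (?k (Suc j) - ?k j)"
      using divide_right_mono[OF rho_le, of "real K"] by simp
    show "N = nat \<lceil>m * (\<rho> / real K) / 2\<rceil>" unfolding N by (simp add: field_simps)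
  next
    have "1 \<le> (real K)\<^sup>2" using K by (simp add: one_le_power)
    then have "(hi - lo) / (real K)\<^sup>2 \<le> hi - lo"
      using lohi divide_left_mono[of 1 "(real K)\<^sup>2" "hi - lo"] K by simp
    then show "lo \<le> end_knot lo hi K" "end_knot lo hi K \<le> hi" using lohi by (auto simp: end_knot_def)
    show "\<rho> / (real K)\<^sup>2 \<le> q_low * (hi - end_knot lo hi K)"
      using divide_right_mono[OF rho_le, of "(real K)\<^sup>2"] by (simp add: end_knot_def)
    show "N' = nat \<lceil>m * (\<rho> / (real K)\<^sup>2) / 2\<rceil>" unfolding N by (simp add: field_simps)
  qed (use \<rho> K in auto)
  also have "\<dots> = ennreal (real (K - 1) * (4 / (m * (\<rho> / real K))) + 4 / (m * (\<rho> / (real K)\<^sup>2)))"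
  proof -
    have "(\<Sum>j\<in>{1..<K}. ennreal (4 / (m * (\<rho> / real K)))) = ennreal (real (K - 1) * (4 / (m * (\<rho> / real K))))"
      using ennreal_mult'[of "real (K - 1)" "4 / (m * (\<rho> / real K))"]
      by (simp add: ennreal_of_nat_eq_real_of_nat)
    then show ?thesis using m \<rho> by (simp only: ennreal_plus zero_le_mult_iff zero_le_divide_iff)
        (auto intro!: ennreal_plus[symmetric])
  qed
  also have "\<dots> \<le> ennreal (8 * (real K)\<^sup>2 / (m * \<rho>))"
  proof (rule ennreal_leI)
    have "real (K - 1) * (4 / (m * (\<rho> / real K))) \<le> real K * (4 / (m * (\<rho> / real K)))"
      using m \<rho> by (intro mult_right_mono) auto
    also have "\<dots> = 4 * (real K)\<^sup>2 / (m * \<rho>)" using m \<rho> K by (simp add: power2_eq_square field_simps)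
    finally show "real (K - 1) * (4 / (m * (\<rho> / real K))) + 4 / (m * (\<rho> / (real K)\<^sup>2)) \<le> 8 * (real K)\<^sup>2 / (m * \<rho>)"
      using m \<rho> K by (simp add: field_simps)
  qed
  finally show ?thesis .
qed

section \<open>Random splitting\<close>

lemma finite_first_index_sets: "finite (first_index_sets p n)"
  unfolding first_index_sets_def by (rule finite_subset[of _ "Pow {1..n}"]) auto

lemma iid_sample_distr:
  assumes M: "prob_space M" and P: "prob_space P" "sets P = sets borel"
    and iid: "iid_sample M P X Y" and n: "n \<ge> 1"
  shows "(\<lambda>\<omega>. \<lambda>i\<in>{1..n}. (X i \<omega>, Y i \<omega>)) \<in> measurable M (Pi\<^sub>M {1..n} (\<lambda>_. borel))"
    "distr M (Pi\<^sub>M {1..n} (\<lambda>_. borel)) (\<lambda>\<omega>. \<lambda>i\<in>{1..n}. (X i \<omega>, Y i \<omega>)) = Pi\<^sub>M {1..n} (\<lambda>_. P)"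
proof -
  interpret prob_space M by (rule M)
  have ind: "indep_vars (\<lambda>_. borel) (\<lambda>i \<omega>. (X i \<omega>, Y i \<omega>)) {1..n}"
    using iid unfolding iid_sample_def by (auto intro: indep_vars_subset)
  have rv: "random_variable borel (\<lambda>\<omega>. (X i \<omega>, Y i \<omega>))" if "i \<in> {1..n}" for i
    using ind that by (auto simp: indep_vars_def)
  show "(\<lambda>\<omega>. \<lambda>i\<in>{1..n}. (X i \<omega>, Y i \<omega>)) \<in> measurable M (Pi\<^sub>M {1..n} (\<lambda>_. borel))"
    using rv by (rule measurable_restrict)
  have "distr M (Pi\<^sub>M {1..n} (\<lambda>_. borel)) (\<lambda>\<omega>. \<lambda>i\<in>{1..n}. (X i \<omega>, Y i \<omega>))
      = Pi\<^sub>M {1..n} (\<lambda>i. distr M borel (\<lambda>\<omega>. (X i \<omega>, Y i \<omega>)))"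
    using ind n rv by (subst indep_vars_iff_distr_eq_PiM'[symmetric]) auto
  also have "\<dots> = Pi\<^sub>M {1..n} (\<lambda>_. P)"
    using iid by (intro PiM_cong) (auto simp: iid_sample_def)
  finally show "distr M (Pi\<^sub>M {1..n} (\<lambda>_. borel)) (\<lambda>\<omega>. \<lambda>i\<in>{1..n}. (X i \<omega>, Y i \<omega>)) = Pi\<^sub>M {1..n} (\<lambda>_. P)" .
qed

text \<open>
  The split is independent of the sample, and for a given split the two sub-samples are independent.
  So the second sub-sample may be integrated out first, with the index estimate held fixed: a bound that
  is uniform in the split and in the index passes to the random split and the estimated index.
\<close>

lemma nn_integral_split_sample_le:
  fixes P :: "((real ^ 'd) \<times> real) measure" and I1 :: "nat \<Rightarrow> 'w \<Rightarrow> nat set"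
    and T :: "nat set \<Rightarrow> (nat \<Rightarrow> (real ^ 'd) \<times> real) \<Rightarrow> real ^ 'd"
    and F :: "nat set \<Rightarrow> real ^ 'd \<Rightarrow> (nat \<Rightarrow> (real ^ 'd) \<times> real) \<Rightarrow> ennreal"
  assumes M: "prob_space M" and P: "prob_space P" "sets P = sets borel"
    and iid: "iid_sample M P X Y" and split: "random_split M p X Y I1" and n: "n \<ge> 1"
    and T: "\<And>J. J \<in> first_index_sets p n \<Longrightarrow> T J \<in> measurable (Pi\<^sub>M J (\<lambda>_. borel)) borel"
    and est: "\<And>\<omega>. \<omega> \<in> space M \<Longrightarrow> \<alpha>' \<omega> = T (I1 n \<omega>) (\<lambda>i\<in>I1 n \<omega>. (X i \<omega>, Y i \<omega>))"
    and F: "\<And>J. J \<in> first_index_sets p n \<Longrightarrow>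
      (\<lambda>(\<alpha>, z). F J \<alpha> z) \<in> borel_measurable (borel \<Otimes>\<^sub>M Pi\<^sub>M ({1..n} - J) (\<lambda>_. borel))"
    and bound: "\<And>J \<alpha>. J \<in> first_index_sets p n \<Longrightarrow>
      (\<integral>\<^sup>+z. F J \<alpha> z \<partial>Pi\<^sub>M ({1..n} - J) (\<lambda>_. P)) \<le> C"
  defines "H \<equiv> \<lambda>\<omega>. F (I1 n \<omega>) (\<alpha>' \<omega>) (\<lambda>i\<in>{1..n} - I1 n \<omega>. (X i \<omega>, Y i \<omega>))"
  shows "H \<in> borel_measurable M" "(\<integral>\<^sup>+\<omega>. H \<omega> \<partial>M) \<le> C"
proof -
  interpret prob_space M by (rule M)
  interpret P: prob_space P by (rule P)
  interpret PP: product_sigma_finite "\<lambda>_ :: nat. P" by unfold_locales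
  let ?\<J> = "first_index_sets p n"
  let ?N = "Pi\<^sub>M {1..n} (\<lambda>_. borel) :: (nat \<Rightarrow> (real ^ 'd) \<times> real) measure"
  define Z where "Z \<omega> = (\<lambda>i\<in>{1..n}. (X i \<omega>, Y i \<omega>))" for \<omega>
  have Z: "Z \<in> measurable M ?N" "distr M ?N Z = Pi\<^sub>M {1..n} (\<lambda>_. P)"
    unfolding Z_def[abs_def] by (rule iid_sample_distr[OF M P iid n])+
  have I1: "I1 n \<in> measurable M (count_space ?\<J>)"
    and ind: "indep_set (sets (vimage_algebra (space M) (I1 n) (count_space ?\<J>)))
       (sets (vimage_algebra (space M) Z ?N))"
    using split n unfolding random_split_def Z_def[abs_def] by auto
  have I1_sub: "J \<subseteq> {1..n}" if "J \<in> ?\<J>" for J using that by (auto simp: first_index_sets_def)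
  define G where "G J s = F J (T J (restrict s J)) (restrict s ({1..n} - J))" for J s
  have G: "G J \<in> borel_measurable ?N" if J: "J \<in> ?\<J>" for J
  proof -
    have r: "(\<lambda>s. restrict s J) \<in> measurable ?N (Pi\<^sub>M J (\<lambda>_. borel))"
      "(\<lambda>s. restrict s ({1..n} - J)) \<in> measurable ?N (Pi\<^sub>M ({1..n} - J) (\<lambda>_. borel))"
      by (intro measurable_restrict_subset I1_sub[OF J] Diff_subset)+
    have "(\<lambda>s. (T J (restrict s J), restrict s ({1..n} - J)))
        \<in> measurable ?N (borel \<Otimes>\<^sub>M Pi\<^sub>M ({1..n} - J) (\<lambda>_. borel))"
      by (intro measurable_Pair measurable_compose[OF r(1) T[OF J]] r(2))
    from measurable_compose[OF this F[OF J]] show ?thesis by (simp add: G_def[abs_def])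
  qed
  have H: "H \<omega> = G (I1 n \<omega>) (Z \<omega>)" if \<omega>: "\<omega> \<in> space M" for \<omega>
  proof -
    have "I1 n \<omega> \<in> ?\<J>" using measurable_space[OF I1 \<omega>] by simp
    then have "{1..n} \<inter> I1 n \<omega> = I1 n \<omega>" using I1_sub by blast
    moreover have "{1..n} \<inter> ({1..n} - I1 n \<omega>) = {1..n} - I1 n \<omega>" by blast
    ultimately show ?thesis
      unfolding H_def G_def Z_def est[OF \<omega>] restrict_restrict by simp
  qed
  have GG: "(\<lambda>(J, s). G J s) \<in> borel_measurable (count_space ?\<J> \<Otimes>\<^sub>M ?N)"
    using finite_first_index_sets G
    by (intro measurable_pair_measure_countable1) (auto intro: countable_finite)
  have pair: "(\<lambda>\<omega>. (I1 n \<omega>, Z \<omega>)) \<in> measurable M (count_space ?\<J> \<Otimes>\<^sub>M ?N)"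
    using I1 Z(1) by (rule measurable_Pair)
  show "H \<in> borel_measurable M"
    using measurable_compose[OF pair GG] H by (subst measurable_cong) auto
  interpret D1: prob_space "distr M (count_space ?\<J>) (I1 n)" by (rule prob_space_distr[OF I1])
  interpret D2: prob_space "distr M ?N Z" by (rule prob_space_distr[OF Z(1)])
  have joint: "distr M (count_space ?\<J>) (I1 n) \<Otimes>\<^sub>M distr M ?N Z
      = distr M (count_space ?\<J> \<Otimes>\<^sub>M ?N) (\<lambda>\<omega>. (I1 n \<omega>, Z \<omega>))"
  proof (rule pair_measure_eqI)
    show "sigma_finite_measure (distr M (count_space ?\<J>) (I1 n))" "sigma_finite_measure (distr M ?N Z)"
      by unfold_locales
    fix A B assume "A \<in> sets (distr M (count_space ?\<J>) (I1 n))" "B \<in> sets (distr M ?N Z)"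
    then have A: "A \<in> sets (count_space ?\<J>)" and B: "B \<in> sets ?N" by auto
    have "prob ((I1 n -` A \<inter> space M) \<inter> (Z -` B \<inter> space M))
        = prob (I1 n -` A \<inter> space M) * prob (Z -` B \<inter> space M)"
      using ind by (rule indep_setD) (intro in_vimage_algebra A B)+
    moreover have "(\<lambda>\<omega>. (I1 n \<omega>, Z \<omega>)) -` (A \<times> B) \<inter> space M
        = (I1 n -` A \<inter> space M) \<inter> (Z -` B \<inter> space M)" by auto
    ultimately show "emeasure (distr M (count_space ?\<J>) (I1 n)) A * emeasure (distr M ?N Z) B
        = emeasure (distr M (count_space ?\<J> \<Otimes>\<^sub>M ?N) (\<lambda>\<omega>. (I1 n \<omega>, Z \<omega>))) (A \<times> B)"
      unfolding emeasure_distr[OF I1 A] emeasure_distr[OF Z(1) B] emeasure_distr[OF pair pair_measureI[OF A B]]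
      by (simp add: emeasure_eq_measure ennreal_mult)
  next
    have "sets (distr M (count_space ?\<J>) (I1 n) \<Otimes>\<^sub>M distr M ?N Z) = sets (count_space ?\<J> \<Otimes>\<^sub>M ?N)"
      by (intro sets_pair_measure_cong sets_distr)
    then show "sets (distr M (count_space ?\<J>) (I1 n) \<Otimes>\<^sub>M distr M ?N Z)
        = sets (distr M (count_space ?\<J> \<Otimes>\<^sub>M ?N) (\<lambda>\<omega>. (I1 n \<omega>, Z \<omega>)))"
      by (simp only: sets_distr)
  qed
  have inner: "(\<integral>\<^sup>+s. G J s \<partial>Pi\<^sub>M {1..n} (\<lambda>_. P)) \<le> C" if J: "J \<in> ?\<J>" for J
  proof -
    have J': "J \<inter> ({1..n} - J) = {}" "finite J" "finite ({1..n} - J)" "J \<union> ({1..n} - J) = {1..n}"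
      using I1_sub[OF J] finite_subset by auto
    have setsP: "sets (Pi\<^sub>M K (\<lambda>_. P)) = sets (Pi\<^sub>M K (\<lambda>_. borel))" for K :: "nat set"
      using P(2) by (intro sets_PiM_cong) auto
    have "(\<integral>\<^sup>+s. G J s \<partial>Pi\<^sub>M {1..n} (\<lambda>_. P))
        = (\<integral>\<^sup>+x. (\<integral>\<^sup>+y. G J (merge J ({1..n} - J) (x, y)) \<partial>Pi\<^sub>M ({1..n} - J) (\<lambda>_. P)) \<partial>Pi\<^sub>M J (\<lambda>_. P))"
      using PP.product_nn_integral_fold[OF J'(1-3), of "G J"] G[OF J]
      unfolding J'(4) measurable_cong_sets[OF setsP refl] by simp
    also have "\<dots> \<le> (\<integral>\<^sup>+x. C \<partial>Pi\<^sub>M J (\<lambda>_. P))"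
    proof (rule nn_integral_mono)
      fix x :: "nat \<Rightarrow> (real ^ 'd) \<times> real"
      have "(\<integral>\<^sup>+y. G J (merge J ({1..n} - J) (x, y)) \<partial>Pi\<^sub>M ({1..n} - J) (\<lambda>_. P))
          = (\<integral>\<^sup>+y. F J (T J (restrict x J)) y \<partial>Pi\<^sub>M ({1..n} - J) (\<lambda>_. P))"
      proof (rule nn_integral_cong)
        fix y assume "y \<in> space (Pi\<^sub>M ({1..n} - J) (\<lambda>_. P))"
        then have "restrict y ({1..n} - J) = y" by (auto simp: space_PiM PiE_restrict)
        then show "G J (merge J ({1..n} - J) (x, y)) = F J (T J (restrict x J)) y"
          using J'(1) by (simp add: G_def)
      qed
      then show "(\<integral>\<^sup>+y. G J (merge J ({1..n} - J) (x, y)) \<partial>Pi\<^sub>M ({1..n} - J) (\<lambda>_. P)) \<le> C"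
        using bound[OF J] by simp
    qed
    also have "\<dots> = C"
    proof -
      interpret PJ: prob_space "Pi\<^sub>M J (\<lambda>_. P)" by (intro prob_space_PiM P)
      show ?thesis by (simp add: PJ.emeasure_space_1)
    qed
    finally show ?thesis .
  qed
  have "(\<integral>\<^sup>+\<omega>. H \<omega> \<partial>M) = (\<integral>\<^sup>+\<omega>. (\<lambda>(J, s). G J s) (I1 n \<omega>, Z \<omega>) \<partial>M)"
    using H by (intro nn_integral_cong) simp
  also have "\<dots> = (\<integral>\<^sup>+x. (\<lambda>(J, s). G J s) x \<partial>distr M (count_space ?\<J> \<Otimes>\<^sub>M ?N) (\<lambda>\<omega>. (I1 n \<omega>, Z \<omega>)))"
    by (rule nn_integral_distr[symmetric, OF pair]) (use GG in simp)
  also have "\<dots> = (\<integral>\<^sup>+x. (\<lambda>(J, s). G J s) x \<partial>(distr M (count_space ?\<J>) (I1 n) \<Otimes>\<^sub>M distr M ?N Z))"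
    unfolding joint ..
  also have "\<dots> = (\<integral>\<^sup>+J. (\<integral>\<^sup>+s. G J s \<partial>distr M ?N Z) \<partial>distr M (count_space ?\<J>) (I1 n))"
    using GG by (subst D2.nn_integral_fst[symmetric]) (auto cong: measurable_cong_sets)
  also have "\<dots> \<le> (\<integral>\<^sup>+J. C \<partial>distr M (count_space ?\<J>) (I1 n))"
    unfolding Z(2) by (intro nn_integral_mono inner) auto
  also have "\<dots> = C"
    by (simp only: nn_integral_const D1.emeasure_space_1 mult_1_right)
  finally show "(\<integral>\<^sup>+\<omega>. H \<omega> \<partial>M) \<le> C" .
qed

section \<open>The loss of a fixed direction\<close>

definition cells :: "nat \<Rightarrow> nat" where
  "cells n = nat \<lceil>real n powr (1 / 3)\<rceil>"

text \<open>
  Both parts are scaled so as to be bounded in mean: the noise bound has expectation of order \<open>n\<^sup>-\<^sup>2\<^sup>/\<^sup>3\<close>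
  and the expected number of badly filled cells is of order \<open>n\<^sup>-\<^sup>1\<^sup>/\<^sup>3\<close>.  The value bounds the excess of
  the fit from above; for the deficit the direction \<open>- \<alpha>\<close> is used.
\<close>

definition direction_loss :: "(real ^ 'd) set \<Rightarrow> ((real ^ 'd) \<times> real \<Rightarrow> real) \<Rightarrow> real \<Rightarrow> nat \<Rightarrow>
    nat set \<Rightarrow> real ^ 'd \<Rightarrow> (nat \<Rightarrow> (real ^ 'd) \<times> real) \<Rightarrow> real" where
  "direction_loss S e \<rho> n J \<alpha> z =
     (let K = cells n; N = nat \<lceil>real (card J) * \<rho> / (2 * real K)\<rceil>;
          N' = nat \<lceil>real (card J) * \<rho> / (2 * (real K)\<^sup>2)\<rceil>;
          lo = - support_function S (- \<alpha>); hi = support_function S \<alpha>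
      in (real n powr (1 / 3))\<^sup>2 * noise_bound lo hi K N N' J (\<lambda>j. \<alpha> \<bullet> fst (z j)) (\<lambda>j. e (z j))
         + real n powr (1 / 3) * underfilled lo hi K N N' J (\<lambda>j. \<alpha> \<bullet> fst (z j)))"

lemma cells_bounds:
  assumes "n \<ge> 1"
  shows "1 \<le> real n powr (1 / 3)" "real n powr (1 / 3) \<le> real (cells n)"
    "real (cells n) \<le> 2 * real n powr (1 / 3)" "1 \<le> cells n" "(real n powr (1 / 3)) ^ 3 = real n"
proof -
  show r: "1 \<le> real n powr (1 / 3)" using assms by (intro ge_one_powr_ge_zero) auto
  then show "real n powr (1 / 3) \<le> real (cells n)" "real (cells n) \<le> 2 * real n powr (1 / 3)"
    unfolding cells_def by linarith+
  then show "1 \<le> cells n" using r by linarith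
  show "(real n powr (1 / 3)) ^ 3 = real n"
    using assms by (simp add: powr_power)
qed

lemma noise_bound_nonneg:
  "lo \<le> hi \<Longrightarrow> 0 \<le> noise_bound lo hi K N N' J t e"
  unfolding noise_bound_def by (auto intro!: add_nonneg_nonneg sum_nonneg mult_nonneg_nonneg)

lemma underfilled_nonneg: "0 \<le> underfilled lo hi K N N' J t"
  unfolding underfilled_def by (auto intro!: add_nonneg_nonneg sum_nonneg)

lemma borel_measurable_direction_loss:
  fixes S :: "(real ^ 'd) set"
  assumes J: "finite J" and bd: "\<And>x. x \<in> S \<Longrightarrow> norm x \<le> R" and ne: "S \<noteq> {}"
    and e: "e \<in> borel_measurable borel" and a: "a \<in> borel_measurable M"
    and z: "\<And>j. j \<in> J \<Longrightarrow> (\<lambda>w. z w j) \<in> measurable M borel"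
  shows "(\<lambda>w. direction_loss S e \<rho> n J (a w) (z w)) \<in> borel_measurable M"
proof -
  note sf = borel_measurable_support_function[OF bd ne]
  have hi [measurable]: "(\<lambda>w. support_function S (a w)) \<in> borel_measurable M"
    by (rule measurable_compose[OF a sf])
  have [measurable]: "(\<lambda>w. support_function S (- a w)) \<in> borel_measurable M"
    by (rule measurable_compose[OF _ sf]) (use a in simp)
  have t: "(\<lambda>w. a w \<bullet> fst (z w j)) \<in> borel_measurable M" if "j \<in> J" for j
  proof -
    have "(\<lambda>w. fst (z w j)) \<in> borel_measurable M"
      by (rule measurable_compose[OF z[OF that] borel_measurable_continuous_onI[OF continuous_on_fst[OF continuous_on_id]]])
    then show ?thesis using a by simp
  qed
  have ez: "(\<lambda>w. e (z w j)) \<in> borel_measurable M" if "j \<in> J" for j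
    by (rule measurable_compose[OF z[OF that] e])
  note borel_measurable_noise_bound[OF J t ez, measurable] borel_measurable_underfilled[OF J t, measurable]
  show ?thesis unfolding direction_loss_def Let_def by measurable
qed

lemma expected_direction_loss:
  fixes P :: "((real ^ 'd) \<times> real) measure" and S :: "(real ^ 'd) set"
  assumes P: "prob_space P" "sets P = sets borel" and S_P: "AE z in P. fst z \<in> S"
    and cv: "convex S" and ne: "S \<noteq> {}" and bd: "\<And>x. x \<in> S \<Longrightarrow> norm x \<le> R"
    and noise: "centred_noise P borel fst (\<lambda>x. (x, 0)) e v"
    and d: "distributed P lborel (\<lambda>z. \<alpha> \<bullet> fst z) (\<lambda>t. ennreal (f t))"
    and f: "\<And>t. 0 \<le> f t" "\<And>t. f t \<le> q_up" "\<And>t. t \<in> index_range S \<alpha> \<Longrightarrow> q_low \<le> f t"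
    and q: "0 < q_up" "0 < q_low" and n: "n \<ge> 1" and J: "finite J" "J \<noteq> {}"
    and card: "c * real n \<le> real (card J)" "0 < c"
  defines "\<rho> \<equiv> q_low / q_up"
  shows "(\<integral>\<^sup>+z. ennreal (direction_loss S e \<rho> n J \<alpha> z) \<partial>Pi\<^sub>M J (\<lambda>_. P))
    \<le> ennreal (32 * v / q_low * (8 / (c * \<rho>) + 1) + 32 / (c * \<rho>))"
proof -
  interpret centred_noise P borel fst "\<lambda>x. (x, 0)" e v by (rule noise)
  define lo where "lo = - support_function S (- \<alpha>)"
  define hi where "hi = support_function S \<alpha>"
  define r where "r = real n powr (1 / 3)"
  define K where "K = cells n"
  define m where "m = real (card J)"
  define N where "N = nat \<lceil>m * \<rho> / (2 * real K)\<rceil>"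
  define N' where "N' = nat \<lceil>m * \<rho> / (2 * (real K)\<^sup>2)\<rceil>"
  have r: "1 \<le> r" "r \<le> real K" "real K \<le> 2 * r" "1 \<le> K" "r ^ 3 = real n"
    unfolding r_def K_def by (rule cells_bounds[OF n])+
  note facts = projected_density_facts[OF P(1) S_P cv ne bd d f q, folded lo_def hi_def]
  have \<rho>: "\<rho> > 0" using q by (simp add: \<rho>_def)
  have m: "m \<ge> c * r ^ 3" "m > 0"
    using card(1) J by (auto simp: m_def r(5) card_gt_0_iff)
  have len: "0 < hi - lo" using facts(1) q by (smt (verit) divide_pos_pos)
  have K: "real K > 0" using r by simp
  have Ncond: "m * \<rho> / (2 * real K) \<le> real N" "N \<ge> 1" "m * \<rho> / (2 * (real K)\<^sup>2) \<le> real N'" "N' \<ge> 1"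
  proof -
    have "0 < m * \<rho> / (2 * real K)" "0 < m * \<rho> / (2 * (real K)\<^sup>2)" using m \<rho> K by auto
    then show "m * \<rho> / (2 * real K) \<le> real N" "N \<ge> 1" "m * \<rho> / (2 * (real K)\<^sup>2) \<le> real N'" "N' \<ge> 1"
      unfolding N_def N'_def by linarith+
  qed
  let ?S = "Pi\<^sub>M J (\<lambda>_. P)"
  let ?t = "\<lambda>z j. \<alpha> \<bullet> fst (z j)"
  have proj: "(\<lambda>x. \<alpha> \<bullet> x) \<in> borel_measurable borel" by measurable
  have tm [measurable]: "(\<lambda>z. ?t z j) \<in> borel_measurable ?S" "(\<lambda>z. e (z j)) \<in> borel_measurable ?S" if "j \<in> J" for j
    using measurable_compose[OF measurable_component_singleton[OF that] measurable_compose[OF X proj]]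
      measurable_compose[OF measurable_component_singleton[OF that] e] by simp_all
  define Nb where "Nb z = noise_bound lo hi K N N' J (?t z) (\<lambda>j. e (z j))" for z :: "nat \<Rightarrow> (real ^ 'd) \<times> real"
  define U where "U z = underfilled lo hi K N N' J (?t z)" for z :: "nat \<Rightarrow> (real ^ 'd) \<times> real"
  have [measurable]: "Nb \<in> borel_measurable ?S" unfolding Nb_def
    by (rule borel_measurable_noise_bound[OF J(1)]) (auto intro: tm)
  have [measurable]: "U \<in> borel_measurable ?S" unfolding U_def
    by (rule borel_measurable_underfilled[OF J(1)]) (auto intro: tm)
  have nn: "0 \<le> Nb z" "0 \<le> U z" for z
    using len by (auto simp: Nb_def U_def noise_bound_nonneg underfilled_nonneg)
  have "(\<integral>\<^sup>+z. ennreal (direction_loss S e \<rho> n J \<alpha> z) \<partial>?S) = (\<integral>\<^sup>+z. ennreal (r\<^sup>2) * ennreal (Nb z) + ennreal r * ennreal (U z) \<partial>?S)"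
  proof (rule nn_integral_cong)
    fix z
    have "direction_loss S e \<rho> n J \<alpha> z = r\<^sup>2 * Nb z + r * U z"
      unfolding direction_loss_def Let_def Nb_def U_def lo_def hi_def K_def N_def N'_def r_def m_def ..
    then show "ennreal (direction_loss S e \<rho> n J \<alpha> z) = ennreal (r\<^sup>2) * ennreal (Nb z) + ennreal r * ennreal (U z)"
      using nn r(1) by (simp add: ennreal_plus ennreal_mult)
  qed
  also have "\<dots> = ennreal (r\<^sup>2) * (\<integral>\<^sup>+z. ennreal (Nb z) \<partial>?S) + ennreal r * (\<integral>\<^sup>+z. ennreal (U z) \<partial>?S)"
    by (simp add: nn_integral_add nn_integral_cmult)
  also have "\<dots> \<le> ennreal (r\<^sup>2) * ennreal (32 * v * (hi - lo) * (1 / real N + 1 / (real K * real N') + 1 / (real K)\<^sup>2))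
      + ennreal r * ennreal (8 * (real K)\<^sup>2 / (m * \<rho>))"
  proof (intro add_mono mult_left_mono)
    show "(\<integral>\<^sup>+z. ennreal (Nb z) \<partial>?S) \<le> ennreal (32 * v * (hi - lo) * (1 / real N + 1 / (real K * real N') + 1 / (real K)\<^sup>2))"
      unfolding Nb_def using len by (intro expected_noise_bound[OF J(1) proj _ r(4) Ncond(2,4)]) auto
    show "(\<integral>\<^sup>+z. ennreal (U z) \<partial>?S) \<le> ennreal (8 * (real K)\<^sup>2 / (m * \<rho>))"
      unfolding U_def m_def \<rho>_def
      by (rule expected_underfilled[OF P J facts(3) facts(1) q r(4)]) (simp_all add: N_def N'_def m_def \<rho>_def)
  qed auto
  also have "\<dots> = ennreal (r\<^sup>2 * (32 * v * (hi - lo) * (1 / real N + 1 / (real K * real N') + 1 / (real K)\<^sup>2))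
      + r * (8 * (real K)\<^sup>2 / (m * \<rho>)))"
  proof -
    have "ennreal a * ennreal b + ennreal a' * ennreal b' = ennreal (a * b + a' * b')"
      if "0 \<le> a" "0 \<le> b" "0 \<le> a'" "0 \<le> b'" for a b a' b' :: real
      using that by (simp add: ennreal_plus ennreal_mult)
    then show ?thesis using r(1) v_nonneg len m \<rho> by auto
  qed
  also have "\<dots> \<le> ennreal (32 * v / q_low * (8 / (c * \<rho>) + 1) + 32 / (c * \<rho>))"
  proof (intro ennreal_leI add_mono)
    have c3: "0 < c * r ^ 3 * \<rho>" using card(2) \<rho> r(1) by simp
    have le_m: "x / (m * \<rho>) \<le> x / (c * r ^ 3 * \<rho>)" if "0 \<le> x" for x
      using that m(1) \<rho> c3 card(2) r(1) by (intro divide_left_mono mult_right_mono mult_pos_pos m(2)) auto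
    have "2 * real K / (m * \<rho>) \<le> 2 * real K / (c * r ^ 3 * \<rho>)" by (rule le_m) simp
    also have "\<dots> \<le> 2 * (2 * r) / (c * r ^ 3 * \<rho>)" using r(3) c3 by (intro divide_right_mono) auto
    also have "\<dots> = 4 / (c * \<rho>) / r\<^sup>2" using r(1) card(2) \<rho> by (simp add: field_simps power2_eq_square power3_eq_cube)
    finally have small: "2 * real K / (m * \<rho>) \<le> 4 / (c * \<rho>) / r\<^sup>2" .
    have "1 / real N \<le> 1 / (m * \<rho> / (2 * real K))"
      using Ncond(1,2) m \<rho> K by (intro divide_left_mono mult_pos_pos) auto
    then have N1: "1 / real N \<le> 4 / (c * \<rho>) / r\<^sup>2" using small by simp
    have "1 / (real K * real N') \<le> 1 / (real K * (m * \<rho> / (2 * (real K)\<^sup>2)))"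
      using Ncond(3,4) m \<rho> K by (intro divide_left_mono mult_pos_pos mult_left_mono) auto
    also have "\<dots> = 2 * real K / (m * \<rho>)" using K m \<rho> by (simp add: field_simps power2_eq_square)
    finally have N2: "1 / (real K * real N') \<le> 4 / (c * \<rho>) / r\<^sup>2" using small by simp
    have K2: "1 / (real K)\<^sup>2 \<le> 1 / r\<^sup>2"
      using r K by (intro divide_left_mono power_mono mult_pos_pos) auto
    have sum: "1 / real N + 1 / (real K * real N') + 1 / (real K)\<^sup>2 \<le> (8 / (c * \<rho>) + 1) / r\<^sup>2"
    proof -
      have "4 / (c * \<rho>) / r\<^sup>2 + 4 / (c * \<rho>) / r\<^sup>2 + 1 / r\<^sup>2 = (8 / (c * \<rho>) + 1) / r\<^sup>2"
        by (simp add: add_divide_distrib)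
      then show ?thesis using N1 N2 K2 by linarith
    qed
    have "r\<^sup>2 * (32 * v * (hi - lo) * (1 / real N + 1 / (real K * real N') + 1 / (real K)\<^sup>2))
        \<le> r\<^sup>2 * (32 * v * (1 / q_low) * ((8 / (c * \<rho>) + 1) / r\<^sup>2))"
      using facts(2) sum v_nonneg len q by (intro mult_left_mono mult_mono) auto
    also have "\<dots> = 32 * v / q_low * (8 / (c * \<rho>) + 1)" using r(1) by simp
    finally show "r\<^sup>2 * (32 * v * (hi - lo) * (1 / real N + 1 / (real K * real N') + 1 / (real K)\<^sup>2))
        \<le> 32 * v / q_low * (8 / (c * \<rho>) + 1)" .
    have "r * (8 * (real K)\<^sup>2 / (m * \<rho>)) \<le> r * (8 * (2 * r)\<^sup>2 / (c * r ^ 3 * \<rho>))"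
    proof (rule mult_left_mono)
      have "8 * (real K)\<^sup>2 / (m * \<rho>) \<le> 8 * (real K)\<^sup>2 / (c * r ^ 3 * \<rho>)" by (rule le_m) simp
      also have "\<dots> \<le> 8 * (2 * r)\<^sup>2 / (c * r ^ 3 * \<rho>)"
        using r(3) c3 K by (intro divide_right_mono mult_left_mono power_mono) auto
      finally show "8 * (real K)\<^sup>2 / (m * \<rho>) \<le> 8 * (2 * r)\<^sup>2 / (c * r ^ 3 * \<rho>)" .
    qed (use r(1) in simp)
    also have "\<dots> = 32 / (c * \<rho>)"
      using r(1) card(2) \<rho> by (simp add: field_simps power2_eq_square power3_eq_cube)
    finally show "r * (8 * (real K)\<^sup>2 / (m * \<rho>)) \<le> 32 / (c * \<rho>)" .
  qed
  finally show ?thesis .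
qed

section \<open>The rate of the isotonic fit\<close>

lemma monotone_lse_cong:
  assumes "\<And>i. i \<in> J \<Longrightarrow> t i = t' i" "\<And>i. i \<in> J \<Longrightarrow> y i = y' i"
  shows "monotone_lse J t y \<Psi> \<longleftrightarrow> monotone_lse J t' y' \<Psi>"
proof -
  have "(\<Sum>i\<in>J. (y i - \<Phi> (t i))\<^sup>2) = (\<Sum>i\<in>J. (y' i - \<Phi> (t' i))\<^sup>2)" for \<Phi> :: "real \<Rightarrow> real"
    using assms by (intro sum.cong) auto
  moreover have "t ` J = t' ` J" using assms by (intro image_cong) auto
  ultimately show ?thesis by (simp add: monotone_lse_def)
qed

lemma second_subsample_size:
  assumes "J \<in> first_index_sets p n" "0 < p" "p < 1" "n \<ge> 1"
  shows "finite ({1..n} - J)" "{1..n} - J \<noteq> {}" "(1 - p) * real n \<le> real (card ({1..n} - J))"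
proof -
  have J: "J \<subseteq> {1..n}" "card J = nat \<lfloor>p * real n\<rfloor>" using assms(1) by (auto simp: first_index_sets_def)
  have "card ({1..n} - J) = n - nat \<lfloor>p * real n\<rfloor>"
    using J finite_subset[OF J(1)] by (simp add: card_Diff_subset)
  moreover have "real (nat \<lfloor>p * real n\<rfloor>) \<le> p * real n" using assms by simp
  ultimately show le: "(1 - p) * real n \<le> real (card ({1..n} - J))"
    by (simp add: algebra_simps)
  have "0 < (1 - p) * real n" using assms by simp
  then show "{1..n} - J \<noteq> {}" using le by (metis card.empty not_le of_nat_0)
qed simp

text \<open>
  The number of badly filled cells is an integer, so it vanishes as soon as it is less than one.
\<close>

lemma direction_loss_le_imp:
  fixes S :: "(real ^ 'd) set"
  assumes le: "direction_loss S e \<rho> n J \<alpha> z \<le> c" and c: "c < real n powr (1 / 3)" and n: "n \<ge> 1"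
    and lohi: "- support_function S (- \<alpha>) \<le> support_function S \<alpha>"
  defines "K \<equiv> cells n" and "N \<equiv> nat \<lceil>real (card J) * \<rho> / (2 * real (cells n))\<rceil>"
    and "N' \<equiv> nat \<lceil>real (card J) * \<rho> / (2 * (real (cells n))\<^sup>2)\<rceil>"
  shows "well_filled (- support_function S (- \<alpha>)) (support_function S \<alpha>) K N N' J (\<lambda>j. \<alpha> \<bullet> fst (z j))"
    "noise_bound (- support_function S (- \<alpha>)) (support_function S \<alpha>) K N N' J (\<lambda>j. \<alpha> \<bullet> fst (z j)) (\<lambda>j. e (z j))
      \<le> c / (real n powr (1 / 3))\<^sup>2"
proof -
  define r where "r = real n powr (1 / 3)"
  have r: "1 \<le> r" unfolding r_def by (rule cells_bounds[OF n])
  define U where "U = underfilled (- support_function S (- \<alpha>)) (support_function S \<alpha>) K N N' J (\<lambda>j. \<alpha> \<bullet> fst (z j))"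
  define B where "B = noise_bound (- support_function S (- \<alpha>)) (support_function S \<alpha>) K N N' J (\<lambda>j. \<alpha> \<bullet> fst (z j)) (\<lambda>j. e (z j))"
  have nn: "0 \<le> U" "0 \<le> B" unfolding U_def B_def by (intro underfilled_nonneg noise_bound_nonneg lohi)+
  have eq: "r\<^sup>2 * B + r * U \<le> c"
    using le unfolding direction_loss_def Let_def B_def U_def K_def N_def N'_def r_def .
  have "r * U \<le> c" using eq nn r by (smt (verit) mult_nonneg_nonneg zero_le_power2)
  then have "r * U < r * 1" using c unfolding r_def[symmetric] by simp
  then have "U < 1" using r by (simp add: mult_less_cancel_left_pos)
  then show "well_filled (- support_function S (- \<alpha>)) (support_function S \<alpha>) K N N' J (\<lambda>j. \<alpha> \<bullet> fst (z j))"
    unfolding U_def by (rule well_filledI)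
  have "r\<^sup>2 * B \<le> c" using eq nn r by (smt (verit) mult_nonneg_nonneg)
  then have "B \<le> c / r\<^sup>2" using r by (simp add: pos_le_divide_eq mult.commute)
  then show "noise_bound (- support_function S (- \<alpha>)) (support_function S \<alpha>) K N N' J (\<lambda>j. \<alpha> \<bullet> fst (z j)) (\<lambda>j. e (z j))
      \<le> c / (real n powr (1 / 3))\<^sup>2" unfolding B_def r_def .
qed

text \<open>
  Index and link are both within \<open>d\<close> of their targets, the link in mean square over the range of the
  index \<open>\<alpha>\<close> itself rather than that of \<open>\<alpha>0\<close>.
\<close>

definition close_fit :: "(real ^ 'd) set \<Rightarrow> (real \<Rightarrow> real) \<Rightarrow> real ^ 'd \<Rightarrow> real \<Rightarrow> real ^ 'd \<Rightarrow> (real \<Rightarrow> real) \<Rightarrow> bool" where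
  "close_fit S \<psi> \<alpha>0 d \<alpha> \<Phi> \<longleftrightarrow> norm (\<alpha> - \<alpha>0) \<le> d \<and>
     (\<integral>\<^sup>+s. ennreal ((\<Phi> s - \<psi> s)\<^sup>2) * indicator {- support_function S (- \<alpha>)..support_function S \<alpha>} s \<partial>lborel)
       \<le> ennreal (d\<^sup>2)"

text \<open>
  Markov's inequality for the loss of the two directions \<open>\<alpha>' n \<omega>\<close> and \<open>- \<alpha>' n \<omega>\<close> gives an event on which
  all cells are well filled and the noise is small.  Intersected with the event that the index estimate
  is close to \<open>\<alpha>0\<close>, it allows \<open>isotonic_lse_integral_bound\<close> to be applied with a bias \<open>\<delta>\<close> of
  order \<open>n\<^sup>-\<^sup>1\<^sup>/\<^sup>3\<close>.
\<close>

lemma plug_in_lse_rate: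
  fixes P :: "((real ^ 'd) \<times> real) measure" and S :: "(real ^ 'd) set"
    and M :: "'w measure" and \<alpha>' :: "nat \<Rightarrow> 'w \<Rightarrow> real ^ 'd"
  assumes P: "prob_space P" "sets P = sets borel"
    and S: "AE x in design_law P. x \<in> S" and \<kappa>: "is_conditional_law P \<kappa>"
    and model: "monotone_single_index P \<Psi>0 \<alpha>0"
    and sample: "prob_space M" "iid_sample M P X Y"
    and split: "0 < p" "p < 1" "random_split M p X Y I1"
    and estimator: "first_subsample_estimator M p X Y I1 \<alpha>'"
      "\<And>n \<omega>. n \<ge> 1 \<Longrightarrow> \<omega> \<in> space M \<Longrightarrow> \<alpha>' n \<omega> \<in> sphere 0 1"
    and rate: "O_p M (\<lambda>n \<omega>. \<alpha>' n \<omega> - \<alpha>0) (\<lambda>n. real n powr (- 1 / 3))"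
    and lse: "\<And>n \<omega>. n \<ge> 1 \<Longrightarrow> \<omega> \<in> space M \<Longrightarrow>
      monotone_lse ({1..n} - I1 n \<omega>) (\<lambda>i. \<alpha>' n \<omega> \<bullet> X i \<omega>) (\<lambda>i. Y i \<omega>) (\<Psi>' n \<omega>)"
    and A2: "A2 S (\<lambda>x. \<Psi>0 (\<alpha>0 \<bullet> x))" and A3: "A3 S \<kappa>" and A4: "A4 S P"
    and cv: "convex S" and bd: "\<And>x. x \<in> S \<Longrightarrow> norm x \<le> R"
    and \<psi>: "mono \<psi>" "L-lipschitz_on UNIV \<psi>" "\<And>t. t \<in> index_range S \<alpha>0 \<Longrightarrow> \<psi> t = \<Psi>0 t"
    and \<epsilon>: "\<epsilon> > 0"
  shows "\<exists>C. \<forall>\<^sub>F n in sequentially. \<exists>E\<in>sets M. measure M E \<ge> 1 - \<epsilon> \<and> (\<forall>\<omega>\<in>E.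
     close_fit S \<psi> \<alpha>0 (C * real n powr (- 1 / 3)) (\<alpha>' n \<omega>) (\<Psi>' n \<omega>))"
proof -
  interpret P: prob_space P by (rule P)
  interpret M: prob_space M by (rule sample)
  define e where "e z = snd z - \<Psi>0 (\<alpha>0 \<bullet> fst z)" for z :: "(real ^ 'd) \<times> real"
  obtain v where noise: "centred_noise P borel fst (\<lambda>x. (x, 0)) e v"
    using regression_noise_centred[OF P S \<kappa> model A2 A3] unfolding e_def[abs_def] by blast
  interpret N: centred_noise P borel fst "\<lambda>x. (x, 0)" e v by (rule noise)
  have e_m: "e \<in> borel_measurable borel"
    using N.e measurable_cong_sets[OF P(2) refl] by blast
  have S_P: "AE z in P. fst z \<in> S" using S unfolding design_law_def by (rule AE_distrD[OF N.X])
  have ne: "S \<noteq> {}"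
  proof
    assume "S = {}"
    then have "AE z in P. False" using S_P by simp
    then show False by simp
  qed
  obtain x0 where x0: "x0 \<in> S" using ne by blast
  then have R: "0 \<le> R" using bd[of x0] norm_ge_zero[of x0] by linarith
  have L: "0 \<le> L" using \<psi>(2) by (rule lipschitz_on_nonneg)
  obtain q_up q_low where q: "q_up > 0" "q_low > 0" and A4': "\<And>\<alpha>. \<alpha> \<in> sphere 0 1 \<Longrightarrow> \<exists>f :: real \<Rightarrow> real.
    distributed P lborel (\<lambda>z. \<alpha> \<bullet> fst z) (\<lambda>t. ennreal (f t)) \<and>
     (\<forall>t. 0 \<le> f t \<and> f t \<le> q_up) \<and> (\<forall>t\<in>index_range S \<alpha>. q_low \<le> f t)"
    using A4 unfolding A4_def by blast
  have len: "0 < support_function S \<alpha> - - support_function S (- \<alpha>)"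
    "support_function S \<alpha> - - support_function S (- \<alpha>) \<le> 1 / q_low" if \<alpha>: "\<alpha> \<in> sphere 0 1" for \<alpha>
  proof -
    obtain f where f: "distributed P lborel (\<lambda>z. \<alpha> \<bullet> fst z) (\<lambda>t. ennreal (f t))"
      "\<And>t. 0 \<le> f t" "\<And>t. f t \<le> q_up" "\<And>t. t \<in> index_range S \<alpha> \<Longrightarrow> q_low \<le> f t"
      using A4'[OF \<alpha>] by blast
    have "0 < 1 / q_up" using q by simp
    also have "1 / q_up \<le> support_function S \<alpha> - - support_function S (- \<alpha>)"
      by (rule projected_density_facts(1)[OF P(1) S_P cv ne bd f q])
    finally show "0 < support_function S \<alpha> - - support_function S (- \<alpha>)" .
    show "support_function S \<alpha> - - support_function S (- \<alpha>) \<le> 1 / q_low"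
      by (rule projected_density_facts(2)[OF P(1) S_P cv ne bd f q])
  qed
  define \<rho> where "\<rho> = q_low / q_up"
  define C0 where "C0 = 32 * v / q_low * (8 / ((1 - p) * \<rho>) + 1) + 32 / ((1 - p) * \<rho>)"
  have C0: "C0 > 0" using q split N.v_nonneg unfolding C0_def \<rho>_def
    by (intro add_nonneg_pos mult_nonneg_nonneg add_nonneg_nonneg) auto
  \<comment> \<open>Both directions together have expected loss at most \<open>2 C0\<close>, so their loss reaches \<open>c\<close> with probability at most \<open>\<epsilon> / 2\<close>.\<close>
  define c where "c = 4 * C0 / \<epsilon>"
  have c: "c > 0" using C0 \<epsilon> by (simp add: c_def)
  obtain T :: "nat \<Rightarrow> nat set \<Rightarrow> (nat \<Rightarrow> (real ^ 'd) \<times> real) \<Rightarrow> real ^ 'd" where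
    T: "\<And>n J. n \<ge> 1 \<Longrightarrow> J \<in> first_index_sets p n \<Longrightarrow> T n J \<in> measurable (Pi\<^sub>M J (\<lambda>_. borel)) borel"
    and est: "\<And>n \<omega>. n \<ge> 1 \<Longrightarrow> \<omega> \<in> space M \<Longrightarrow> \<alpha>' n \<omega> = T n (I1 n \<omega>) (\<lambda>i\<in>I1 n \<omega>. (X i \<omega>, Y i \<omega>))"
    using estimator(1) unfolding first_subsample_estimator_def by blast
  \<comment> \<open>The loss is set to \<open>0\<close> off the sphere, where the density bounds say nothing.\<close>
  define F where "F n J \<alpha> z = (if norm \<alpha> = 1 then ennreal (direction_loss S e \<rho> n ({1..n} - J) \<alpha> z)
      + ennreal (direction_loss S e \<rho> n ({1..n} - J) (- \<alpha>) z) else 0)" for n J \<alpha> z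
  define H where "H n \<omega> = F n (I1 n \<omega>) (\<alpha>' n \<omega>) (\<lambda>i\<in>{1..n} - I1 n \<omega>. (X i \<omega>, Y i \<omega>))" for n \<omega>
  have H: "H n \<in> borel_measurable M" "(\<integral>\<^sup>+\<omega>. H n \<omega> \<partial>M) \<le> ennreal (2 * C0)" if n: "n \<ge> 1" for n
  proof -
    have F_m: "(\<lambda>(\<alpha>, z). F n J \<alpha> z) \<in> borel_measurable (borel \<Otimes>\<^sub>M Pi\<^sub>M ({1..n} - J) (\<lambda>_. borel))" for J
    proof -
      let ?N = "borel \<Otimes>\<^sub>M Pi\<^sub>M ({1..n} - J) (\<lambda>_. borel) :: ((real ^ 'd) \<times> (nat \<Rightarrow> (real ^ 'd) \<times> real)) measure"
      have z: "(\<lambda>w. snd w j) \<in> measurable ?N borel" if "j \<in> {1..n} - J" for j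
        by (rule measurable_compose[OF measurable_snd measurable_component_singleton[OF that]])
      have 1: "(\<lambda>w. direction_loss S e \<rho> n ({1..n} - J) (fst w) (snd w)) \<in> borel_measurable ?N"
        by (rule borel_measurable_direction_loss[OF _ bd ne e_m _ z]) auto
      have 2: "(\<lambda>w. direction_loss S e \<rho> n ({1..n} - J) (- fst w) (snd w)) \<in> borel_measurable ?N"
        by (rule borel_measurable_direction_loss[OF _ bd ne e_m _ z]) auto
      note 1 [measurable] 2 [measurable]
      have [measurable]: "Measurable.pred ?N (\<lambda>w. norm (fst w) = 1)" by measurable
      show ?thesis unfolding F_def case_prod_beta by measurable
    qed
    have bound: "(\<integral>\<^sup>+z. F n J \<alpha> z \<partial>Pi\<^sub>M ({1..n} - J) (\<lambda>_. P)) \<le> ennreal (2 * C0)"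
      if J: "J \<in> first_index_sets p n" for J \<alpha>
    proof (cases "norm \<alpha> = 1")
      case False
      then show ?thesis by (simp add: F_def)
    next
      case True
      note size = second_subsample_size[OF J split(1,2) n]
      let ?S = "Pi\<^sub>M ({1..n} - J) (\<lambda>_. P)"
      have z: "(\<lambda>w. w j) \<in> measurable ?S borel" if "j \<in> {1..n} - J" for j
        using measurable_component_singleton[OF that, of "\<lambda>_. P"] by (simp add: measurable_cong_sets[OF refl P(2)])
      have dl_m: "(\<lambda>z. direction_loss S e \<rho> n ({1..n} - J) \<beta> z) \<in> borel_measurable ?S" for \<beta>
        by (rule borel_measurable_direction_loss[OF size(1) bd ne e_m _ z]) auto
      have dl: "(\<integral>\<^sup>+z. ennreal (direction_loss S e \<rho> n ({1..n} - J) \<beta> z) \<partial>?S) \<le> ennreal C0"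
        if \<beta>: "norm \<beta> = 1" for \<beta>
      proof -
        have "\<beta> \<in> sphere 0 1" using \<beta> by simp
        then obtain f where f: "distributed P lborel (\<lambda>z. \<beta> \<bullet> fst z) (\<lambda>t. ennreal (f t))"
          "\<And>t. 0 \<le> f t" "\<And>t. f t \<le> q_up" "\<And>t. t \<in> index_range S \<beta> \<Longrightarrow> q_low \<le> f t"
          using A4' by blast
        show ?thesis unfolding C0_def \<rho>_def
          by (rule expected_direction_loss[OF P S_P cv ne bd noise f q n size]) (use split(2) in auto)
      qed
      have "(\<integral>\<^sup>+z. F n J \<alpha> z \<partial>?S) = (\<integral>\<^sup>+z. ennreal (direction_loss S e \<rho> n ({1..n} - J) \<alpha> z) \<partial>?S)
          + (\<integral>\<^sup>+z. ennreal (direction_loss S e \<rho> n ({1..n} - J) (- \<alpha>) z) \<partial>?S)"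
        unfolding F_def using True dl_m by (simp add: nn_integral_add)
      also have "\<dots> \<le> ennreal C0 + ennreal C0" using True by (intro add_mono dl) auto
      also have "\<dots> = ennreal (2 * C0)" using C0 by (simp flip: ennreal_plus)
      finally show ?thesis .
    qed
    show "H n \<in> borel_measurable M" "(\<integral>\<^sup>+\<omega>. H n \<omega> \<partial>M) \<le> ennreal (2 * C0)"
      unfolding H_def[abs_def]
      by (rule nn_integral_split_sample_le[OF sample(1) P sample(2) split(3) n T[OF n] est[OF n] F_m bound];
          assumption)+
  qed
  obtain C2 where C2: "\<forall>\<^sub>F n in sequentially. \<exists>E\<in>sets M. measure M E \<ge> 1 - \<epsilon> / 2 \<and>
     (\<forall>\<omega>\<in>E. norm (\<alpha>' n \<omega> - \<alpha>0) \<le> C2 * real n powr (- 1 / 3))"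
    using rate \<epsilon> unfolding O_p_def by (meson half_gt_zero)
  define D where "D = 6 * (1 / q_low) * ((2 * L * (1 / q_low))\<^sup>2 + (L * R * \<bar>C2\<bar>)\<^sup>2) + 6 * c"
  have D: "0 \<le> D" using q c by (auto simp: D_def intro!: add_nonneg_nonneg mult_nonneg_nonneg)
  \<comment> \<open>The summand \<open>1\<close> ensures \<open>C \<ge> 1\<close>, hence \<open>D \<le> C\<^sup>2\<close>.\<close>
  define C where "C = max \<bar>C2\<bar> (1 + D)"
  have C: "\<bar>C2\<bar> \<le> C" "D \<le> C\<^sup>2"
  proof -
    show "\<bar>C2\<bar> \<le> C" by (simp add: C_def)
    have "1 + D \<le> C" by (simp add: C_def)
    then have "D \<le> C" "1 \<le> C" using D by auto
    then have "D \<le> C * 1" "C * 1 \<le> C * C" by (auto intro: mult_left_mono)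
    then show "D \<le> C\<^sup>2" by (simp add: power2_eq_square)
  qed
  have "\<forall>\<^sub>F n in sequentially. n \<ge> 1" by (rule eventually_ge_at_top)
  moreover have "\<forall>\<^sub>F n in sequentially. c < real n powr (1 / 3)"
  proof -
    have "filterlim (\<lambda>n. real n powr (1 / 3)) at_top sequentially"
      by (intro filterlim_compose[OF real_powr_at_top filterlim_real_sequentially]) simp
    then show ?thesis by (simp add: filterlim_at_top_dense)
  qed
  ultimately have "\<forall>\<^sub>F n in sequentially. \<exists>E\<in>sets M. measure M E \<ge> 1 - \<epsilon> \<and> (\<forall>\<omega>\<in>E.
     close_fit S \<psi> \<alpha>0 (C * real n powr (- 1 / 3)) (\<alpha>' n \<omega>) (\<Psi>' n \<omega>))"
    using C2
  proof eventually_elim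
    case (elim n)
    have n: "n \<ge> 1" and cn: "c < real n powr (1 / 3)" using elim by auto
    define r where "r = real n powr (1 / 3)"
    have r: "1 \<le> r" "r \<le> real (cells n)" "1 \<le> cells n" unfolding r_def using cells_bounds[OF n] by auto
    have r_inv: "real n powr (- 1 / 3) = 1 / r"
      using powr_minus_divide[of "real n" "1 / 3"] by (simp add: r_def)
    then have r_inv': "real n powr - (1 / 3) = 1 / r" by simp
    obtain E2 where E2: "E2 \<in> sets M" "measure M E2 \<ge> 1 - \<epsilon> / 2"
      "\<And>\<omega>. \<omega> \<in> E2 \<Longrightarrow> norm (\<alpha>' n \<omega> - \<alpha>0) \<le> C2 * real n powr (- 1 / 3)"
      using elim by blast
    note [measurable] = H(1)[OF n]
    define B1 where "B1 = {\<omega> \<in> space M. 1 \<le> ennreal (1 / c) * H n \<omega>}"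
    have B1: "B1 \<in> sets M" unfolding B1_def by measurable
    have pB1: "measure M B1 \<le> \<epsilon> / 2"
    proof -
      have "emeasure M B1 \<le> ennreal (1 / c) * (\<integral>\<^sup>+\<omega>. H n \<omega> * indicator (space M) \<omega> \<partial>M)"
        unfolding B1_def using nn_integral_Markov_inequality[of "H n" "space M" M "ennreal (1 / c)"] by simp
      also have "(\<integral>\<^sup>+\<omega>. H n \<omega> * indicator (space M) \<omega> \<partial>M) = (\<integral>\<^sup>+\<omega>. H n \<omega> \<partial>M)"
        by (intro nn_integral_cong) simp
      also have "ennreal (1 / c) * \<dots> \<le> ennreal (1 / c) * ennreal (2 * C0)" by (intro mult_left_mono H n) auto
      also have "\<dots> = ennreal (\<epsilon> / 2)" using c C0 \<epsilon> by (simp add: c_def flip: ennreal_mult')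
      finally show ?thesis using \<epsilon> by (simp add: M.emeasure_eq_measure)
    qed
    have "AE \<omega> in M. \<forall>i\<in>{1..n}. X i \<omega> \<in> S"
    proof (rule AE_finite_allI)
      fix i assume i: "i \<in> {1..n}"
      have rv: "(\<lambda>\<omega>. (X i \<omega>, Y i \<omega>)) \<in> measurable M borel"
        using sample(2) i by (auto simp: iid_sample_def M.indep_vars_def)
      have P_eq: "distr M borel (\<lambda>\<omega>. (X i \<omega>, Y i \<omega>)) = P" using sample(2) i by (auto simp: iid_sample_def)
      show "AE \<omega> in M. X i \<omega> \<in> S"
        using AE_distrD[OF rv, of "\<lambda>z. fst z \<in> S", unfolded P_eq, OF S_P] unfolding fst_conv .
    qed simp
    then obtain B3 where B3: "{\<omega> \<in> space M. \<not> (\<forall>i\<in>{1..n}. X i \<omega> \<in> S)} \<subseteq> B3" "B3 \<in> sets M" "emeasure M B3 = 0"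
      by (rule AE_E)
    define E where "E = E2 - (B1 \<union> B3)"
    have E: "E \<in> sets M" using E2(1) B1 B3(2) by (simp add: E_def)
    have pE: "measure M E \<ge> 1 - \<epsilon>"
    proof -
      have "measure M E2 \<le> measure M (E \<union> (B1 \<union> B3))"
        using E E2(1) B1 B3(2) by (intro M.finite_measure_mono) (auto simp: E_def)
      also have "\<dots> \<le> measure M E + measure M (B1 \<union> B3)"
        using E B1 B3(2) by (intro measure_Un_le) auto
      also have "measure M (B1 \<union> B3) \<le> measure M B1 + measure M B3"
        using B1 B3(2) by (intro measure_Un_le) auto
      also have "measure M B3 = 0" using B3(3) by (simp add: measure_def)
      finally show ?thesis using pB1 E2(2) by simp
    qed
    have "close_fit S \<psi> \<alpha>0 (C * real n powr (- 1 / 3)) (\<alpha>' n \<omega>) (\<Psi>' n \<omega>)" if \<omega>E: "\<omega> \<in> E" for \<omega>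
      unfolding close_fit_def
    proof (intro conjI)
      have \<omega>: "\<omega> \<in> space M" using \<omega>E E sets.sets_into_space by blast
      have dist2: "norm (\<alpha>' n \<omega> - \<alpha>0) \<le> \<bar>C2\<bar> / r"
      proof -
        have "norm (\<alpha>' n \<omega> - \<alpha>0) \<le> C2 * (1 / r)" using E2(3) \<omega>E by (simp add: E_def r_inv')
        also have "\<dots> \<le> \<bar>C2\<bar> * (1 / r)" using r(1) by (intro mult_right_mono) auto
        finally show ?thesis by simp
      qed
      also have "\<bar>C2\<bar> / r \<le> C / r" using C(1) r(1) by (intro divide_right_mono) auto
      finally show "norm (\<alpha>' n \<omega> - \<alpha>0) \<le> C * real n powr (- 1 / 3)" by (simp add: r_inv')
      have XS: "\<forall>i\<in>{1..n}. X i \<omega> \<in> S" using \<omega>E \<omega> B3(1) by (auto simp: E_def)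
      define \<alpha> where "\<alpha> = \<alpha>' n \<omega>"
      define J where "J = {1..n} - I1 n \<omega>"
      define z where "z = (\<lambda>i\<in>J. (X i \<omega>, Y i \<omega>))"
      have \<alpha>: "\<alpha> \<in> sphere 0 1" "- \<alpha> \<in> sphere 0 1" using estimator(2)[OF n \<omega>] by (auto simp: \<alpha>_def)
      have I1: "I1 n \<omega> \<in> first_index_sets p n"
        using split(3) n \<omega> unfolding random_split_def by (auto dest!: measurable_space)
      note size = second_subsample_size[OF I1 split(1,2) n, folded J_def]
      have "ennreal (1 / c) * H n \<omega> < 1" using \<omega>E \<omega> by (auto simp: E_def B1_def)
      then have "ennreal c * (ennreal (1 / c) * H n \<omega>) \<le> ennreal c * 1" by (intro mult_left_mono) auto
      then have "H n \<omega> \<le> ennreal c" using c by (simp add: mult.assoc[symmetric] flip: ennreal_mult')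
      then have "ennreal (direction_loss S e \<rho> n J \<alpha> z) + ennreal (direction_loss S e \<rho> n J (- \<alpha>) z) \<le> ennreal c"
        using \<alpha>(1) unfolding H_def F_def J_def[symmetric] z_def \<alpha>_def[symmetric] by simp
      then have "ennreal (direction_loss S e \<rho> n J \<alpha> z) \<le> ennreal c"
        "ennreal (direction_loss S e \<rho> n J (- \<alpha>) z) \<le> ennreal c"
        using order_trans[OF add_increasing2[OF zero_le order_refl]] order_trans[OF add_increasing[OF zero_le order_refl]]
        by blast+
      then have loss: "direction_loss S e \<rho> n J \<alpha> z \<le> c" "direction_loss S e \<rho> n J (- \<alpha>) z \<le> c"
        using c by (auto simp: ennreal_le_iff)
      define lo where "lo = - support_function S (- \<alpha>)"
      define hi where "hi = support_function S \<alpha>"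
      define K where "K = cells n"
      define m where "m = real (card J) * \<rho>"
      define N1 where "N1 = nat \<lceil>m / (2 * real K)\<rceil>"
      define N2 where "N2 = nat \<lceil>m / (2 * (real K)\<^sup>2)\<rceil>"
      have lohi: "lo < hi" "hi - lo \<le> 1 / q_low" using len[OF \<alpha>(1)] by (auto simp: lo_def hi_def)
      have m: "m > 0" using size(1,2) q by (simp add: m_def \<rho>_def card_gt_0_iff)
      have Kpos: "real K > 0" using r(3) by (simp add: K_def)
      have "0 < m / (2 * real K)" "0 < m / (2 * (real K)\<^sup>2)" using m Kpos by auto
      then have N12: "N1 \<ge> 1" "N2 \<ge> 1" unfolding N1_def N2_def by linarith+
      have f1: "well_filled lo hi K N1 N2 J (\<lambda>j. \<alpha> \<bullet> fst (z j))"
        "noise_bound lo hi K N1 N2 J (\<lambda>j. \<alpha> \<bullet> fst (z j)) (\<lambda>j. e (z j)) \<le> c / r\<^sup>2"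
        using direction_loss_le_imp[OF loss(1) cn n] lohi
        unfolding lo_def hi_def K_def N1_def N2_def m_def r_def by auto
      have f2: "well_filled (- hi) (- lo) K N1 N2 J (\<lambda>j. - (\<alpha> \<bullet> fst (z j)))"
        "noise_bound (- hi) (- lo) K N1 N2 J (\<lambda>j. - (\<alpha> \<bullet> fst (z j))) (\<lambda>j. e (z j)) \<le> c / r\<^sup>2"
        using direction_loss_le_imp[OF loss(2) cn n] lohi
        unfolding lo_def hi_def K_def N1_def N2_def m_def r_def by auto
      have zJ: "z i = (X i \<omega>, Y i \<omega>)" "X i \<omega> \<in> S" if "i \<in> J" for i
        using that XS by (auto simp: z_def J_def)
      define \<delta> where "\<delta> = L * R * \<bar>C2\<bar> / r"
      have \<delta>: "0 \<le> \<delta>" using L R r(1) by (simp add: \<delta>_def)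
      have "(\<integral>\<^sup>+s. ennreal ((\<Psi>' n \<omega> s - \<psi> s)\<^sup>2) * indicator {lo..hi} s \<partial>lborel)
        \<le> ennreal (6 * (hi - lo) * ((2 * L * (hi - lo) / real K)\<^sup>2 + \<delta>\<^sup>2)
            + 3 * noise_bound lo hi K N1 N2 J (\<lambda>j. \<alpha> \<bullet> fst (z j)) (\<lambda>j. e (z j))
            + 3 * noise_bound (- hi) (- lo) K N1 N2 J (\<lambda>j. - (\<alpha> \<bullet> fst (z j))) (\<lambda>j. e (z j)))"
      proof (rule isotonic_lse_integral_bound[where y="\<lambda>j. snd (z j)", OF size(1,2) _ \<psi>(1,2) \<delta>])
        show "monotone_lse J (\<lambda>j. \<alpha> \<bullet> fst (z j)) (\<lambda>j. snd (z j)) (\<Psi>' n \<omega>)"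
          using lse[OF n \<omega>] unfolding J_def[symmetric] \<alpha>_def[symmetric]
          by (subst monotone_lse_cong) (auto simp: zJ)
        fix i assume i: "i \<in> J"
        have x: "X i \<omega> \<in> S" "fst (z i) = X i \<omega>" using zJ[OF i] by auto
        have "snd (z i) - \<psi> (\<alpha> \<bullet> fst (z i)) - e (z i) = \<psi> (\<alpha>0 \<bullet> X i \<omega>) - \<psi> (\<alpha> \<bullet> X i \<omega>)"
          using x \<psi>(3)[of "\<alpha>0 \<bullet> X i \<omega>"] by (simp add: e_def index_range_def)
        also have "\<bar>\<dots>\<bar> \<le> L * \<bar>\<alpha>0 \<bullet> X i \<omega> - \<alpha> \<bullet> X i \<omega>\<bar>"
          using lipschitz_onD[OF \<psi>(2)] by (simp add: dist_real_def)
        also have "\<dots> \<le> L * (norm (\<alpha> - \<alpha>0) * norm (X i \<omega>))"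
          using Cauchy_Schwarz_ineq2[of "\<alpha>0 - \<alpha>" "X i \<omega>"] L
          by (intro mult_left_mono) (auto simp: inner_diff_left norm_minus_commute)
        also have "\<dots> \<le> L * ((\<bar>C2\<bar> / r) * R)"
          using dist2 bd[OF x(1)] L R r(1) unfolding \<alpha>_def by (intro mult_left_mono mult_mono) auto
        also have "\<dots> = \<delta>" by (simp add: \<delta>_def)
        finally show "\<bar>snd (z i) - \<psi> (\<alpha> \<bullet> fst (z i)) - e (z i)\<bar> \<le> \<delta>" .
        show "lo \<le> \<alpha> \<bullet> fst (z i) \<and> \<alpha> \<bullet> fst (z i) \<le> hi"
          unfolding x(2) lo_def hi_def using support_function_upper[of S R "X i \<omega>" \<alpha>] bd x(1) by blast
      qed (use lohi r(3) N12 f1 f2 K_def in auto)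
      also have "\<dots> \<le> ennreal (D / r\<^sup>2)"
      proof (rule ennreal_leI)
        have "2 * L * (hi - lo) / real K \<le> 2 * L * (1 / q_low) / r"
          using lohi L r q unfolding K_def by (intro frac_le mult_left_mono) auto
        then have "(2 * L * (hi - lo) / real K)\<^sup>2 \<le> (2 * L * (1 / q_low) / r)\<^sup>2"
          using L lohi by (intro power_mono) auto
        then have "6 * (hi - lo) * ((2 * L * (hi - lo) / real K)\<^sup>2 + \<delta>\<^sup>2)
            \<le> 6 * (1 / q_low) * ((2 * L * (1 / q_low) / r)\<^sup>2 + \<delta>\<^sup>2)"
          using lohi q by (intro mult_mono) auto
        also have "\<dots> = 6 * (1 / q_low) * ((2 * L * (1 / q_low))\<^sup>2 + (L * R * \<bar>C2\<bar>)\<^sup>2) / r\<^sup>2"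
          by (simp only: \<delta>_def power_divide add_divide_distrib[symmetric] times_divide_eq_right)
        finally have "6 * (hi - lo) * ((2 * L * (hi - lo) / real K)\<^sup>2 + \<delta>\<^sup>2)
            \<le> 6 * (1 / q_low) * ((2 * L * (1 / q_low))\<^sup>2 + (L * R * \<bar>C2\<bar>)\<^sup>2) / r\<^sup>2" .
        moreover have "D / r\<^sup>2 = 6 * (1 / q_low) * ((2 * L * (1 / q_low))\<^sup>2 + (L * R * \<bar>C2\<bar>)\<^sup>2) / r\<^sup>2 + 3 * (c / r\<^sup>2) + 3 * (c / r\<^sup>2)"
          unfolding D_def add_divide_distrib by simp
        ultimately show "6 * (hi - lo) * ((2 * L * (hi - lo) / real K)\<^sup>2 + \<delta>\<^sup>2)
            + 3 * noise_bound lo hi K N1 N2 J (\<lambda>j. \<alpha> \<bullet> fst (z j)) (\<lambda>j. e (z j))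
            + 3 * noise_bound (- hi) (- lo) K N1 N2 J (\<lambda>j. - (\<alpha> \<bullet> fst (z j))) (\<lambda>j. e (z j)) \<le> D / r\<^sup>2"
          using f1(2) f2(2) by linarith
      qed
      also have "\<dots> \<le> ennreal ((C * real n powr (- 1 / 3))\<^sup>2)"
        unfolding r_inv using C(2) r(1) by (intro ennreal_leI) (simp add: power_divide divide_right_mono)
      finally show "(\<integral>\<^sup>+s. ennreal ((\<Psi>' n \<omega> s - \<psi> s)\<^sup>2)
         * indicator {- support_function S (- \<alpha>' n \<omega>)..support_function S (\<alpha>' n \<omega>)} s \<partial>lborel)
       \<le> ennreal ((C * real n powr (- 1 / 3))\<^sup>2)" unfolding lo_def hi_def \<alpha>_def .
    qed
    then show ?case using E pE by blast
  qed
  then show ?thesis by blast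
qed

section \<open>The plug-in estimator\<close>

text \<open>
  If the integrand is not integrable, its Bochner integral is \<open>0\<close> and the bound holds as well.
\<close>

lemma sqrt_set_integral_le:
  fixes f :: "'a \<Rightarrow> real"
  assumes f: "\<And>x. 0 \<le> f x" and c: "0 \<le> c"
    and le: "(\<integral>\<^sup>+x. ennreal (f x) * indicator A x \<partial>M) \<le> ennreal (c\<^sup>2)"
  shows "norm (sqrt (LINT x:A|M. f x)) \<le> c"
proof -
  have "(\<integral>\<^sup>+x. ennreal (indicator A x *\<^sub>R f x) \<partial>M) = (\<integral>\<^sup>+x. ennreal (f x) * indicator A x \<partial>M)"
    by (intro nn_integral_cong) (simp add: indicator_def)
  then have "(LINT x:A|M. f x) \<le> c\<^sup>2"
    unfolding set_lebesgue_integral_def using le by (intro integral_real_bounded) auto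
  moreover have "0 \<le> (LINT x:A|M. f x)"
    unfolding set_lebesgue_integral_def using f by (intro integral_nonneg_AE) auto
  ultimately show ?thesis using c by (simp add: real_le_lsqrt)
qed

lemma support_function_le_norm:
  assumes bd: "\<And>x. x \<in> S \<Longrightarrow> norm x \<le> R" and ne: "S \<noteq> {}"
  shows "support_function S \<alpha> \<le> norm \<alpha> * R"
  unfolding support_function_def
proof (rule cSup_least)
  show "index_range S \<alpha> \<noteq> {}" using ne by (simp add: index_range_def)
  fix t assume "t \<in> index_range S \<alpha>"
  then obtain x where x: "x \<in> S" "t = \<alpha> \<bullet> x" by (auto simp: index_range_def)
  have "\<alpha> \<bullet> x \<le> norm \<alpha> * norm x" by (rule norm_cauchy_schwarz)
  also have "\<dots> \<le> norm \<alpha> * R" by (intro mult_left_mono bd x) auto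
  finally show "t \<le> norm \<alpha> * R" by (simp add: x(2))
qed

text \<open>
  The error splits into \<open>\<Phi> - \<psi>\<close> at \<open>\<alpha>\<^sup>T x\<close>, whose integral over \<open>S\<close> is compared with one over the line, and
  the change of \<open>\<psi>\<close> between \<open>\<alpha>\<^sup>T x\<close> and \<open>\<alpha>\<^sub>0\<^sup>T x\<close>, which is at most \<open>L R d\<close>.
\<close>

lemma prediction_error_le:
  fixes S :: "(real ^ 'd) set" and \<alpha> \<alpha>0 :: "real ^ 'd" and L R d :: real
  assumes bd: "\<And>x. x \<in> S \<Longrightarrow> norm x \<le> R" and ne: "S \<noteq> {}" and \<alpha>: "norm \<alpha> = 1"
    and mono: "mono \<Phi>" "mono \<psi>" and lip: "L-lipschitz_on UNIV \<psi>"
    and g0: "\<And>x. x \<in> S \<Longrightarrow> g0 x = \<psi> (\<alpha>0 \<bullet> x)"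
    and fit: "close_fit S \<psi> \<alpha>0 d \<alpha> \<Phi>"
  shows "norm (sqrt (LINT x:S|lebesgue. (\<Phi> (\<alpha> \<bullet> x) - g0 x)\<^sup>2))
    \<le> sqrt (CARD('d) * (2 * R) ^ (CARD('d) - 1) * (2 + 4 * R * (L * R)\<^sup>2)) * d"
proof (rule sqrt_set_integral_le)
  have d: "norm (\<alpha> - \<alpha>0) \<le> d" "0 \<le> d"
    and I: "(\<integral>\<^sup>+s. ennreal ((\<Phi> s - \<psi> s)\<^sup>2)
         * indicator {- support_function S (- \<alpha>)..support_function S \<alpha>} s \<partial>lborel) \<le> ennreal (d\<^sup>2)"
    using fit order_trans[OF norm_ge_zero] by (auto simp: close_fit_def)
  obtain x0 where x0: "x0 \<in> S" using ne by blast
  then have R: "0 \<le> R" using bd[of x0] norm_ge_zero[of x0] by linarith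
  have L: "0 \<le> L" using lip by (rule lipschitz_on_nonneg)
  note [measurable] = borel_measurable_mono[OF mono(1)] borel_measurable_mono[OF mono(2)]
  define lo where "lo = - support_function S (- \<alpha>)"
  define hi where "hi = support_function S \<alpha>"
  have lohi: "lo \<le> hi" "hi - lo \<le> 2 * R"
    using support_function_upper[of S R x0 \<alpha>] bd x0 support_function_le_norm[OF bd ne, of \<alpha>]
      support_function_le_norm[OF bd ne, of "- \<alpha>"] \<alpha> by (auto simp: lo_def hi_def)
  \<comment> \<open>The constant is kept inside the indicator of \<open>C\<^sub>\<alpha>\<close>, so that it is integrable on the line.\<close>
  define k where "k = 2 * (L * R * d)\<^sup>2"
  define \<phi> where "\<phi> t = (2 * ennreal ((\<Phi> t - \<psi> t)\<^sup>2) + ennreal k) * indicator {lo..hi} t" for t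
  have \<phi>_m [measurable]: "\<phi> \<in> borel_measurable borel" unfolding \<phi>_def by measurable
  define Cd where "Cd = real CARD('d) * (2 * R) ^ (CARD('d) - 1)"
  have Cd: "0 \<le> Cd" using R by (simp add: Cd_def)
  have A0: "0 \<le> Cd * (2 + 4 * R * (L * R)\<^sup>2)" using Cd R by (intro mult_nonneg_nonneg add_nonneg_nonneg) auto
  then show "0 \<le> sqrt (CARD('d) * (2 * R) ^ (CARD('d) - 1) * (2 + 4 * R * (L * R)\<^sup>2)) * d"
    using d(2) unfolding Cd_def by simp
  show "0 \<le> (\<Phi> (\<alpha> \<bullet> x) - g0 x)\<^sup>2" for x by simp
  have "(\<integral>\<^sup>+x. ennreal ((\<Phi> (\<alpha> \<bullet> x) - g0 x)\<^sup>2) * indicator S x \<partial>lebesgue)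
      \<le> (\<integral>\<^sup>+x. (if \<forall>b\<in>Basis. \<bar>x \<bullet> b\<bar> \<le> R then \<phi> (\<alpha> \<bullet> x) else 0) \<partial>lebesgue)"
  proof (rule nn_integral_mono)
    fix x :: "real ^ 'd"
    show "ennreal ((\<Phi> (\<alpha> \<bullet> x) - g0 x)\<^sup>2) * indicator S x
        \<le> (if \<forall>b\<in>Basis. \<bar>x \<bullet> b\<bar> \<le> R then \<phi> (\<alpha> \<bullet> x) else 0)"
    proof (cases "x \<in> S")
      case True
      have box: "\<forall>b\<in>Basis. \<bar>x \<bullet> b\<bar> \<le> R"
        using Basis_le_norm bd[OF True] by (meson order_trans)
      have range: "\<alpha> \<bullet> x \<in> {lo..hi}"
        using support_function_upper[of S R x \<alpha>] bd True by (auto simp: lo_def hi_def)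
      have "\<bar>\<psi> (\<alpha> \<bullet> x) - g0 x\<bar> \<le> L * \<bar>(\<alpha> - \<alpha>0) \<bullet> x\<bar>"
        using lipschitz_onD[OF lip, of "\<alpha> \<bullet> x" "\<alpha>0 \<bullet> x"] g0[OF True] by (simp add: dist_real_def inner_diff_left)
      also have "\<dots> \<le> L * (norm (\<alpha> - \<alpha>0) * norm x)"
        using L by (intro mult_left_mono Cauchy_Schwarz_ineq2)
      also have "\<dots> \<le> L * (d * R)"
        using d bd[OF True] L by (intro mult_left_mono mult_mono) auto
      finally have "\<bar>\<psi> (\<alpha> \<bullet> x) - g0 x\<bar> \<le> L * R * d" by (simp add: mult_ac)
      then have "(\<psi> (\<alpha> \<bullet> x) - g0 x)\<^sup>2 \<le> (L * R * d)\<^sup>2"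
        by (rule power2_le_iff_abs_le[THEN iffD2, rotated]) (use L R d in auto)
      moreover have "(\<Phi> (\<alpha> \<bullet> x) - g0 x)\<^sup>2 \<le> 2 * (\<Phi> (\<alpha> \<bullet> x) - \<psi> (\<alpha> \<bullet> x))\<^sup>2 + 2 * (\<psi> (\<alpha> \<bullet> x) - g0 x)\<^sup>2"
        using zero_le_power2[of "(\<Phi> (\<alpha> \<bullet> x) - \<psi> (\<alpha> \<bullet> x)) - (\<psi> (\<alpha> \<bullet> x) - g0 x)"]
        by (simp add: power2_eq_square algebra_simps)
      ultimately have "(\<Phi> (\<alpha> \<bullet> x) - g0 x)\<^sup>2 \<le> 2 * (\<Phi> (\<alpha> \<bullet> x) - \<psi> (\<alpha> \<bullet> x))\<^sup>2 + k"
        unfolding k_def by linarith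
      then have "ennreal ((\<Phi> (\<alpha> \<bullet> x) - g0 x)\<^sup>2) \<le> ennreal (2 * (\<Phi> (\<alpha> \<bullet> x) - \<psi> (\<alpha> \<bullet> x))\<^sup>2 + k)"
        by (rule ennreal_leI)
      also have "\<dots> = \<phi> (\<alpha> \<bullet> x)"
        using range by (simp add: \<phi>_def ennreal_plus ennreal_mult k_def)
      finally show ?thesis using True box by simp
    qed simp
  qed
  also have "\<dots> = (\<integral>\<^sup>+x. (if \<forall>b\<in>Basis. \<bar>x \<bullet> b\<bar> \<le> R then \<phi> (\<alpha> \<bullet> x) else 0) \<partial>lborel)"
    by (rule nn_integral_completion) 
  also have "\<dots> \<le> ennreal Cd * (\<integral>\<^sup>+t. \<phi> t \<partial>lborel)"
    using nn_integral_projection_le[OF \<alpha> R \<phi>_m] by (simp add: Cd_def)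
  also have "\<dots> \<le> ennreal Cd * ennreal ((2 + 4 * R * (L * R)\<^sup>2) * d\<^sup>2)"
  proof (rule mult_left_mono)
    have "(\<integral>\<^sup>+t. \<phi> t \<partial>lborel) = (\<integral>\<^sup>+t. 2 * (ennreal ((\<Phi> t - \<psi> t)\<^sup>2) * indicator {lo..hi} t) + ennreal k * indicator {lo..hi} t \<partial>lborel)"
      unfolding \<phi>_def by (intro nn_integral_cong) (simp add: distrib_right mult.assoc)
    also have "\<dots> = 2 * (\<integral>\<^sup>+t. ennreal ((\<Phi> t - \<psi> t)\<^sup>2) * indicator {lo..hi} t \<partial>lborel) + ennreal k * ennreal (hi - lo)"
      using lohi by (subst nn_integral_add) (auto simp: nn_integral_cmult nn_integral_cmult_indicator)
    also have "\<dots> \<le> 2 * ennreal (d\<^sup>2) + ennreal k * ennreal (2 * R)"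
      using I lohi unfolding lo_def hi_def by (intro add_mono mult_left_mono ennreal_leI) auto
    also have "\<dots> = ennreal (2 * d\<^sup>2 + k * (2 * R))"
    proof -
      have "ennreal (2 * d\<^sup>2 + k * (2 * R)) = ennreal (2 * d\<^sup>2) + ennreal (k * (2 * R))"
        using R by (intro ennreal_plus) (auto simp: k_def)
      also have "ennreal (2 * d\<^sup>2) = 2 * ennreal (d\<^sup>2)" by (simp add: ennreal_mult)
      also have "ennreal (k * (2 * R)) = ennreal k * ennreal (2 * R)"
        using R by (intro ennreal_mult) (auto simp: k_def)
      finally show ?thesis ..
    qed
    also have "2 * d\<^sup>2 + k * (2 * R) = (2 + 4 * R * (L * R)\<^sup>2) * d\<^sup>2"
      by (simp add: k_def power_mult_distrib algebra_simps)
    finally show "(\<integral>\<^sup>+t. \<phi> t \<partial>lborel) \<le> ennreal ((2 + 4 * R * (L * R)\<^sup>2) * d\<^sup>2)" .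
  qed simp
  also have "\<dots> = ennreal ((sqrt (CARD('d) * (2 * R) ^ (CARD('d) - 1) * (2 + 4 * R * (L * R)\<^sup>2)) * d)\<^sup>2)"
    using A0 Cd R unfolding Cd_def by (simp add: power_mult_distrib mult.assoc flip: ennreal_mult')
  finally show "(\<integral>\<^sup>+x. ennreal ((\<Phi> (\<alpha> \<bullet> x) - g0 x)\<^sup>2) * indicator S x \<partial>lebesgue)
      \<le> ennreal ((sqrt (CARD('d) * (2 * R) ^ (CARD('d) - 1) * (2 + 4 * R * (L * R)\<^sup>2)) * d)\<^sup>2)" .
qed

lemma lipschitz_on_if_derivative_le:
  fixes \<Psi> :: "real \<Rightarrow> real"
  assumes mono: "mono \<Psi>" and I: "is_interval I"
    and D: "\<And>t. t \<in> I \<Longrightarrow> (\<Psi> has_real_derivative D t) (at t within I) \<and> D t \<le> K"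
  shows "(max K 0)-lipschitz_on I \<Psi>"
proof -
  have incr: "\<Psi> t - \<Psi> s \<le> max K 0 * (t - s)" if st: "s \<in> I" "t \<in> I" "s < t" for s t
  proof -
    have sub: "{s..t} \<subseteq> I"
      using I st(1,2) unfolding is_interval_1 by (meson atLeastAtMost_iff subsetI)
    have "\<exists>x\<in>{s<..<t}. \<Psi> t - \<Psi> s = D x * (t - s)"
    proof (rule mvt_simple[OF st(3)])
      fix x assume "s \<le> x" "x \<le> t"
      then have "(\<Psi> has_real_derivative D x) (at x within {s..t})"
        using D[of x] sub by (intro DERIV_subset[OF _ sub]) auto
      then show "(\<Psi> has_derivative (*) (D x)) (at x within {s..t})"
        by (simp add: has_field_derivative_def)
    qed
    then obtain x where x: "x \<in> {s<..<t}" "\<Psi> t - \<Psi> s = D x * (t - s)" by blast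
    then have "x \<in> I" using sub by (auto simp: subset_iff)
    then have "D x \<le> max K 0" using D[of x] by (simp add: le_max_iff_disj)
    then show ?thesis unfolding x(2) using st(3) by (intro mult_right_mono) auto
  qed
  show ?thesis
  proof (rule lipschitz_onI)
    fix s t assume st: "s \<in> I" "t \<in> I"
    show "dist (\<Psi> s) (\<Psi> t) \<le> max K 0 * dist s t"
    proof (cases s t rule: linorder_cases)
      case less
      then show ?thesis using incr[OF st less] monoD[OF mono, of s t] by (simp add: dist_real_def)
    next
      case greater
      then show ?thesis using incr[OF st(2,1) greater] monoD[OF mono, of t s] by (simp add: dist_real_def)
    qed simp
  qed simp
qed

text \<open>
  Each end point of the index range moves by at most \<open>R \<bar>\<alpha> - \<alpha>0\<bar> \<le> v\<close> if \<open>\<alpha>0\<close> is replaced by \<open>\<alpha>\<close>, so the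
  shortened range of \<open>\<alpha>0\<close> lies in the range of \<open>\<alpha>\<close>; as \<open>v > 0\<close>, \<open>\<psi>\<close> and \<open>\<Psi>0\<close> agree on it.
\<close>

lemma interior_error_le:
  fixes S :: "(real ^ 'd) set"
  assumes cv: "convex S" and ne: "S \<noteq> {}" and bd: "\<And>x. x \<in> S \<Longrightarrow> norm x \<le> R"
    and \<psi>: "\<And>t. t \<in> index_range S \<alpha>0 \<Longrightarrow> \<psi> t = \<Psi>0 t"
    and fit: "close_fit S \<psi> \<alpha>0 d \<alpha> \<Phi>" and v: "R * d \<le> v" "0 < v"
  shows "norm (sqrt (LINT t:{Inf (index_range S \<alpha>0) + v .. Sup (index_range S \<alpha>0) - v}|lborel.
    (\<Phi> t - \<Psi>0 t)\<^sup>2)) \<le> d"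
proof (rule sqrt_set_integral_le)
  let ?I = "{Inf (index_range S \<alpha>0) + v .. Sup (index_range S \<alpha>0) - v}"
  have d: "norm (\<alpha> - \<alpha>0) \<le> d" using fit by (simp add: close_fit_def)
  show "0 \<le> d" using order_trans[OF norm_ge_zero d] .
  obtain x0 where "x0 \<in> S" using ne by blast
  then have R: "0 \<le> R" using bd[of x0] norm_ge_zero[of x0] by linarith
  have shift: "R * norm (\<alpha>0 - \<alpha>) \<le> v" "R * norm (- \<alpha>0 - - \<alpha>) \<le> v"
    using mult_left_mono[OF d R] v(1) by (auto simp: norm_minus_commute)
  have endpoints: "support_function S \<alpha>0 - v \<le> support_function S \<alpha>"
    "support_function S (- \<alpha>0) - v \<le> support_function S (- \<alpha>)"
    using support_function_le[OF bd ne, of \<alpha>0 \<alpha>] support_function_le[OF bd ne, of "- \<alpha>0" "- \<alpha>"] shift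
    by linarith+
  have "(\<integral>\<^sup>+t. ennreal ((\<Phi> t - \<Psi>0 t)\<^sup>2) * indicator ?I t \<partial>lborel)
      \<le> (\<integral>\<^sup>+s. ennreal ((\<Phi> s - \<psi> s)\<^sup>2)
         * indicator {- support_function S (- \<alpha>)..support_function S \<alpha>} s \<partial>lborel)"
  proof (rule nn_integral_mono)
    fix t
    show "ennreal ((\<Phi> t - \<Psi>0 t)\<^sup>2) * indicator ?I t
        \<le> ennreal ((\<Phi> t - \<psi> t)\<^sup>2) * indicator {- support_function S (- \<alpha>)..support_function S \<alpha>} t"
    proof (cases "t \<in> ?I")
      case True
      then have t: "- support_function S (- \<alpha>0) + v \<le> t" "t \<le> support_function S \<alpha>0 - v"
        by (auto simp: Inf_index_range support_function_def[of S \<alpha>0])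
      then have "t \<in> {- support_function S (- \<alpha>0)<..<support_function S \<alpha>0}" using v(2) by auto
      then have "\<psi> t = \<Psi>0 t" using Ioo_subset_index_range[OF cv ne bd, of \<alpha>0] by (intro \<psi>) blast
      moreover have "t \<in> {- support_function S (- \<alpha>)..support_function S \<alpha>}"
        using t endpoints by auto
      ultimately show ?thesis by (simp add: indicator_def)
    qed simp
  qed
  then show "(\<integral>\<^sup>+t. ennreal ((\<Phi> t - \<Psi>0 t)\<^sup>2) * indicator ?I t \<partial>lborel) \<le> ennreal (d\<^sup>2)"
    using fit by (auto simp: close_fit_def intro: order_trans)
qed simp

lemma O_pI:
  assumes tight: "\<And>\<epsilon>. 0 < \<epsilon> \<Longrightarrow> \<exists>C. \<forall>\<^sub>F n in sequentially. \<exists>E\<in>sets M. measure M E \<ge> 1 - \<epsilon> \<and> (\<forall>\<omega>\<in>E. Q n (C * r n) \<omega>)"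
    and bound: "\<And>C. \<forall>\<^sub>F n in sequentially. \<forall>\<omega>\<in>space M. Q n (C * r n) \<omega> \<longrightarrow> norm (Z n \<omega>) \<le> A * (C * r n)"
  shows "O_p M Z r"
  unfolding O_p_def
proof (intro allI impI)
  fix \<epsilon> :: real assume "0 < \<epsilon>"
  from tight[OF this] obtain C where
    C: "\<forall>\<^sub>F n in sequentially. \<exists>E\<in>sets M. measure M E \<ge> 1 - \<epsilon> \<and> (\<forall>\<omega>\<in>E. Q n (C * r n) \<omega>)" ..
  show "\<exists>C. \<forall>\<^sub>F n in sequentially. \<exists>E\<in>sets M. measure M E \<ge> 1 - \<epsilon> \<and> (\<forall>\<omega>\<in>E. norm (Z n \<omega>) \<le> C * r n)"
  proof (rule exI[of _ "A * C"])
    show "\<forall>\<^sub>F n in sequentially. \<exists>E\<in>sets M. measure M E \<ge> 1 - \<epsilon> \<and> (\<forall>\<omega>\<in>E. norm (Z n \<omega>) \<le> A * C * r n)"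
      using C bound[of C]
    proof eventually_elim
      case (elim n)
      then obtain E where E: "E \<in> sets M" "measure M E \<ge> 1 - \<epsilon>" "\<forall>\<omega>\<in>E. Q n (C * r n) \<omega>" by blast
      have "norm (Z n \<omega>) \<le> A * C * r n" if "\<omega> \<in> E" for \<omega>
        using elim(2) E(3) that sets.sets_into_space[OF E(1)] unfolding mult.assoc by blast
      then show ?case using E(1,2) by (intro bexI[OF _ E(1)] conjI ballI)
    qed
  qed
qed

theorem theorem6p1:
  fixes P :: "((real ^ 'd) \<times> real) measure"
    and S :: "(real ^ 'd) set"
    and \<kappa> :: "real ^ 'd \<Rightarrow> real measure"
    and \<Psi>0 :: "real \<Rightarrow> real" and \<alpha>0 :: "real ^ 'd" and g0 :: "real ^ 'd \<Rightarrow> real"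
    and M :: "'w measure"
    and X :: "nat \<Rightarrow> 'w \<Rightarrow> real ^ 'd" and Y :: "nat \<Rightarrow> 'w \<Rightarrow> real"
    and p :: real and I1 :: "nat \<Rightarrow> 'w \<Rightarrow> nat set"
    and \<alpha>' :: "nat \<Rightarrow> 'w \<Rightarrow> real ^ 'd" and \<Psi>' :: "nat \<Rightarrow> 'w \<Rightarrow> real \<Rightarrow> real"
  assumes law: "prob_space P" "sets P = sets borel"
    and continuous_law: "\<exists>q. has_lebesgue_density P q"
    and support: "is_support (design_law P) S"
    and conditional_law: "is_conditional_law P \<kappa>"
    and index: "\<alpha>0 \<in> sphere 0 1"
    and model: "monotone_single_index P \<Psi>0 \<alpha>0"
    and identifiable: "identifiable_index P \<alpha>0"
    and g0: "\<And>x. g0 x = \<Psi>0 (\<alpha>0 \<bullet> x)"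
    and sample: "prob_space M" "iid_sample M P X Y"
    and split: "0 < p" "p < 1" "random_split M p X Y I1"
    and estimator: "first_subsample_estimator M p X Y I1 \<alpha>'"
      "\<And>n \<omega>. n \<ge> 1 \<Longrightarrow> \<omega> \<in> space M \<Longrightarrow> \<alpha>' n \<omega> \<in> sphere 0 1"
    and rate: "O_p M (\<lambda>n \<omega>. \<alpha>' n \<omega> - \<alpha>0) (\<lambda>n. real n powr (- 1 / 3))"
    and lse: "\<And>n \<omega>. n \<ge> 1 \<Longrightarrow> \<omega> \<in> space M \<Longrightarrow>
      monotone_lse ({1..n} - I1 n \<omega>) (\<lambda>i. \<alpha>' n \<omega> \<bullet> X i \<omega>) (\<lambda>i. Y i \<omega>) (\<Psi>' n \<omega>)"
    and conditions: "A1 S" "A2 S g0" "A3 S \<kappa>" "A4 S P"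
  shows
    "(\<not> \<Psi>0 constant_on index_range S \<alpha>0 \<and> (\<exists>L. L-lipschitz_on (index_range S \<alpha>0) \<Psi>0)
      \<longrightarrow> O_p M (\<lambda>n \<omega>. sqrt (LINT x:S|lebesgue. (\<Psi>' n \<omega> (\<alpha>' n \<omega> \<bullet> x) - g0 x)\<^sup>2))
            (\<lambda>n. real n powr (- 1 / 3)))
     \<and>
     (A5 S \<Psi>0 \<alpha>0 \<and> A6 S P \<and>
      (\<exists>D K. \<forall>t\<in>index_range S \<alpha>0.
         (\<Psi>0 has_real_derivative D t) (at t within index_range S \<alpha>0) \<and> D t \<le> K)
      \<longrightarrow> (\<forall>v :: nat \<Rightarrow> real.
            filterlim (\<lambda>n. real n powr (1 / 3) * v n) at_top sequentially \<longrightarrow>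
            (\<forall>n\<ge>1. Inf (index_range S \<alpha>0) + v n \<le> Sup (index_range S \<alpha>0) - v n) \<longrightarrow>
            O_p M (\<lambda>n \<omega>. sqrt (LINT t:{Inf (index_range S \<alpha>0) + v n .. Sup (index_range S \<alpha>0) - v n}|lborel.
                    (\<Psi>' n \<omega> t - \<Psi>0 t)\<^sup>2))
              (\<lambda>n. real n powr (- 1 / 3))))"
proof -
  interpret P: prob_space P by (rule law)
  have S_Q: "AE x in design_law P. x \<in> S" using support by (simp add: is_support_def)
  obtain R where bd: "\<And>x. x \<in> S \<Longrightarrow> norm x \<le> R" using conditions(1) by (auto simp: A1_def bounded_iff)
  have cv: "convex S" using conditions(1) by (simp add: A1_def)
  have fst_m: "fst \<in> measurable P borel" by (rule measurable_fst_borel[OF law(2)])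
  have ne: "S \<noteq> {}"
  proof
    assume "S = {}"
    then have "AE z in P. False" using AE_distrD[OF fst_m, of "\<lambda>x. x \<in> S"] S_Q unfolding design_law_def by simp
    then show False by simp
  qed
  have ne': "index_range S \<alpha>0 \<noteq> {}" using ne by (simp add: index_range_def)
  obtain x0 where "x0 \<in> S" using ne by blast
  then have R: "0 \<le> R" using bd[of x0] norm_ge_zero[of x0] by linarith
  have mono: "mono \<Psi>0" using model by (simp add: monotone_single_index_def)
  have mono': "mono (\<Psi>' n \<omega>)" if "n \<ge> 1" "\<omega> \<in> space M" for n \<omega>
    using lse[OF that] by (simp add: monotone_lse_def is_arg_min_def)
  have g0_eq: "g0 = (\<lambda>x. \<Psi>0 (\<alpha>0 \<bullet> x))" using g0 by blast
  have A2: "A2 S (\<lambda>x. \<Psi>0 (\<alpha>0 \<bullet> x))" using conditions(2) unfolding g0_eq .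
  obtain K0 where K0: "\<And>t. t \<in> index_range S \<alpha>0 \<Longrightarrow> \<bar>\<Psi>0 t\<bar> \<le> K0"
    using A2 by (auto simp: A2_def index_range_def)
  have tight: "\<exists>C. \<forall>\<^sub>F n in sequentially. \<exists>E\<in>sets M. measure M E \<ge> 1 - \<epsilon> \<and> (\<forall>\<omega>\<in>E.
      close_fit S \<psi> \<alpha>0 (C * real n powr (- 1 / 3)) (\<alpha>' n \<omega>) (\<Psi>' n \<omega>))"
    if "mono \<psi>" "L-lipschitz_on UNIV \<psi>" "\<And>t. t \<in> index_range S \<alpha>0 \<Longrightarrow> \<psi> t = \<Psi>0 t" "0 < \<epsilon>" for \<psi> L \<epsilon>
    by (rule plug_in_lse_rate[OF law S_Q conditional_law model sample split estimator(1) _ rate _ A2 conditions(3,4) cv])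
      (fact estimator(2) lse bd that)+
  show ?thesis
  proof (intro conjI impI allI)
    assume "\<not> \<Psi>0 constant_on index_range S \<alpha>0 \<and> (\<exists>L. L-lipschitz_on (index_range S \<alpha>0) \<Psi>0)"
    then obtain L where L: "L-lipschitz_on (index_range S \<alpha>0) \<Psi>0" by blast
    obtain \<psi> where \<psi>: "mono \<psi>" "L-lipschitz_on UNIV \<psi>" "\<And>t. t \<in> index_range S \<alpha>0 \<Longrightarrow> \<psi> t = \<Psi>0 t"
      using monotone_lipschitz_extension[OF mono L ne' K0] by blast
    define A where "A = sqrt (CARD('d) * (2 * R) ^ (CARD('d) - 1) * (2 + 4 * R * (L * R)\<^sup>2))"
    show "O_p M (\<lambda>n \<omega>. sqrt (LINT x:S|lebesgue. (\<Psi>' n \<omega> (\<alpha>' n \<omega> \<bullet> x) - g0 x)\<^sup>2))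
            (\<lambda>n. real n powr (- 1 / 3))"
    proof (rule O_pI[OF tight[OF \<psi>]])
      fix C :: real
      show "\<forall>\<^sub>F n in sequentially. \<forall>\<omega>\<in>space M. close_fit S \<psi> \<alpha>0 (C * real n powr (- 1 / 3)) (\<alpha>' n \<omega>) (\<Psi>' n \<omega>) \<longrightarrow>
          norm (sqrt (LINT x:S|lebesgue. (\<Psi>' n \<omega> (\<alpha>' n \<omega> \<bullet> x) - g0 x)\<^sup>2)) \<le> A * (C * real n powr (- 1 / 3))"
        using eventually_ge_at_top[of 1]
      proof (eventually_elim, intro ballI impI)
        fix n \<omega> assume n: "1 \<le> n" and \<omega>: "\<omega> \<in> space M"
          and fit: "close_fit S \<psi> \<alpha>0 (C * real n powr (- 1 / 3)) (\<alpha>' n \<omega>) (\<Psi>' n \<omega>)"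
        show "norm (sqrt (LINT x:S|lebesgue. (\<Psi>' n \<omega> (\<alpha>' n \<omega> \<bullet> x) - g0 x)\<^sup>2)) \<le> A * (C * real n powr (- 1 / 3))"
          unfolding A_def
        proof (rule prediction_error_le[OF bd ne _ mono'[OF n \<omega>] \<psi>(1,2) _ fit])
          show "norm (\<alpha>' n \<omega>) = 1" using estimator(2)[OF n \<omega>] by simp
          show "g0 x = \<psi> (\<alpha>0 \<bullet> x)" if "x \<in> S" for x
            using \<psi>(3)[of "\<alpha>0 \<bullet> x"] that by (simp add: g0 index_range_def)
        qed
      qed
    qed
  next
    fix v :: "nat \<Rightarrow> real"
    assume "A5 S \<Psi>0 \<alpha>0 \<and> A6 S P \<and> (\<exists>D K. \<forall>t\<in>index_range S \<alpha>0.
         (\<Psi>0 has_real_derivative D t) (at t within index_range S \<alpha>0) \<and> D t \<le> K)"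
      and v: "filterlim (\<lambda>n. real n powr (1 / 3) * v n) at_top sequentially"
    then obtain D K where D: "\<And>t. t \<in> index_range S \<alpha>0 \<Longrightarrow>
         (\<Psi>0 has_real_derivative D t) (at t within index_range S \<alpha>0) \<and> D t \<le> K" by blast
    have "convex (index_range S \<alpha>0)"
      unfolding index_range_def by (rule convex_linear_image[OF _ cv]) (intro bounded_linear.linear bounded_linear_inner_right)
    then have int: "is_interval (index_range S \<alpha>0)" by (simp add: is_interval_convex_1)
    have L: "(max K 0)-lipschitz_on (index_range S \<alpha>0) \<Psi>0" by (rule lipschitz_on_if_derivative_le[OF mono int D])
    obtain \<psi> where \<psi>: "mono \<psi>" "(max K 0)-lipschitz_on UNIV \<psi>" "\<And>t. t \<in> index_range S \<alpha>0 \<Longrightarrow> \<psi> t = \<Psi>0 t"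
      using monotone_lipschitz_extension[OF mono L ne' K0] by blast
    show "O_p M (\<lambda>n \<omega>. sqrt (LINT t:{Inf (index_range S \<alpha>0) + v n .. Sup (index_range S \<alpha>0) - v n}|lborel.
        (\<Psi>' n \<omega> t - \<Psi>0 t)\<^sup>2)) (\<lambda>n. real n powr (- 1 / 3))"
    proof (rule O_pI[OF tight[OF \<psi>], where A=1])
      fix C :: real
      have "\<forall>\<^sub>F n in sequentially. R * \<bar>C\<bar> + 1 \<le> real n powr (1 / 3) * v n"
        using v by (simp add: filterlim_at_top)
      then show "\<forall>\<^sub>F n in sequentially. \<forall>\<omega>\<in>space M. close_fit S \<psi> \<alpha>0 (C * real n powr (- 1 / 3)) (\<alpha>' n \<omega>) (\<Psi>' n \<omega>) \<longrightarrow>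
          norm (sqrt (LINT t:{Inf (index_range S \<alpha>0) + v n .. Sup (index_range S \<alpha>0) - v n}|lborel.
            (\<Psi>' n \<omega> t - \<Psi>0 t)\<^sup>2)) \<le> 1 * (C * real n powr (- 1 / 3))"
        using eventually_ge_at_top[of 1]
      proof (eventually_elim, intro ballI impI)
        fix n \<omega> assume vn: "R * \<bar>C\<bar> + 1 \<le> real n powr (1 / 3) * v n" and n: "1 \<le> n"
          and fit: "close_fit S \<psi> \<alpha>0 (C * real n powr (- 1 / 3)) (\<alpha>' n \<omega>) (\<Psi>' n \<omega>)"
        define r where "r = real n powr (1 / 3)"
        have r: "1 \<le> r" unfolding r_def by (rule cells_bounds[OF n])
        have r_inv: "real n powr (- 1 / 3) = 1 / r"
          using powr_minus_divide[of "real n" "1 / 3"] by (simp add: r_def)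
        have "R * C \<le> R * \<bar>C\<bar>" "0 \<le> R * \<bar>C\<bar>" using R by (auto intro: mult_left_mono)
        then have "R * C \<le> v n * r" "0 < v n * r"
          using vn unfolding r_def[symmetric] mult.commute[of r] by linarith+
        then have vn': "R * (C * real n powr (- 1 / 3)) \<le> v n" "0 < v n"
          unfolding r_inv using r by (simp_all add: pos_divide_le_eq zero_less_mult_iff)
        show "norm (sqrt (LINT t:{Inf (index_range S \<alpha>0) + v n .. Sup (index_range S \<alpha>0) - v n}|lborel.
            (\<Psi>' n \<omega> t - \<Psi>0 t)\<^sup>2)) \<le> 1 * (C * real n powr (- 1 / 3))"
          unfolding mult_1 by (rule interior_error_le[OF cv ne bd \<psi>(3) fit vn'])
      qed
    qed
  qed
qed

end
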